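(* Let $\Omega\subset\mathbb{R}^3$ be the reference domain, let $2<q<3$, and let the stored-energy function be $W(A)=|A|^q+Z(\operatorname{cof}A)+h(\det A)$ for $A\in\mathbb{R}^{3\times 3}$, where $Z:\mathbb{R}^{3\times3}\to[0,+\infty)$ is convex and $h:\mathbb{R}\to[0,+\infty]$ is convex and $C^1$ on $(0,+\infty)$, satisfies $\lim_{t\to0+}h(t)=+\infty$, $\liminf_{t\to+\infty}h(t)/t>0$, and $h(t)=+\infty$ for $t\le 0$. Let $I(u)=\int_\Omega W(\nabla u)\,dx$ and $u_\lambda(x)=\lambda x$ with $\lambda>0$. Let $\kappa$ be a constant with $2^{2-q}\le\kappa\le q2^{1-q}$ for which $|A|^q\geq|\lambda\mathbf{1}|^q+q|\lambda\mathbf{1}|^{q-2}\lambda\mathbf{1}\cdot(A-\lambda\mathbf{1})+\kappa|A-\lambda\mathbf{1}|^q$ for all $A$. Let $\lambda_1(A)\le\lambda_2(A)\le\lambda_3(A)$ be the singular values of $A$ and define $G(A)=\sum_{1\le i<j\le3}\lambda_i(A)\lambda_j(A)-\lambda\sum_{i=1}^3\lambda_i(A)-\big(\operatorname{tr}\operatorname{cof}A-\lambda\operatorname{tr}A\big)$, and, for $c_0>0$, $M_2(\lambda,c_0)=\sup\{|G(A)|/|A-\lambda\mathbf{1}|^2: |A-\lambda\mathbf{1}|\ge c_0\}$, $M_3(\lambda,c_0)=\sup\{|G(A)|/|A-\lambda\mathbf{1}|^3: 0<|A-\lambda\mathbf{1}|<c_0\}$. Suppose that $\lambda$ is chosen so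 that \[0\le\lambda^{3-q}h'(\lambda^3)\le\min\Big\{\tfrac{\kappa}{2}(q-2)^{(2-q)/2}q^{q/2},\ \tfrac{\kappa}{2}\lambda^{2-q}M_2(\lambda,c^* )^{q-3}M_3(\lambda,c^* )^{2-q}\Big\},\] where $c^*$ is the unique fixed point of the function $c_0\mapsto M_2(\lambda,c_0)/M_3(\lambda,c_0)$. Then $I(u)\ge I(u_\lambda)$ for any map $u\in H^1(\Omega,\mathbb{R}^3)$ whose boundary values agree with those of $u_\lambda$ in the sense of trace. In particular, the largest possible value $\lambda_0$ satisfying this two-sided inequality on $\lambda^{3-q}h'(\lambda^3)$ is a lower bound for $\lambda_{\mathrm{crit}}$ (the threshold value of $\lambda$ beyond which the inequality $I(u)\ge I(u_\lambda)$ fails for some admissible $u$). Moreover, if this inequality on $\lambda^{3-q}h'(\lambda^3)$ holds with strict inequality, then there is $C=C(\Omega)>0$ such that \[I(u)-I(u_\lambda)\ge C\int_\Omega|\nabla u-\lambda\mathbf{1}|^q+|G(\nabla u)|\,dx\] for all admissible $u$, i.e. all $u\in W^{1,q}(\Omega;\mathbb{R}^3)$ with $u=u_\lambda$ on $\partial\Omega$ and $I(u)<+\infty$.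
   Context: $\mathbf{1}$ is the $3\times3$ identity matrix; $\operatorname{cof}A$ is the cofactor matrix; $|A|$ is the Frobenius norm. $G=P-N$ where $P(A)=\sum_{i<j}\lambda_i\lambda_j-\lambda\sum_i\lambda_i$ and $N(A)=\operatorname{tr}\operatorname{cof}A-\lambda\operatorname{tr}A$ is a null Lagrangian, so $\int_\Omega P(\nabla u)=\int_\Omega G(\nabla u)$ for admissible $u$. The fixed point $c^*$ exists and is unique since $c_0\mapsto c_0^{q-2}/M_2(\lambda,c_0)$ is nondecreasing and $c_0\mapsto c_0^{q-3}/M_3(\lambda,c_0)$ is nonincreasing. *)

theory Defs
  imports "HOL-Analysis.Analysis"
begin

type_synonym vec3 = "real^3"
type_synonym mat3 = "real^3^3"

text \<open>Cofactor matrix: entry (i,j) is the determinant of A with row i replaced by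
  the j-th unit vector, i.e. (-1)^(i+j) times the (i,j) minor.\<close>
definition cof :: "mat3 \<Rightarrow> mat3" where
  "cof A = (\<chi> i j. det (\<chi> k. if k = i then axis j 1 else A $ k))"

definition diagm :: "vec3 \<Rightarrow> mat3" where
  "diagm s = (\<chi> i j. if i = j then s $ i else 0)"

definition singvals :: "mat3 \<Rightarrow> vec3" where
  "singvals A = (THE s. 0 \<le> s $ 1 \<and> s $ 1 \<le> s $ 2 \<and> s $ 2 \<le> s $ 3 \<and>
      (\<exists>U V. orthogonal_matrix U \<and> orthogonal_matrix V \<and> A = U ** diagm s ** transpose V))"

definition Gfun :: "real \<Rightarrow> mat3 \<Rightarrow> real" where
  "Gfun lam A = (let s = singvals A in
     (s$1 * s$2 + s$1 * s$3 + s$2 * s$3) - lam * (s$1 + s$2 + s$3)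
     - (trace (cof A) - lam * trace A))"

definition M2 :: "real \<Rightarrow> real \<Rightarrow> real" where
  "M2 lam c0 = Sup ((\<lambda>A. \<bar>Gfun lam A\<bar> / norm (A - mat lam) ^ 2) ` {A. norm (A - mat lam) \<ge> c0})"

definition M3 :: "real \<Rightarrow> real \<Rightarrow> real" where
  "M3 lam c0 = Sup ((\<lambda>A. \<bar>Gfun lam A\<bar> / norm (A - mat lam) ^ 3) `
      {A. 0 < norm (A - mat lam) \<and> norm (A - mat lam) < c0})"

definition cstar :: "real \<Rightarrow> real" where
  "cstar lam = (THE c. 0 < c \<and> M2 lam c / M3 lam c = c)"

definition lam_bound :: "real \<Rightarrow> real \<Rightarrow> real \<Rightarrow> real" where
  "lam_bound q kappa lam = min (kappa / 2 * (q - 2) powr ((2 - q) / 2) * q powr (q / 2))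
       (kappa / 2 * lam powr (2 - q) * M2 lam (cstar lam) powr (q - 3) * M3 lam (cstar lam) powr (2 - q))"

definition lam_quant :: "(real \<Rightarrow> ennreal) \<Rightarrow> real \<Rightarrow> real \<Rightarrow> real" where
  "lam_quant h q lam = lam powr (3 - q) * deriv (\<lambda>t. enn2real (h t)) (lam ^ 3)"

definition lam_cond :: "(real \<Rightarrow> ennreal) \<Rightarrow> real \<Rightarrow> real \<Rightarrow> real \<Rightarrow> bool" where
  "lam_cond h q kappa lam \<longleftrightarrow> 0 \<le> lam_quant h q lam \<and> lam_quant h q lam \<le> lam_bound q kappa lam"

definition lam_cond_strict :: "(real \<Rightarrow> ennreal) \<Rightarrow> real \<Rightarrow> real \<Rightarrow> real \<Rightarrow> bool" where
  "lam_cond_strict h q kappa lam \<longleftrightarrow> 0 \<le> lam_quant h q lam \<and> lam_quant h q lam < lam_bound q kappa lam"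

definition Wen :: "real \<Rightarrow> (mat3 \<Rightarrow> real) \<Rightarrow> (real \<Rightarrow> ennreal) \<Rightarrow> mat3 \<Rightarrow> ennreal" where
  "Wen q Z h A = ennreal (norm A powr q) + ennreal (Z (cof A)) + h (det A)"

text \<open>I(u) = \<integral>_\<Omega> W(\<nabla>u), expressed through the (weak) gradient Du of u.\<close>
definition energy :: "vec3 set \<Rightarrow> real \<Rightarrow> (mat3 \<Rightarrow> real) \<Rightarrow> (real \<Rightarrow> ennreal) \<Rightarrow> (vec3 \<Rightarrow> mat3) \<Rightarrow> ennreal" where
  "energy \<Omega> q Z h Du = (\<integral>\<^sup>+ x. Wen q Z h (Du x) \<partial>lebesgue_on \<Omega>)"

definition test_fn :: "vec3 set \<Rightarrow> (vec3 \<Rightarrow> real) \<Rightarrow> bool" where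
  "test_fn \<Omega> \<phi> \<longleftrightarrow> (\<exists>K. compact K \<and> K \<subseteq> \<Omega> \<and> (\<forall>x. x \<notin> K \<longrightarrow> \<phi> x = 0)) \<and>
     \<phi> differentiable_on UNIV \<and>
     (\<forall>j. continuous_on UNIV (\<lambda>x. frechet_derivative \<phi> (at x) (axis j 1)))"

definition pderiv3 :: "(vec3 \<Rightarrow> real) \<Rightarrow> 3 \<Rightarrow> vec3 \<Rightarrow> real" where
  "pderiv3 \<phi> j x = frechet_derivative \<phi> (at x) (axis j 1)"

definition weak_grad :: "vec3 set \<Rightarrow> (vec3 \<Rightarrow> vec3) \<Rightarrow> (vec3 \<Rightarrow> mat3) \<Rightarrow> bool" where
  "weak_grad \<Omega> u Du \<longleftrightarrow> (\<forall>\<phi>. test_fn \<Omega> \<phi> \<longrightarrow> (\<forall>i j.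
      integrable (lebesgue_on \<Omega>) (\<lambda>x. u x $ i * pderiv3 \<phi> j x) \<and>
      integrable (lebesgue_on \<Omega>) (\<lambda>x. Du x $ i $ j * \<phi> x) \<and>
      (\<integral>x. u x $ i * pderiv3 \<phi> j x \<partial>lebesgue_on \<Omega>) = - (\<integral>x. Du x $ i $ j * \<phi> x \<partial>lebesgue_on \<Omega>)))"

definition sobolev :: "real \<Rightarrow> vec3 set \<Rightarrow> (vec3 \<Rightarrow> vec3) \<Rightarrow> (vec3 \<Rightarrow> mat3) \<Rightarrow> bool" where
  "sobolev p \<Omega> u Du \<longleftrightarrow>
     u \<in> borel_measurable (lebesgue_on \<Omega>) \<and> Du \<in> borel_measurable (lebesgue_on \<Omega>) \<and>
     integrable (lebesgue_on \<Omega>) (\<lambda>x. norm (u x) powr p) \<and>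
     integrable (lebesgue_on \<Omega>) (\<lambda>x. norm (Du x) powr p) \<and>
     weak_grad \<Omega> u Du"

text \<open>v \<in> W_0^{1,p}(\<Omega>;R^3): W^{1,p}-limit of C^1_c(\<Omega>) maps (zero trace).\<close>
definition sobolev0 :: "real \<Rightarrow> vec3 set \<Rightarrow> (vec3 \<Rightarrow> vec3) \<Rightarrow> (vec3 \<Rightarrow> mat3) \<Rightarrow> bool" where
  "sobolev0 p \<Omega> v Dv \<longleftrightarrow> sobolev p \<Omega> v Dv \<and>
     (\<exists>\<phi> D\<phi>. (\<forall>n. (\<forall>i. test_fn \<Omega> (\<lambda>x. \<phi> n x $ i)) \<and> weak_grad \<Omega> (\<phi> n) (D\<phi> n)) \<and>
        (\<lambda>n. \<integral>x. norm (\<phi> n x - v x) powr p \<partial>lebesgue_on \<Omega>) \<longlonglongrightarrow> 0 \<and>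
        (\<lambda>n. \<integral>x. norm (D\<phi> n x - Dv x) powr p \<partial>lebesgue_on \<Omega>) \<longlonglongrightarrow> 0)"

definition admissible :: "real \<Rightarrow> vec3 set \<Rightarrow> real \<Rightarrow> (vec3 \<Rightarrow> vec3) \<Rightarrow> (vec3 \<Rightarrow> mat3) \<Rightarrow> bool" where
  "admissible p \<Omega> lam u Du \<longleftrightarrow> sobolev p \<Omega> u Du \<and>
     sobolev0 p \<Omega> (\<lambda>x. u x - lam *\<^sub>R x) (\<lambda>x. Du x - mat lam)"

definition minimizer :: "vec3 set \<Rightarrow> real \<Rightarrow> (mat3 \<Rightarrow> real) \<Rightarrow> (real \<Rightarrow> ennreal) \<Rightarrow> real \<Rightarrow> bool" where
  "minimizer \<Omega> q Z h lam \<longleftrightarrow> (\<forall>u Du. admissible 2 \<Omega> lam u Du \<longrightarrow>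
      energy \<Omega> q Z h Du \<ge> energy \<Omega> q Z h (\<lambda>_. mat lam))"

end

theory Submission
  imports Defs
begin

text \<open>Let \<open>X = A - \<lambda>1\<close>, let \<open>s\<^sub>i\<close> be the singular values of \<open>A\<close> and \<open>a\<^sub>i = s\<^sub>i - \<lambda>\<close>.
  If \<open>det A > 0\<close> then \<open>det A - \<lambda>\<^sup>3 = a\<^sub>1 a\<^sub>2 a\<^sub>3 + \<lambda> P(A)\<close> with \<open>P = G + N\<close>, so the tangent of \<open>h\<close> at \<open>\<lambda>\<^sup>3\<close>,
  a subgradient of \<open>Z\<close> at \<open>cof (\<lambda>1)\<close> and the hypothesis on \<open>\<kappa>\<close> bound \<open>W(A) - W(\<lambda>1)\<close> below by an affine function
  of \<open>X\<close> and \<open>cof A\<close> plus \<open>\<kappa> |X|\<^sup>q + h'(\<lambda>\<^sup>3) (a\<^sub>1 a\<^sub>2 a\<^sub>3 + \<lambda> G(A))\<close>.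
  Half of the term \<open>\<kappa> |X|\<^sup>q\<close> absorbs the product (a weighted AM-GM inequality and
  \<open>a\<^sub>i \<ge> -\<lambda>\<close>), the other half absorbs \<open>\<lambda> G\<close>: at the fixed point \<open>c\<^sup>* = M\<^sub>2/M\<^sub>3\<close> the quadratic bound on \<open>|G|\<close> for
  \<open>|X| \<ge> c\<^sup>*\<close> and the cubic one for \<open>|X| < c\<^sup>*\<close> both become multiples of \<open>|X|\<^sup>q\<close> with the same constant.
  The affine function is a null Lagrangian on \<open>W\<^sup>1\<^sup>,\<^sup>2\<close>, unlike \<open>det (\<nabla>u)\<close>, which therefore is only used pointwise.\<close>

section \<open>Singular values\<close>

text \<open>The maps of the first claim are only in \<open>H^1\<close>, so \<open>|X|^q\<close> and
  \<open>det (\<nabla>u)\<close> need not be integrable and \<open>I(u)\<close> may be infinite.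
  Energies are therefore never subtracted: a constant plus a null Lagrangian plus a nonnegative
  remainder lies below \<open>W\<close> pointwise, and only this lower bound is integrated as a real
  function. The remainder is 0 in the first claim and a multiple of \<open>|X|^q + |G|\<close> in
  the last. Where \<open>det A \<le> 0\<close> the bound is trivial because \<open>W\<close> is
  infinite; elsewhere the sign of \<open>det A\<close> makes it equal to the product of the singular
  values. A strict inequality leaves unspent the fraction of \<open>\<kappa> |X|^q\<close> that is
  one minus the quotient of its two sides. The comparison of thresholds concerns every
  \<open>\<lambda>\<close>, while the hypothesis on \<open>\<kappa>\<close> is given at one;
  homogeneity carries it to the others. Singular values and \<open>cstar\<close> are definite
  descriptions, so each needs existence and uniqueness. Existence of \<open>cstar\<close> rests on
  continuity of \<open>M2\<close> and \<open>M3\<close>, hence of \<open>G\<close>, which the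
  nuclear norm supplies.\<close>

definition svd :: "mat3 \<Rightarrow> vec3 \<Rightarrow> mat3 \<Rightarrow> mat3 \<Rightarrow> bool" where
  "svd A s U V \<longleftrightarrow> 0 \<le> s $ 1 \<and> s $ 1 \<le> s $ 2 \<and> s $ 2 \<le> s $ 3 \<and>
     orthogonal_matrix U \<and> orthogonal_matrix V \<and> A = U ** diagm s ** transpose V"

lemma compact_orthogonal: "compact {U :: mat3. orthogonal_matrix U}"
proof -
  have "bounded {U :: mat3. orthogonal_matrix U}"
  proof (rule boundedI)
    fix U :: mat3 assume "U \<in> {U. orthogonal_matrix U}"
    then have "norm (U $ i) = 1" for i
      using orthogonal_matrix_orthonormal_rows by (metis row_def vec_nth_inverse mem_Collect_eq)
    then have "norm U \<le> (\<Sum>i\<in>(UNIV :: 3 set). 1)"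
      unfolding norm_vec_def by (intro order_trans[OF L2_set_le_sum]) auto
    then show "norm U \<le> 3" by (simp add: sum_3)
  qed
  moreover have "{U :: mat3. orthogonal_matrix U}
      = {U. (\<forall>i j. (transpose U ** U) $ i $ j = mat 1 $ i $ j)}"
    unfolding orthogonal_matrix by (auto simp: vec_eq_iff)
  moreover have "closed {U :: mat3. (\<forall>i j. (transpose U ** U) $ i $ j = mat 1 $ i $ j)}"
    unfolding matrix_matrix_mult_def transpose_def
    by (intro closed_Collect_all closed_Collect_eq) (auto intro!: continuous_intros)
  ultimately show ?thesis by (simp add: compact_eq_bounded_closed)
qed

lemma orthogonal_entry_le: 
  assumes "orthogonal_matrix (Q :: mat3)" shows "\<bar>Q $ i $ j\<bar> \<le> 1"
proof -
  have "norm (Q $ i) = 1"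
    using assms orthogonal_matrix_orthonormal_rows by (metis row_def vec_nth_inverse)
  then show ?thesis by (metis component_le_norm_cart)
qed

text \<open>The first-order condition for a maximum at the trivial rotation, without derivatives:
  the unit vector in direction \<open>(a, b)\<close> gives the value
  \<open>sqrt (a\<^sup>2 + b\<^sup>2)\<close>, which exceeds \<open>a\<close> unless
  \<open>b = 0\<close>.\<close>

lemma circle_max:
  fixes a b :: real
  assumes "\<And>c s. c\<^sup>2 + s\<^sup>2 = 1 \<Longrightarrow> c * a + s * b \<le> a"
  shows "b = 0"
proof (rule ccontr)
  assume b: "b \<noteq> 0"
  define r where "r = sqrt (a\<^sup>2 + b\<^sup>2)"
  have r: "r > 0" "r\<^sup>2 = a\<^sup>2 + b\<^sup>2" using b by (auto simp: r_def sum_power2_gt_zero_iff)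
  have "(a/r)\<^sup>2 + (b/r)\<^sup>2 = 1" using r b by (simp add: power_divide flip: add_divide_distrib)
  from assms[OF this] have "(a\<^sup>2 + b\<^sup>2) / r \<le> a" by (simp add: power2_eq_square add_divide_distrib)
  then have "r\<^sup>2 / r \<le> a" by (simp only: r(2))
  then have "r \<le> a" using r(1) by (simp add: power2_eq_square)
  then have "r\<^sup>2 \<le> a\<^sup>2" using r by (intro power_mono) auto
  then show False using r b by auto
qed

lemmas mat3_simps = vec_eq_iff matrix_matrix_mult_def transpose_def mat_def sum_3 forall_3 vector_3
  diagm_def trace_def

text \<open>Maximise \<open>trace (diag (1,2,3) U\<^sup>T A V)\<close> over orthogonal \<open>U\<close> and \<open>V\<close>. Planar rotations on either side
  show that the maximal \<open>U\<^sup>T A V\<close> is diagonal, because the weights are distinct; sign changes and swaps of neighbours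
  show that its diagonal is nonnegative and sorted.\<close>
lemma svd_exists: "\<exists>s U V. svd A s U V"
proof -
  let ?O = "{U :: mat3. orthogonal_matrix U}"
  define w where "w = (\<lambda>M :: mat3. M$1$1 + 2 * M$2$2 + 3 * M$3$3)"
  have "continuous_on (?O \<times> ?O) (\<lambda>p. w (transpose (fst p) ** A ** snd p))"
    unfolding w_def matrix_matrix_mult_def transpose_def by (auto intro!: continuous_intros)
  moreover have "compact (?O \<times> ?O)" by (intro compact_Times compact_orthogonal)
  moreover have "(mat 1, mat 1) \<in> ?O \<times> ?O" by (simp add: orthogonal_matrix_id)
  ultimately obtain p where p: "p \<in> ?O \<times> ?O"
    "\<And>p'. p' \<in> ?O \<times> ?O \<Longrightarrow> w (transpose (fst p') ** A ** snd p') \<le> w (transpose (fst p) ** A ** snd p)"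
    using continuous_attains_sup[of "?O \<times> ?O" "\<lambda>p. w (transpose (fst p) ** A ** snd p)"] by blast
  obtain U V where UV: "p = (U, V)" by (cases p)
  have oU: "orthogonal_matrix U" and oV: "orthogonal_matrix V" using p(1) UV by auto
  define B where "B = transpose U ** A ** V"
  \<comment> \<open>Orthogonal factors on either side of \<open>B\<close> are absorbed into
    \<open>U\<close> and \<open>V\<close>, so \<open>B\<close> is maximal under all such
    changes.\<close>
  have max: "w (Q ** B ** R) \<le> w B" if "orthogonal_matrix Q" "orthogonal_matrix R" for Q R
  proof -
    have "w (transpose (U ** transpose Q) ** A ** (V ** R)) \<le> w B"
      using p(2)[of "(U ** transpose Q, V ** R)"] that oU oV
      by (auto simp: UV B_def orthogonal_matrix_mul)
    then show ?thesis by (simp add: matrix_transpose_mul B_def matrix_mul_assoc)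
  qed
  have maxl: "w (Q ** B) \<le> w B" if "orthogonal_matrix Q" for Q
    using max[OF that, of "mat 1"] by (simp add: orthogonal_matrix_id)
  have maxr: "w (B ** Q) \<le> w B" if "orthogonal_matrix Q" for Q
    using max[OF _ that, of "mat 1"] by (simp add: orthogonal_matrix_id)
  define R12 where "R12 = (\<lambda>c s::real. vector [vector [c,s,0], vector [-s,c,0], vector [0,0,1]] :: mat3)"
  define R13 where "R13 = (\<lambda>c s::real. vector [vector [c,0,s], vector [0,1,0], vector [-s,0,c]] :: mat3)"
  define R23 where "R23 = (\<lambda>c s::real. vector [vector [1,0,0], vector [0,c,s], vector [0,-s,c]] :: mat3)"
  have oR: "orthogonal_matrix (R12 c s)" "orthogonal_matrix (R13 c s)" "orthogonal_matrix (R23 c s)"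
    if "c\<^sup>2 + s\<^sup>2 = 1" for c s
    using that by (auto simp: orthogonal_matrix R12_def R13_def R23_def mat3_simps power2_eq_square)
  \<comment> \<open>In the plane of axes \<open>i < j\<close>, rotating on the left and on the right
    gives two linear equations for the two off-diagonal entries. Their determinant is, up to sign,
    the difference of the squared weights, hence nonzero.\<close>
  have "B$2$1 - 2 * B$1$2 = 0"
    using maxl[OF oR(1)] by (intro circle_max[of "B$1$1 + 2 * B$2$2"])
      (force simp: w_def R12_def mat3_simps algebra_simps)
  moreover have "2 * B$2$1 - B$1$2 = 0"
    using maxr[OF oR(1)] by (intro circle_max[of "B$1$1 + 2 * B$2$2"])
      (force simp: w_def R12_def mat3_simps algebra_simps)
  moreover have "B$3$1 - 3 * B$1$3 = 0"
    using maxl[OF oR(2)] by (intro circle_max[of "B$1$1 + 3 * B$3$3"])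
      (force simp: w_def R13_def mat3_simps algebra_simps)
  moreover have "3 * B$3$1 - B$1$3 = 0"
    using maxr[OF oR(2)] by (intro circle_max[of "B$1$1 + 3 * B$3$3"])
      (force simp: w_def R13_def mat3_simps algebra_simps)
  moreover have "2 * B$3$2 - 3 * B$2$3 = 0"
    using maxl[OF oR(3)] by (intro circle_max[of "2 * B$2$2 + 3 * B$3$3"])
      (force simp: w_def R23_def mat3_simps algebra_simps)
  moreover have "3 * B$3$2 - 2 * B$2$3 = 0"
    using maxr[OF oR(3)] by (intro circle_max[of "2 * B$2$2 + 3 * B$3$3"])
      (force simp: w_def R23_def mat3_simps algebra_simps)
  ultimately have off: "B$1$2 = 0" "B$2$1 = 0" "B$1$3 = 0" "B$3$1 = 0" "B$2$3 = 0" "B$3$2 = 0"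
    by linarith+
  define s where "s = (\<chi> i. B$i$i)"
  have Bs: "B = diagm s" by (auto simp: mat3_simps s_def off)
  define S where "S = (vector [vector [-1,0,0], vector [0,1,0], vector [0,0,1]] :: mat3)"
  define P where "P = (vector [vector [0,1,0], vector [1,0,0], vector [0,0,1]] :: mat3)"
  define P' where "P' = (vector [vector [1,0,0], vector [0,0,1], vector [0,1,0]] :: mat3)"
  have o: "orthogonal_matrix S" "orthogonal_matrix P" "orthogonal_matrix P'"
    by (auto simp: orthogonal_matrix S_def P_def P'_def mat3_simps)
  \<comment> \<open>One sign change suffices: the increasing weights force the diagonal to increase,
    so the smallest entry carries the sign of all.\<close>
  have "0 \<le> B$1$1" using maxl[OF o(1)] by (auto simp: w_def S_def mat3_simps)
  moreover have "B$1$1 \<le> B$2$2" using max[OF o(2) o(2)] by (auto simp: w_def P_def mat3_simps)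
  moreover have "B$2$2 \<le> B$3$3" using max[OF o(3) o(3)] by (auto simp: w_def P'_def mat3_simps)
  moreover have "A = U ** B ** transpose V"
  proof -
    have "U ** B ** transpose V = (U ** transpose U) ** A ** (V ** transpose V)"
      by (simp add: B_def matrix_mul_assoc)
    then show ?thesis using oU oV by (simp add: orthogonal_matrix_def)
  qed
  ultimately have "svd A s U V" unfolding svd_def Bs[symmetric] using oU oV by (simp add: s_def)
  then show ?thesis by blast
qed

section \<open>Variational characterisation and uniqueness of the singular values\<close>

lemma trace_diagm_mult: "trace (diagm s ** Q) = s$1 * Q$1$1 + s$2 * Q$2$2 + s$3 * Q$3$3"
  by (simp add: mat3_simps)

lemma svd_trace: 
  assumes "svd A s U V"
  shows "trace (R ** A) = trace (diagm s ** (transpose V ** R ** U))"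
proof -
  have "trace (R ** A) = trace ((R ** U ** diagm s) ** transpose V)"
    using assms by (simp add: svd_def matrix_mul_assoc)
  also have "\<dots> = trace ((transpose V ** R ** U) ** diagm s)"
    by (subst trace_mul_sym) (simp add: matrix_mul_assoc)
  finally show ?thesis by (subst trace_mul_sym)
qed

text \<open>Cyclicity of the trace leaves \<open>diagm s\<close> against an orthogonal matrix, whose
  diagonal entries are at most 1. Together with attainment this makes the sum of the singular values
  a maximum that depends on \<open>A\<close> alone.\<close>

lemma svd_trace_le:
  assumes "svd A s U V" "orthogonal_matrix R"
  shows "trace (R ** A) \<le> s$1 + s$2 + s$3"
proof -
  define Q where "Q = transpose V ** R ** U"
  have "orthogonal_matrix Q" using assms by (auto simp: Q_def svd_def orthogonal_matrix_mul)
  then have "Q$i$i \<le> 1" for i using orthogonal_entry_le[of Q i i] by auto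
  moreover have "0 \<le> s$1" "0 \<le> s$2" "0 \<le> s$3" using assms by (auto simp: svd_def)
  ultimately show ?thesis 
    unfolding svd_trace[OF assms(1)] Q_def[symmetric] trace_diagm_mult
    by (intro add_mono) (auto intro: mult_left_le)
qed

lemma svd_trace_attained:
  assumes "svd A s U V"
  shows "\<exists>R. orthogonal_matrix R \<and> trace (R ** A) = s$1 + s$2 + s$3"
proof (intro exI conjI)
  show "orthogonal_matrix (V ** transpose U)" using assms by (auto simp: svd_def orthogonal_matrix_mul)
  have "transpose V ** (V ** transpose U) ** U = (transpose V ** V) ** (transpose U ** U)"
    by (simp add: matrix_mul_assoc)
  then have "transpose V ** (V ** transpose U) ** U = mat 1"
    using assms by (simp add: svd_def orthogonal_matrix_def)
  then show "trace ((V ** transpose U) ** A) = s$1 + s$2 + s$3"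
    by (simp add: svd_trace[OF assms]) (simp add: mat3_simps)
qed

lemma norm_mat3: "(norm (A :: mat3))\<^sup>2 = trace (A ** transpose A)"
  unfolding power2_norm_eq_inner by (simp add: inner_vec_def mat3_simps)

lemma svd_norm:
  assumes "svd A s U V"
  shows "(norm A)\<^sup>2 = (s$1)\<^sup>2 + (s$2)\<^sup>2 + (s$3)\<^sup>2"
proof -
  have A: "A = U ** diagm s ** transpose V" "transpose U ** U = mat 1" "transpose V ** V = mat 1"
    using assms by (auto simp: svd_def orthogonal_matrix_def)
  have "trace (A ** transpose A) = trace (U ** diagm s ** (transpose V ** V) ** transpose (diagm s) ** transpose U)"
    by (simp add: A(1) matrix_transpose_mul matrix_mul_assoc)
  also have "\<dots> = trace (U ** (diagm s ** transpose (diagm s) ** transpose U))"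
    by (simp add: A matrix_mul_assoc)
  also have "\<dots> = trace (diagm s ** transpose (diagm s) ** (transpose U ** U))"
    by (subst trace_mul_sym) (simp add: matrix_mul_assoc)
  also have "\<dots> = (s$1)\<^sup>2 + (s$2)\<^sup>2 + (s$3)\<^sup>2"
    by (simp add: A) (simp add: mat3_simps power2_eq_square)
  finally show ?thesis by (simp add: norm_mat3)
qed

lemma orthogonal_row_sum:
  assumes "orthogonal_matrix (Q :: mat3)" 
  shows "(Q$i$1)\<^sup>2 + (Q$i$2)\<^sup>2 + (Q$i$3)\<^sup>2 = 1" "(Q$1$i)\<^sup>2 + (Q$2$i)\<^sup>2 + (Q$3$i)\<^sup>2 = 1"
proof -
  have "Q ** transpose Q = mat 1" "transpose Q ** Q = mat 1" using assms by (auto simp: orthogonal_matrix_def)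
  then have "(Q ** transpose Q) $ i $ i = 1" "(transpose Q ** Q) $ i $ i = 1" by (auto simp: mat_def)
  then show "(Q$i$1)\<^sup>2 + (Q$i$2)\<^sup>2 + (Q$i$3)\<^sup>2 = 1" "(Q$1$i)\<^sup>2 + (Q$2$i)\<^sup>2 + (Q$3$i)\<^sup>2 = 1"
    by (auto simp: mat3_simps power2_eq_square)
qed

text \<open>The entry is a sum of \<open>s$i * x * y\<close> over a unit row and a unit column;
  \<open>s$i \<le> s$3\<close> and \<open>2 * x * y \<le> x\<^sup>2 + y\<^sup>2\<close> finish it.
  This characterises the largest singular value by \<open>A\<close> alone.\<close>

lemma svd_entry_le:
  assumes "svd A s U V" "orthogonal_matrix Q" "orthogonal_matrix R"
  shows "(Q ** A ** R) $ 3 $ 3 \<le> s $ 3"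
proof -
  define Q' where "Q' = Q ** U"
  define R' where "R' = transpose V ** R"
  have o: "orthogonal_matrix Q'" "orthogonal_matrix R'"
    using assms by (auto simp: Q'_def R'_def svd_def orthogonal_matrix_mul)
  have "Q ** A ** R = Q' ** diagm s ** R'"
    using assms by (auto simp: Q'_def R'_def svd_def matrix_mul_assoc)
  then have "(Q ** A ** R) $ 3 $ 3 = s$1 * (Q'$3$1 * R'$1$3) + s$2 * (Q'$3$2 * R'$2$3) + s$3 * (Q'$3$3 * R'$3$3)"
    by (simp add: mat3_simps algebra_simps)
  also have "\<dots> \<le> s$3 * (((Q'$3$1)\<^sup>2 + (R'$1$3)\<^sup>2)/2) + s$3 * (((Q'$3$2)\<^sup>2 + (R'$2$3)\<^sup>2)/2) + s$3 * (((Q'$3$3)\<^sup>2 + (R'$3$3)\<^sup>2)/2)"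
  proof (intro add_mono)
    have *: "s$i * (x * y) \<le> s$3 * ((x\<^sup>2 + y\<^sup>2)/2)" if "i = 1 \<or> i = 2 \<or> i = 3" for i :: 3 and x y :: real
    proof -
      have "x * y \<le> (x\<^sup>2 + y\<^sup>2)/2" using sum_squares_bound[of x y] by simp
      moreover have "0 \<le> s$i" "s$i \<le> s$3" using assms that by (auto simp: svd_def)
      ultimately show ?thesis
        by (meson mult_left_mono mult_right_mono order_trans sum_power2_ge_zero divide_nonneg_pos zero_less_numeral)
    qed
    show "s$1 * (Q'$3$1 * R'$1$3) \<le> s$3 * (((Q'$3$1)\<^sup>2 + (R'$1$3)\<^sup>2)/2)"
      "s$2 * (Q'$3$2 * R'$2$3) \<le> s$3 * (((Q'$3$2)\<^sup>2 + (R'$2$3)\<^sup>2)/2)"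
      "s$3 * (Q'$3$3 * R'$3$3) \<le> s$3 * (((Q'$3$3)\<^sup>2 + (R'$3$3)\<^sup>2)/2)"
      using * by blast+
  qed
  also have "\<dots> = s$3 * (((Q'$3$1)\<^sup>2 + (Q'$3$2)\<^sup>2 + (Q'$3$3)\<^sup>2) + ((R'$1$3)\<^sup>2 + (R'$2$3)\<^sup>2 + (R'$3$3)\<^sup>2)) / 2"
    by (simp add: algebra_simps add_divide_distrib)
  also have "\<dots> = s$3" using orthogonal_row_sum[OF o(1), of 3] orthogonal_row_sum[OF o(2), of 3] by simp
  finally show ?thesis .
qed

lemma svd_entry_attained:
  assumes "svd A s U V"
  shows "(transpose U ** A ** V) $ 3 $ 3 = s $ 3"
proof -
  have "transpose U ** A ** V = (transpose U ** U) ** diagm s ** (transpose V ** V)"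
    using assms by (simp add: svd_def matrix_mul_assoc)
  then show ?thesis using assms by (simp add: svd_def orthogonal_matrix_def) (simp add: diagm_def)
qed

text \<open>Sum, maximum and sum of squares depend on \<open>A\<close> only. The two smaller values
  then have a known sum and a known sum of squares, so their difference is known up to a sign, which
  the ordering fixes.\<close>

lemma svd_unique:
  assumes "svd A s U V" "svd A t U' V'"
  shows "s = t"
proof -
  have le1: "a$1 + a$2 + a$3 \<le> b$1 + b$2 + b$3" if "svd A a U V" "svd A b U' V'" for a b U V U' V'
    using svd_trace_attained[OF that(1)] svd_trace_le[OF that(2)] by metis
  have le2: "a$3 \<le> b$3" if "svd A a U V" "svd A b U' V'" for a b U V U' V'
    using svd_entry_attained[OF that(1)] svd_entry_le[OF that(2), of "transpose U" V] that(1)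
    by (auto simp: svd_def)
  have 1: "s$1 + s$2 + s$3 = t$1 + t$2 + t$3" using assms le1 by (intro antisym) blast+
  have 3: "s$3 = t$3" using assms le2 by (intro antisym) blast+
  have "(s$1)\<^sup>2 + (s$2)\<^sup>2 = (t$1)\<^sup>2 + (t$2)\<^sup>2"
    using svd_norm[OF assms(1)] svd_norm[OF assms(2)] 3 by simp
  moreover have "2 * (s$1)\<^sup>2 + 2 * (s$2)\<^sup>2 = (s$1+s$2)\<^sup>2 + (s$2-s$1)\<^sup>2"
     "2 * (t$1)\<^sup>2 + 2 * (t$2)\<^sup>2 = (t$1+t$2)\<^sup>2 + (t$2-t$1)\<^sup>2"
    by (auto simp: power2_eq_square algebra_simps)
  moreover have "s$1 + s$2 = t$1 + t$2" using 1 3 by simp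
  ultimately have "(s$2-s$1)\<^sup>2 = (t$2-t$1)\<^sup>2" by simp
  then have "s$2 - s$1 = t$2 - t$1" using assms by (auto simp: svd_def power2_eq_iff_nonneg)
  with 1 3 show ?thesis by (auto simp: vec_eq_iff forall_3)
qed

lemma singvals_eqI: assumes "svd A s U V" shows "singvals A = s"
  unfolding singvals_def
proof (rule the_equality)
  show "0 \<le> s $ 1 \<and> s $ 1 \<le> s $ 2 \<and> s $ 2 \<le> s $ 3 \<and>
      (\<exists>U V. orthogonal_matrix U \<and> orthogonal_matrix V \<and> A = U ** diagm s ** transpose V)"
    using assms unfolding svd_def by blast
  show "t = s" if *: "0 \<le> t $ 1 \<and> t $ 1 \<le> t $ 2 \<and> t $ 2 \<le> t $ 3 \<and>
      (\<exists>U V. orthogonal_matrix U \<and> orthogonal_matrix V \<and> A = U ** diagm t ** transpose V)" for t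
  proof -
    obtain U' V' where "svd A t U' V'" using * unfolding svd_def by auto
    then show ?thesis using assms svd_unique by blast
  qed
qed

lemma singvals_svd: obtains U V where "svd A (singvals A) U V"
  using svd_exists[of A] singvals_eqI by metis

section \<open>Nuclear norm and the growth of G\<close>

lemma cof_entries:
  "cof A $ 1 $ 1 = A$2$2 * A$3$3 - A$2$3 * A$3$2"
  "cof A $ 1 $ 2 = A$2$3 * A$3$1 - A$2$1 * A$3$3"
  "cof A $ 1 $ 3 = A$2$1 * A$3$2 - A$2$2 * A$3$1"
  "cof A $ 2 $ 1 = A$3$2 * A$1$3 - A$3$3 * A$1$2"
  "cof A $ 2 $ 2 = A$3$3 * A$1$1 - A$3$1 * A$1$3"
  "cof A $ 2 $ 3 = A$3$1 * A$1$2 - A$3$2 * A$1$1"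
  "cof A $ 3 $ 1 = A$1$2 * A$2$3 - A$1$3 * A$2$2"
  "cof A $ 3 $ 2 = A$1$3 * A$2$1 - A$1$1 * A$2$3"
  "cof A $ 3 $ 3 = A$1$1 * A$2$2 - A$1$2 * A$2$1"
  by (simp_all add: cof_def det_3 axis_def)

lemma cof_mult_transpose: "cof A ** transpose A = mat (det A)"
  by (simp add: mat3_simps cof_entries det_3 algebra_simps)

lemma cof_orthogonal:
  assumes "orthogonal_matrix Q" shows "cof Q = det Q *\<^sub>R Q"
proof -
  have "cof Q = cof Q ** (transpose Q ** Q)" using assms by (simp add: orthogonal_matrix_def)
  also have "\<dots> = mat (det Q) ** Q" by (simp add: matrix_mul_assoc cof_mult_transpose)
  also have "\<dots> = det Q *\<^sub>R Q" by (simp add: mat3_simps)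
  finally show ?thesis .
qed

lemma cof_mult: "cof (A ** B) = cof A ** cof B"
  by (simp add: mat3_simps cof_entries) (simp add: algebra_simps)

lemma cof_transpose: "cof (transpose A) = transpose (cof A)"
  by (simp add: mat3_simps cof_entries algebra_simps)

lemma cof_diagm: "cof (diagm s) = diagm (vector [s$2 * s$3, s$1 * s$3, s$1 * s$2])"
  by (simp add: mat3_simps cof_entries)

lemma scaleR_mult_mat3: "(a *\<^sub>R A) ** B = a *\<^sub>R (A ** B :: mat3)" "A ** (a *\<^sub>R B) = a *\<^sub>R (A ** B :: mat3)"
  by (simp_all add: vec_eq_iff matrix_matrix_mult_def sum_distrib_left algebra_simps)

lemma trace_scaleR: "trace (a *\<^sub>R A) = a * trace (A :: mat3)"
  by (simp add: trace_def sum_distrib_left)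

lemma transpose_scaleR: "transpose (a *\<^sub>R A) = a *\<^sub>R transpose (A :: mat3)"
  by (simp add: transpose_def vec_eq_iff)

text \<open>The two orthogonal factors enter only through \<open>Q\<close>: the traces see its
  diagonal, and \<open>det Q\<close>, which is 1 or -1, carries the sign of
  \<open>det A\<close>.\<close>

lemma svd_trace_cof:
  assumes "svd A s U V" 
  defines "Q \<equiv> transpose V ** U"
  shows "trace A = s$1 * Q$1$1 + s$2 * Q$2$2 + s$3 * Q$3$3"
    "trace (cof A) = det Q * (s$2 * s$3 * Q$1$1 + s$1 * s$3 * Q$2$2 + s$1 * s$2 * Q$3$3)"
    "orthogonal_matrix Q" "det A = det Q * (s$1 * s$2 * s$3)"
proof -
  have A: "A = U ** diagm s ** transpose V" and o: "orthogonal_matrix U" "orthogonal_matrix V"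
    using assms by (auto simp: svd_def)
  show "trace A = s$1 * Q$1$1 + s$2 * Q$2$2 + s$3 * Q$3$3"
    using svd_trace[OF assms(1), of "mat 1"] by (simp add: trace_diagm_mult Q_def)
  show "orthogonal_matrix Q" using o by (simp add: Q_def orthogonal_matrix_mul)
  have dQ: "det Q = det U * det V" by (simp add: Q_def det_mul)
  have "trace (cof A) = det Q * trace (U ** (cof (diagm s) ** transpose V))"
    using o by (simp add: A cof_mult cof_transpose cof_orthogonal transpose_scaleR scaleR_mult_mat3
        trace_scaleR dQ matrix_mul_assoc)
  also have "trace (U ** (cof (diagm s) ** transpose V)) = trace (cof (diagm s) ** Q)"
    by (subst trace_mul_sym) (simp add: Q_def matrix_mul_assoc)
  finally show "trace (cof A) = det Q * (s$2 * s$3 * Q$1$1 + s$1 * s$3 * Q$2$2 + s$1 * s$2 * Q$3$3)"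
    by (simp add: cof_diagm trace_diagm_mult vector_3)
  have "det (diagm s) = s$1 * s$2 * s$3" by (simp add: det_3 diagm_def)
  then show "det A = det Q * (s$1 * s$2 * s$3)" by (simp add: A det_mul dQ)
qed

section \<open>The nuclear norm and the continuity of G\<close>

definition nuc :: "mat3 \<Rightarrow> real" where
  "nuc A = singvals A $ 1 + singvals A $ 2 + singvals A $ 3"

lemma trace_mult_le:
  assumes "orthogonal_matrix (R :: mat3)" shows "trace (R ** A) \<le> 9 * norm A"
proof -
  have "trace (R ** A) = (\<Sum>i\<in>UNIV. \<Sum>j\<in>UNIV. R$i$j * A$j$i)"
    by (simp add: trace_def matrix_matrix_mult_def)
  also have "\<dots> \<le> (\<Sum>i\<in>(UNIV::3 set). \<Sum>j\<in>(UNIV::3 set). norm A)"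
  proof (intro sum_mono)
    fix i j :: 3
    have "\<bar>A$j$i\<bar> \<le> norm A" using component_le_norm_cart[of "A$j" i] Finite_Cartesian_Product.norm_nth_le[of A j] by linarith
    then have "\<bar>R$i$j\<bar> * \<bar>A$j$i\<bar> \<le> 1 * norm A"
      using orthogonal_entry_le[OF assms, of i j] by (intro mult_mono) auto
    then show "R$i$j * A$j$i \<le> norm A" by (simp add: abs_mult[symmetric])
  qed
  finally show ?thesis by simp
qed

text \<open>The nuclear norm is a maximum of the linear functions \<open>trace (R ** A)\<close>,
  which share a Lipschitz constant. The value 9 counts matrix entries, each bounded by the
  norm.\<close>

lemma nuc_lipschitz: "\<bar>nuc A - nuc B\<bar> \<le> 9 * norm (A - B)"
proof -
  have *: "nuc A - nuc B \<le> 9 * norm (A - B)" for A B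
  proof -
    obtain U V where A: "svd A (singvals A) U V" by (rule singvals_svd)
    obtain U' V' where B: "svd B (singvals B) U' V'" by (rule singvals_svd)
    obtain R where R: "orthogonal_matrix R" "trace (R ** A) = nuc A"
      using svd_trace_attained[OF A] by (auto simp: nuc_def)
    have "R ** A = R ** B + R ** (A - B)" by (simp flip: matrix_add_ldistrib)
    then have "trace (R ** A) = trace (R ** B) + trace (R ** (A - B))" by (simp add: trace_add)
    then show ?thesis using trace_mult_le[OF R(1), of "A - B"] svd_trace_le[OF B R(1)] R(2)
      by (simp add: nuc_def)
  qed
  show ?thesis using *[of A B] *[of B A] by (simp add: norm_minus_commute abs_le_iff)
qed

lemma continuous_on_nuc: "continuous_on S nuc"
proof -
  have "9-lipschitz_on S nuc" by (rule lipschitz_onI) (auto simp: dist_norm nuc_lipschitz)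
  then show ?thesis by (rule lipschitz_on_continuous_on)
qed

text \<open>Twice the second elementary symmetric function of the singular values is \<open>(nuc A)\<^sup>2 - |A|\<^sup>2\<close>, so \<open>G\<close> inherits
  continuity from the nuclear norm.\<close>
lemma Gfun_nuc: "Gfun lam A = ((nuc A)\<^sup>2 - (norm A)\<^sup>2) / 2 - lam * nuc A - (trace (cof A) - lam * trace A)"
proof -
  obtain U V where A: "svd A (singvals A) U V" by (rule singvals_svd)
  show ?thesis unfolding svd_norm[OF A] nuc_def Gfun_def Let_def
    by (simp add: power2_eq_square field_simps)
qed

lemma continuous_on_Gfun: "continuous_on S (Gfun lam)"
  unfolding Gfun_nuc[abs_def] trace_def sum_3 cof_entries
  by (intro continuous_intros continuous_on_compose2[OF continuous_on_nuc[of UNIV]]) auto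

text \<open>The squared distance from \<open>\<lambda>1\<close> splits into a stretch part and a
  rotation part, both nonnegative for \<open>lam > 0\<close>. The first controls
  \<open>s$i - lam\<close>, the second the defects \<open>1 - Q$i$i\<close>.\<close>

lemma norm_shift:
  assumes "svd A s U V" 
  defines "Q \<equiv> transpose V ** U"
  shows "(norm (A - mat lam))\<^sup>2 = (s$1-lam)\<^sup>2 + (s$2-lam)\<^sup>2 + (s$3-lam)\<^sup>2
     + 2 * lam * (s$1 * (1 - Q$1$1) + s$2 * (1 - Q$2$2) + s$3 * (1 - Q$3$3))"
proof -
  have "(norm (A - mat lam))\<^sup>2 = (norm A)\<^sup>2 - 2 * lam * trace A + 3 * lam\<^sup>2"
    unfolding power2_norm_eq_inner by (simp add: inner_vec_def mat3_simps power2_eq_square algebra_simps)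
  then show ?thesis unfolding svd_norm[OF assms(1)] svd_trace_cof(1)[OF assms(1)] Q_def
    by (simp add: power2_eq_square algebra_simps)
qed

lemma singval_shift_le:
  assumes "svd A s U V" "lam > 0"
  shows "(s$1-lam)\<^sup>2 + (s$2-lam)\<^sup>2 + (s$3-lam)\<^sup>2 \<le> (norm (A - mat lam))\<^sup>2"
proof -
  define Q where "Q = transpose V ** U"
  have "Q$i$i \<le> 1" for i using orthogonal_entry_le[OF svd_trace_cof(3)[OF assms(1)], of i i] by (simp add: Q_def)
  then have "0 \<le> s$1 * (1 - Q$1$1)" "0 \<le> s$2 * (1 - Q$2$2)" "0 \<le> s$3 * (1 - Q$3$3)"
    using assms by (auto simp: svd_def)
  then show ?thesis unfolding norm_shift[OF assms(1)] Q_def[symmetric] using assms(2) by simp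
qed

text \<open>G sees only the misalignment of the two orthogonal factors; it vanishes when
  \<open>Q\<close> is the identity, that is, for positive semidefinite \<open>A\<close>.\<close>

lemma Gfun_svd:
  assumes "svd A s U V" 
  defines "Q \<equiv> transpose V ** U"
  shows "Gfun lam A = (s$2 * s$3 * (1 - det Q * Q$1$1) + s$1 * s$3 * (1 - det Q * Q$2$2) + s$1 * s$2 * (1 - det Q * Q$3$3))
     - lam * (s$1 * (1 - Q$1$1) + s$2 * (1 - Q$2$2) + s$3 * (1 - Q$3$3))"
  unfolding Gfun_def singvals_eqI[OF assms(1)] svd_trace_cof(1,2)[OF assms(1)] Q_def Let_def
  by (simp add: algebra_simps)

text \<open>If \<open>det Q = -1\<close>, the cofactor identity makes the lower right 2x2 minor
  equal to \<open>- Q$1$1\<close>, at most -3/4. But its diagonal product is at least 9/16, and unit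
  rows keep the off-diagonal product at most 7/16.\<close>

lemma det_near_identity:
  fixes Q :: mat3
  assumes "orthogonal_matrix Q" "Q$1$1 \<ge> 3/4" "Q$2$2 \<ge> 3/4" "Q$3$3 \<ge> 3/4"
  shows "det Q = 1"
proof (rule ccontr)
  assume "det Q \<noteq> 1"
  then have "det Q = -1" using det_orthogonal_matrix[OF assms(1)] by auto
  then have "cof Q $ 1 $ 1 = - Q$1$1" using cof_orthogonal[OF assms(1)] by simp
  then have e: "Q$2$2 * Q$3$3 - Q$2$3 * Q$3$2 = - Q$1$1" by (simp add: cof_entries)
  have nine: "(3/4 :: real)\<^sup>2 = 9/16" by (simp add: power2_eq_square)
  have "3/4 * (3/4) \<le> Q$2$2 * Q$3$3" using assms by (intro mult_mono) auto
  moreover have "2 * (Q$2$3 * Q$3$2) \<le> (Q$2$3)\<^sup>2 + (Q$3$2)\<^sup>2" using sum_squares_bound[of "Q$2$3" "Q$3$2"] by simp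
  moreover have "(Q$2$3)\<^sup>2 \<le> 7/16"
  proof -
    have "(3/4)\<^sup>2 \<le> (Q$2$2)\<^sup>2" using assms by (intro power_mono) auto
    moreover have "0 \<le> (Q$2$1)\<^sup>2" by simp
    ultimately show ?thesis using orthogonal_row_sum(1)[OF assms(1), of 2] nine by linarith
  qed
  moreover have "(Q$3$2)\<^sup>2 \<le> 7/16"
  proof -
    have "(3/4)\<^sup>2 \<le> (Q$3$3)\<^sup>2" using assms by (intro power_mono) auto
    moreover have "0 \<le> (Q$3$1)\<^sup>2" by simp
    ultimately show ?thesis using orthogonal_row_sum(1)[OF assms(1), of 3] nine by linarith
  qed
  ultimately show False using e assms by simp
qed

text \<open>With \<open>r\<close> the distance, \<open>lam \<le> 2 * r\<close> gives singular values
  at most \<open>3 * r\<close>. Three terms of size \<open>2 * (3 * r)\<^sup>2\<close> and three of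
  size \<open>2 * r * (3 * r) * 2\<close> add up to \<open>90 * r\<^sup>2\<close>.\<close>

lemma Gfun_far:
  assumes "lam > 0" "norm (A - mat lam) \<ge> lam / 2"
  shows "\<bar>Gfun lam A\<bar> \<le> 90 * (norm (A - mat lam))\<^sup>2"
proof -
  obtain s U V where A: "svd A s U V" using svd_exists by blast
  define Q where "Q = transpose V ** U"
  define r where "r = norm (A - mat lam)"
  have Q: "orthogonal_matrix Q" using svd_trace_cof(3)[OF A] by (simp add: Q_def)
  have q: "\<bar>Q$i$i\<bar> \<le> 1" for i using orthogonal_entry_le[OF Q] .
  have d: "det Q = 1 \<or> det Q = -1" using det_orthogonal_matrix[OF Q] .
  have s: "0 \<le> s$1" "s$1 \<le> s$2" "s$2 \<le> s$3" using A by (auto simp: svd_def)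
  have r: "0 < r" "lam \<le> 2 * r" using assms unfolding r_def by linarith+
  have "(s$3 - lam)\<^sup>2 \<le> (s$1 - lam)\<^sup>2 + (s$2 - lam)\<^sup>2 + (s$3 - lam)\<^sup>2" by simp
  also have "\<dots> \<le> r\<^sup>2" using singval_shift_le[OF A assms(1)] unfolding r_def .
  finally have "s$3 - lam \<le> r" by (rule power2_le_imp_le) (use r in simp)
  then have s3: "0 \<le> s$1" "0 \<le> s$2" "0 \<le> s$3" "s$1 \<le> 3 * r" "s$2 \<le> 3 * r" "s$3 \<le> 3 * r" using r s by auto
  have b1: "0 \<le> x * y * (1 - det Q * Q$i$i) \<and> x * y * (1 - det Q * Q$i$i) \<le> 18 * r\<^sup>2" 
    if "0 \<le> x" "0 \<le> y" "x \<le> 3 * r" "y \<le> 3 * r" for x y i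
  proof -
    have "0 \<le> 1 - det Q * Q$i$i" "1 - det Q * Q$i$i \<le> 2" using d q[of i] by auto
    moreover have "0 \<le> x * y" using that by simp
    moreover have "x * y \<le> (3 * r) * (3 * r)" using that r by (intro mult_mono[of x "3 * r" y "3 * r"]) auto
    ultimately have "0 \<le> x * y * (1 - det Q * Q$i$i) \<and> x * y * (1 - det Q * Q$i$i) \<le> (3 * r) * (3 * r) * 2"
      using that r by (intro conjI mult_mono mult_nonneg_nonneg) auto
    then show ?thesis by (simp add: power2_eq_square)
  qed
  have b2: "0 \<le> lam * (x * (1 - Q$i$i)) \<and> lam * (x * (1 - Q$i$i)) \<le> 12 * r\<^sup>2" 
    if "0 \<le> x" "x \<le> 3 * r" for x i
  proof -
    have "0 \<le> 1 - Q$i$i" "1 - Q$i$i \<le> 2" using q[of i] by auto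
    then have "0 \<le> lam * (x * (1 - Q$i$i)) \<and> lam * (x * (1 - Q$i$i)) \<le> (2 * r) * ((3 * r) * 2)"
      using that assms(1) r by (intro conjI mult_mono mult_nonneg_nonneg) auto
    then show ?thesis by (simp add: power2_eq_square)
  qed
  have G: "Gfun lam A = s$2 * s$3 * (1 - det Q * Q$1$1) + s$1 * s$3 * (1 - det Q * Q$2$2) + s$1 * s$2 * (1 - det Q * Q$3$3)
     - (lam * (s$1 * (1 - Q$1$1)) + lam * (s$2 * (1 - Q$2$2)) + lam * (s$3 * (1 - Q$3$3)))"
    unfolding Gfun_svd[OF A] Q_def[symmetric] by (simp only: distrib_left)
  have final: "\<bar>x1 + x2 + x3 - (y1 + y2 + y3)\<bar> \<le> 90 * R" 
    if "0 \<le> x1 \<and> x1 \<le> 18 * R" "0 \<le> x2 \<and> x2 \<le> 18 * R" "0 \<le> x3 \<and> x3 \<le> 18 * R"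
     "0 \<le> y1 \<and> y1 \<le> 12 * R" "0 \<le> y2 \<and> y2 \<le> 12 * R" "0 \<le> y3 \<and> y3 \<le> 12 * R" for x1 x2 x3 y1 y2 y3 R :: real
    using that by linarith
  show ?thesis unfolding G r_def[symmetric]
    by (intro final b1 b2 s3)
qed

text \<open>Near \<open>\<lambda>1\<close> the orthogonal factor \<open>Q = V\<^sup>T U\<close> has determinant 1, and \<open>G = \<Sum> (1 - Q\<^sub>i\<^sub>i) (s\<^sub>j s\<^sub>k - \<lambda> s\<^sub>i)\<close>
  is a quadratically small factor times a linearly small one.\<close>
lemma Gfun_near:
  assumes "lam > 0" "norm (A - mat lam) \<le> lam / 2"
  shows "\<bar>Gfun lam A\<bar> \<le> 21/2 / lam * (norm (A - mat lam)) ^ 3"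
proof -
  obtain s U V where A: "svd A s U V" using svd_exists by blast
  define Q where "Q = transpose V ** U"
  define r where "r = norm (A - mat lam)"
  have Q: "orthogonal_matrix Q" using svd_trace_cof(3)[OF A] by (simp add: Q_def)
  have q: "Q$i$i \<le> 1" for i using orthogonal_entry_le[OF Q, of i i] by simp
  have r: "0 \<le> r" "r \<le> lam / 2" using assms unfolding r_def by simp_all
  define a where "a = (\<lambda>i. s$i - lam)"
  have "(a 1)\<^sup>2 + (a 2)\<^sup>2 + (a 3)\<^sup>2 \<le> r\<^sup>2" using singval_shift_le[OF A assms(1)] unfolding r_def a_def .
  then have "(a 1)\<^sup>2 \<le> r\<^sup>2" "(a 2)\<^sup>2 \<le> r\<^sup>2" "(a 3)\<^sup>2 \<le> r\<^sup>2"
    using zero_le_power2[of "a 1"] zero_le_power2[of "a 2"] zero_le_power2[of "a 3"] by linarith+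
  then have a: "\<bar>a i\<bar> \<le> r" for i
    using exhaust_3[of i] r(1) by (auto intro: power2_le_imp_le simp: power2_abs)
  have s: "s$i \<ge> lam / 2" for i using a[of i] r unfolding a_def by auto
  have nn: "0 \<le> s$i * (1 - Q$i$i)" for i using s[of i] q[of i] assms(1) by auto
  have sum: "2 * lam * (s$1 * (1 - Q$1$1) + s$2 * (1 - Q$2$2) + s$3 * (1 - Q$3$3)) \<le> r\<^sup>2"
    using norm_shift[OF A, of lam] unfolding Q_def[symmetric] r_def[symmetric]
    by simp
  \<comment> \<open>The rotation part gives
    \<open>2 * lam * s$i * (1 - Q$i$i) \<le> r\<^sup>2\<close>, and here
    \<open>s$i \<ge> lam / 2\<close>.\<close>
  have t: "1 - Q$i$i \<le> r\<^sup>2 / lam\<^sup>2" for i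
  proof -
    have "s$i * (1 - Q$i$i) \<le> s$1 * (1 - Q$1$1) + s$2 * (1 - Q$2$2) + s$3 * (1 - Q$3$3)"
      using nn[of 1] nn[of 2] nn[of 3] exhaust_3[of i] by auto
    then have "2 * lam * (s$i * (1 - Q$i$i)) \<le> r\<^sup>2" using sum assms(1) 
      by (meson mult_left_mono order_trans less_imp_le zero_less_mult_iff zero_less_numeral)
    moreover have "lam / 2 * (1 - Q$i$i) \<le> s$i * (1 - Q$i$i)" using s[of i] q[of i] by (intro mult_right_mono) auto
    then have "2 * lam * (lam / 2 * (1 - Q$i$i)) \<le> 2 * lam * (s$i * (1 - Q$i$i))"
      using assms(1) by (intro mult_left_mono) auto
    ultimately have "lam\<^sup>2 * (1 - Q$i$i) \<le> r\<^sup>2" by (simp add: power2_eq_square)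
    then show ?thesis using assms(1) by (simp add: field_simps)
  qed
  \<comment> \<open>The radius \<open>lam / 2\<close> is what yields \<open>Q$i$i \<ge> 3/4\<close>,
    the threshold that forces \<open>det Q = 1\<close>.\<close>
  have "r\<^sup>2 / lam\<^sup>2 \<le> 1/4"
  proof -
    have "r\<^sup>2 \<le> (lam/2)\<^sup>2" using r by (intro power_mono) auto
    then show ?thesis using assms(1) by (simp add: field_simps power2_eq_square)
  qed
  then have "Q$i$i \<ge> 3/4" for i using t[of i] by linarith
  then have det: "det Q = 1" using det_near_identity[OF Q] by simp
  \<comment> \<open>In terms of \<open>a\<close> the contributions \<open>lam\<^sup>2\<close>
    cancel. The product costs \<open>1/2 * lam * r\<close> and the three linear terms
    \<open>lam * r\<close> each, hence 7/2, and 21/2 for three summands.\<close>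
  have b: "\<bar>(1 - Q$i$i) * (s$j * s$k - lam * s$i)\<bar> \<le> r\<^sup>2 / lam\<^sup>2 * (7/2 * lam * r)" for i j k
  proof -
    have "s$j * s$k - lam * s$i = a j * a k + lam * a j + lam * a k - lam * a i"
      by (simp add: a_def algebra_simps)
    moreover have "\<bar>a j * a k\<bar> \<le> r * (lam/2)" unfolding abs_mult
      using a[of j] a[of k] r by (intro mult_mono) auto
    moreover have "\<bar>lam * a m\<bar> \<le> lam * r" for m using a[of m] assms(1) by (auto simp: abs_mult)
    ultimately have "\<bar>s$j * s$k - lam * s$i\<bar> \<le> r * (lam/2) + lam * r + lam * r + lam * r"
      by (smt (verit))
    then have "\<bar>s$j * s$k - lam * s$i\<bar> \<le> 7/2 * lam * r" by (simp add: algebra_simps)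
    then show ?thesis unfolding abs_mult using q[of i] t[of i] by (intro mult_mono) auto
  qed
  have "Gfun lam A = (1 - Q$1$1) * (s$2 * s$3 - lam * s$1) + (1 - Q$2$2) * (s$1 * s$3 - lam * s$2)
      + (1 - Q$3$3) * (s$1 * s$2 - lam * s$3)"
    unfolding Gfun_svd[OF A] Q_def[symmetric] det by (simp add: algebra_simps)
  also have "\<bar>\<dots>\<bar> \<le> 3 * (r\<^sup>2 / lam\<^sup>2 * (7/2 * lam * r))"
    using b[of 1 2 3] b[of 2 1 3] b[of 3 1 2] by linarith
  also have "\<dots> = 21/2 / lam * r ^ 3" using assms(1) by (simp add: field_simps power2_eq_square power3_eq_cube)
  finally show ?thesis by (simp add: r_def)
qed

text \<open>Two equal singular values \<open>lam\<close> are rotated in their plane by an angle of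
  cosine \<open>1 - t\<close>, and the third is stretched by \<open>a\<close>. These matrices
  witness that \<open>M2\<close> and \<open>M3\<close> are positive at every radius.\<close>

lemma Gfun_example:
  assumes "lam > 0" "a > 0" "0 \<le> t" "t \<le> 1"
  shows "\<exists>A. Gfun lam A = 2 * lam * a * t \<and> (norm (A - mat lam))\<^sup>2 = a\<^sup>2 + 4 * lam\<^sup>2 * t"
proof -
  define c where "c = 1 - t"
  define d where "d = sqrt (1 - c\<^sup>2)"
  have "c\<^sup>2 \<le> 1" using assms by (simp add: c_def power_le_one)
  then have cd: "c\<^sup>2 + d\<^sup>2 = 1" by (simp add: d_def)
  define R where "R = (vector [vector [c,d,0], vector [-d,c,0], vector [0,0,1]] :: mat3)"
  define s where "s = (vector [lam, lam, lam + a] :: vec3)"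
  have R: "orthogonal_matrix R" using cd by (auto simp: orthogonal_matrix R_def mat3_simps power2_eq_square)
  have svd: "svd (R ** diagm s) s R (mat 1)"
    using assms R by (auto simp: svd_def s_def vector_3 orthogonal_matrix_id)
  have detR: "det R = 1" using cd by (simp add: R_def det_3 vector_3 power2_eq_square)
  have "Gfun lam (R ** diagm s) = 2 * lam * a * t"
    using Gfun_svd[OF svd, of lam] by (simp add: detR) (simp add: R_def s_def vector_3 c_def algebra_simps)
  moreover have "(norm (R ** diagm s - mat lam))\<^sup>2 = a\<^sup>2 + 4 * lam\<^sup>2 * t"
    using norm_shift[OF svd, of lam] by (simp add: R_def s_def vector_3 c_def power2_eq_square algebra_simps)
  ultimately show ?thesis by blast
qed

section \<open>The fixed point\<close>

text \<open>Uniform continuity on a compact annulus, applied to the radial move of \<open>X\<close>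
  to the sphere of radius \<open>r\<close>, which has length \<open>\<bar>r - norm X\<bar>\<close>.
  It compensates for the dependence on \<open>c\<close> of the sets over which suprema are
  taken.\<close>

lemma radial_uniform:
  fixes K :: "'a :: euclidean_space \<Rightarrow> real"
  assumes "continuous_on (- {0}) K" "c > 0" "e > 0"
  shows "\<exists>d>0. d < c \<and> (\<forall>X r. \<bar>norm X - c\<bar> < d \<longrightarrow> \<bar>r - c\<bar> < d \<longrightarrow> \<bar>K X - K ((r / norm X) *\<^sub>R X)\<bar> < e)"
proof -
  define C :: "'a set" where "C = cball 0 (2 * c) - ball 0 (c / 2)"
  have "compact C" by (simp add: C_def compact_diff)
  moreover have "continuous_on C K" using assms(2)
    by (intro continuous_on_subset[OF assms(1)]) (auto simp: C_def)
  ultimately have "uniformly_continuous_on C K" by (rule compact_uniformly_continuous[rotated])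
  then obtain d where d: "d > 0" "\<And>X Y. X \<in> C \<Longrightarrow> Y \<in> C \<Longrightarrow> dist Y X < d \<Longrightarrow> dist (K Y) (K X) < e"
    using assms(3) unfolding uniformly_continuous_on_def by metis
  show ?thesis
  proof (intro exI[of _ "min (c/2) (d/2)"] conjI allI impI)
    fix X :: 'a and r assume X: "\<bar>norm X - c\<bar> < min (c/2) (d/2)" and r: "\<bar>r - c\<bar> < min (c/2) (d/2)"
    have pos: "norm X > 0" "r > 0" using X r by linarith+
    have "c / 2 \<le> norm X" "norm X \<le> 2 * c" "c / 2 \<le> r" "r \<le> 2 * c" using X r by linarith+
    then have "X \<in> C" "(r / norm X) *\<^sub>R X \<in> C" using pos by (auto simp: C_def)
    moreover have "dist ((r / norm X) *\<^sub>R X) X < d"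
    proof -
      have "(r / norm X) *\<^sub>R X - X = (r / norm X - 1) *\<^sub>R X" by (simp add: algebra_simps)
      then have "dist ((r / norm X) *\<^sub>R X) X = \<bar>r / norm X - 1\<bar> * norm X" by (simp add: dist_norm)
      also have "\<dots> = \<bar>r - norm X\<bar>" using pos by (simp add: abs_mult_pos[symmetric] field_simps)
      also have "\<dots> < d" using X r by linarith
      finally show ?thesis .
    qed
    ultimately show "\<bar>K X - K ((r / norm X) *\<^sub>R X)\<bar> < e" using d(2)[of X "(r / norm X) *\<^sub>R X"]
      by (simp add: dist_norm abs_minus_commute)
  qed (use d assms in auto)
qed

text \<open>As \<open>x\<close> and \<open>y\<close> range over the same neighbourhood, exchanging
  them turns the one-sided estimate into a two-sided one.\<close>

lemma continuous_on_Ioi_onesidedI: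
  fixes f :: "real \<Rightarrow> real"
  assumes "\<And>c e. c > 0 \<Longrightarrow> e > 0 \<Longrightarrow> \<exists>d>0. \<forall>x y. \<bar>x - c\<bar> < d \<longrightarrow> \<bar>y - c\<bar> < d \<longrightarrow> f x \<le> f y + e"
  shows "continuous_on {0<..} f"
  unfolding continuous_on_iff
proof (intro ballI allI impI)
  fix c e :: real assume "c \<in> {0<..}" "e > 0"
  then obtain d where d: "d > 0" "\<And>x y. \<bar>x - c\<bar> < d \<Longrightarrow> \<bar>y - c\<bar> < d \<Longrightarrow> f x \<le> f y + e / 2"
    using assms[of c "e/2"] by auto
  show "\<exists>d>0. \<forall>x\<in>{0<..}. dist x c < d \<longrightarrow> dist (f x) (f c) < e"
  proof (intro exI[of _ d] conjI ballI impI d(1))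
    fix x assume "dist x c < d"
    then have "f x \<le> f c + e / 2" "f c \<le> f x + e / 2" using d(2)[of x c] d(2)[of c x] d(1)
      by (auto simp: dist_norm)
    then show "dist (f x) (f c) < e" using \<open>e > 0\<close> by (simp add: dist_norm abs_less_iff)
  qed
qed

lemma continuous_on_Sup_outside:
  fixes K :: "'a :: euclidean_space \<Rightarrow> real"
  assumes K: "continuous_on (- {0}) K" and bdd: "\<And>c. c > 0 \<Longrightarrow> bdd_above (K ` {X. c \<le> norm X})"
  shows "continuous_on {0<..} (\<lambda>c. Sup (K ` {X. c \<le> norm X}))"
proof (rule continuous_on_Ioi_onesidedI)
  fix c e :: real assume c: "c > 0" "e > 0"
  then obtain d where d: "d > 0" "d < c"
      "\<And>X r. \<bar>norm X - c\<bar> < d \<Longrightarrow> \<bar>r - c\<bar> < d \<Longrightarrow> \<bar>K X - K ((r / norm X) *\<^sub>R X)\<bar> < e"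
    using radial_uniform[OF K c] by blast
  show "\<exists>d>0. \<forall>x y. \<bar>x - c\<bar> < d \<longrightarrow> \<bar>y - c\<bar> < d \<longrightarrow>
      Sup (K ` {X. x \<le> norm X}) \<le> Sup (K ` {X. y \<le> norm X}) + e"
  proof (intro exI[of _ d] conjI allI impI d(1))
    fix x y assume xy: "\<bar>x - c\<bar> < d" "\<bar>y - c\<bar> < d"
    have pos: "x > 0" "y > 0" using xy d by linarith+
    have up: "K Y \<le> Sup (K ` {X. y \<le> norm X})" if "y \<le> norm Y" for Y
      using bdd[OF pos(2)] that by (intro cSup_upper) auto
    show "Sup (K ` {X. x \<le> norm X}) \<le> Sup (K ` {X. y \<le> norm X}) + e"
    proof (rule cSup_least)
      obtain X :: 'a where "norm X = x" using vector_choose_size[of x] pos by auto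
      then show "K ` {X. x \<le> norm X} \<noteq> {}" by auto
      fix k assume "k \<in> K ` {X. x \<le> norm X}"
      then obtain X where X: "k = K X" "x \<le> norm X" by auto
      show "k \<le> Sup (K ` {X. y \<le> norm X}) + e"
      proof (cases "y \<le> norm X")
        case True then show ?thesis using up[of X] X c by simp
      next
        case False
        then have "\<bar>norm X - c\<bar> < d" using X xy by auto
        then have "K X < K ((y / norm X) *\<^sub>R X) + e" using d(3)[of X y] xy by (simp add: abs_less_iff)
        moreover have "norm ((y / norm X) *\<^sub>R X) = y" using pos X by auto
        ultimately show ?thesis using up[of "(y / norm X) *\<^sub>R X"] X by auto
      qed
    qed
  qed
qed

lemma continuous_on_Sup_inside:
  fixes K :: "'a :: euclidean_space \<Rightarrow> real"
  assumes K: "continuous_on (- {0}) K" and bdd: "\<And>c. c > 0 \<Longrightarrow> bdd_above (K ` {X. 0 < norm X \<and> norm X < c})"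
  shows "continuous_on {0<..} (\<lambda>c. Sup (K ` {X. 0 < norm X \<and> norm X < c}))"
proof (rule continuous_on_Ioi_onesidedI)
  fix c e :: real assume c: "c > 0" "e > 0"
  then obtain d where d: "d > 0" "d < c"
      "\<And>X r. \<bar>norm X - c\<bar> < d \<Longrightarrow> \<bar>r - c\<bar> < d \<Longrightarrow> \<bar>K X - K ((r / norm X) *\<^sub>R X)\<bar> < e"
    using radial_uniform[OF K c] by blast
  show "\<exists>d>0. \<forall>x y. \<bar>x - c\<bar> < d \<longrightarrow> \<bar>y - c\<bar> < d \<longrightarrow>
      Sup (K ` {X. 0 < norm X \<and> norm X < x}) \<le> Sup (K ` {X. 0 < norm X \<and> norm X < y}) + e"
  proof (intro exI[of _ d] conjI allI impI d(1))
    fix x y assume xy: "\<bar>x - c\<bar> < d" "\<bar>y - c\<bar> < d"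
    have pos: "x > 0" "y > 0" using xy d by linarith+
    have up: "K Y \<le> Sup (K ` {X. 0 < norm X \<and> norm X < y})" if "0 < norm Y" "norm Y < y" for Y
      using bdd[OF pos(2)] that by (intro cSup_upper) auto
    show "Sup (K ` {X. 0 < norm X \<and> norm X < x}) \<le> Sup (K ` {X. 0 < norm X \<and> norm X < y}) + e"
    proof (rule cSup_least)
      obtain X :: 'a where "norm X = x/2" using vector_choose_size[of "x/2"] pos by auto
      then have "0 < norm X \<and> norm X < x" using pos by auto
      then show "K ` {X. 0 < norm X \<and> norm X < x} \<noteq> {}" by blast
      fix k assume "k \<in> K ` {X. 0 < norm X \<and> norm X < x}"
      then obtain X where X: "k = K X" "0 < norm X" "norm X < x" by auto
      show "k \<le> Sup (K ` {X. 0 < norm X \<and> norm X < y}) + e"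
      proof (cases "norm X < y")
        case True then show ?thesis using up[of X] X c by simp
      next
        case False
        \<comment> \<open>The set excludes its outer sphere, so the point is moved strictly inside
          radius \<open>y\<close> while \<open>r\<close> stays within \<open>d\<close> of
          \<open>c\<close>.\<close>
        define r where "r = (c - d + y) / 2"
        have "c - d < y" "y < c + d" using xy by linarith+
        then have r: "r < y" "\<bar>r - c\<bar> < d" "0 < r" using d(1,2) by (auto simp: r_def abs_less_iff field_simps)
        have "\<bar>norm X - c\<bar> < d" using X xy False by auto
        then have "K X < K ((r / norm X) *\<^sub>R X) + e" using d(3)[of X r] r by (simp add: abs_less_iff)
        moreover have "norm ((r / norm X) *\<^sub>R X) = r" using r X by auto
        ultimately show ?thesis using up[of "(r / norm X) *\<^sub>R X"] X r by auto
      qed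
    qed
  qed
qed

section \<open>Finiteness, positivity and monotonicity of \<open>M2\<close> and
  \<open>M3\<close>\<close>

lemma Gfun_outside:
  assumes "lam > 0" "c > 0"
  shows "\<exists>B. \<forall>A. c \<le> norm (A - mat lam) \<longrightarrow> \<bar>Gfun lam A\<bar> / norm (A - mat lam) ^ 2 \<le> B"
proof (intro exI allI impI)
  fix A :: mat3 assume A: "c \<le> norm (A - mat lam)"
  define r where "r = norm (A - mat lam)"
  have r: "r > 0" using A assms unfolding r_def by linarith
  show "\<bar>Gfun lam A\<bar> / norm (A - mat lam) ^ 2 \<le> 90"
  proof (cases "r \<ge> lam / 2")
    case True
    then show ?thesis using Gfun_far[OF assms(1), of A] r unfolding r_def[symmetric] by (simp add: field_simps)
  next
    case False
    \<comment> \<open>Near \<open>\<lambda>1\<close> one factor \<open>r < lam / 2\<close> of the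
      cubic bound is sacrificed to make it quadratic.\<close>
    then have "\<bar>Gfun lam A\<bar> \<le> 21/2 / lam * r * r^2"
      using Gfun_near[OF assms(1), of A] unfolding r_def[symmetric] by (simp add: power2_eq_square power3_eq_cube)
    also have "\<dots> \<le> 90 * r^2" using False assms(1) by (intro mult_right_mono) (auto simp: field_simps)
    finally show ?thesis using r unfolding r_def[symmetric] by (simp add: field_simps)
  qed
qed

lemma Gfun_inside:
  assumes "lam > 0" "c > 0"
  shows "\<exists>B. \<forall>A. 0 < norm (A - mat lam) \<and> norm (A - mat lam) < c \<longrightarrow> \<bar>Gfun lam A\<bar> / norm (A - mat lam) ^ 3 \<le> B"
proof (intro exI allI impI)
  fix A :: mat3 assume A: "0 < norm (A - mat lam) \<and> norm (A - mat lam) < c"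
  define r where "r = norm (A - mat lam)"
  have r: "r > 0" using A by (simp add: r_def)
  show "\<bar>Gfun lam A\<bar> / norm (A - mat lam) ^ 3 \<le> 180 / lam"
  proof (cases "r \<ge> lam / 2")
    case True
    have "\<bar>Gfun lam A\<bar> \<le> 90 * r^2" using Gfun_far[OF assms(1), of A] True unfolding r_def[symmetric] by simp
    \<comment> \<open>The factor \<open>2 * r / lam\<close>, at least 1 here, raises the quadratic
      bound to a cubic one and doubles 90.\<close>
    also have "\<dots> \<le> 180 / lam * r * r^2" using True assms(1) by (intro mult_right_mono) (auto simp: field_simps)
    finally show ?thesis using r unfolding r_def[symmetric]
      by (simp add: pos_divide_le_eq power2_eq_square power3_eq_cube mult.assoc)
  next
    case False
    then have "\<bar>Gfun lam A\<bar> \<le> 21/2 / lam * r^3"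
      using Gfun_near[OF assms(1), of A] unfolding r_def[symmetric] by simp
    also have "\<dots> \<le> 180 / lam * r^3" using r assms(1) by (intro mult_right_mono) (auto simp: field_simps)
    finally show ?thesis using r unfolding r_def[symmetric] by (simp add: pos_divide_le_eq)
  qed
qed

lemma bdd_M2: "lam > 0 \<Longrightarrow> c > 0 \<Longrightarrow> 
   bdd_above ((\<lambda>A. \<bar>Gfun lam A\<bar> / norm (A - mat lam) ^ 2) ` {A. norm (A - mat lam) \<ge> c})"
  using Gfun_outside[of lam c] unfolding bdd_above_def by auto

lemma bdd_M3: "lam > 0 \<Longrightarrow> c > 0 \<Longrightarrow> 
   bdd_above ((\<lambda>A. \<bar>Gfun lam A\<bar> / norm (A - mat lam) ^ 3) ` {A. 0 < norm (A - mat lam) \<and> norm (A - mat lam) < c})"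
  using Gfun_inside[of lam c] unfolding bdd_above_def by auto

lemma M2_bound:
  fixes A :: mat3
  assumes "lam > 0" "c > 0" "norm (A - mat lam) \<ge> c"
  shows "\<bar>Gfun lam A\<bar> \<le> M2 lam c * norm (A - mat lam) ^ 2"
proof -
  have "\<bar>Gfun lam A\<bar> / norm (A - mat lam) ^ 2 \<le> M2 lam c" unfolding M2_def
    using assms bdd_M2[OF assms(1,2)] by (intro cSup_upper) auto
  moreover have "norm (A - mat lam) > 0" using assms by linarith
  ultimately show ?thesis by (simp add: pos_divide_le_eq)
qed

lemma M3_bound:
  fixes A :: mat3
  assumes "lam > 0" "c > 0" "0 < norm (A - mat lam)" "norm (A - mat lam) < c"
  shows "\<bar>Gfun lam A\<bar> \<le> M3 lam c * norm (A - mat lam) ^ 3"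
proof -
  have "\<bar>Gfun lam A\<bar> / norm (A - mat lam) ^ 3 \<le> M3 lam c" unfolding M3_def
    using assms bdd_M3[OF assms(1,2)] by (intro cSup_upper) auto
  then show ?thesis using assms(3) by (simp add: pos_divide_le_eq)
qed

lemma M2_pos:
  assumes "lam > 0" "c > 0" shows "M2 lam c > 0"
proof -
  obtain A where A: "Gfun lam A = 2 * lam * c * 1" "(norm (A - mat lam))\<^sup>2 = c\<^sup>2 + 4 * lam\<^sup>2 * 1"
    using Gfun_example[of lam c 1] assms by auto
  then have "c\<^sup>2 \<le> (norm (A - mat lam))\<^sup>2" by simp
  then have "c \<le> norm (A - mat lam)" by (rule power2_le_imp_le) simp
  then have "2 * lam * c \<le> M2 lam c * norm (A - mat lam) ^ 2" 
    using M2_bound[of lam c A] assms A by simp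
  moreover have "2 * lam * c > 0" using assms by simp
  ultimately have "M2 lam c * norm (A - mat lam) ^ 2 > 0" by linarith
  then show ?thesis by (simp add: zero_less_mult_iff)
qed

lemma M3_pos:
  assumes "lam > 0" "c > 0" shows "M3 lam c > 0"
proof -
  \<comment> \<open>With \<open>a = c/2\<close> in \<open>Gfun_example\<close>, this keeps the
    squared distance at most \<open>c\<^sup>2 / 2\<close>, inside the open ball; the minimum with 1
    keeps \<open>t\<close> in the permitted range.\<close>
  define t where "t = min 1 (c\<^sup>2 / (16 * lam\<^sup>2))"
  have t: "0 < t" "t \<le> 1" using assms by (simp_all add: t_def)
  have "4 * lam\<^sup>2 * t \<le> 4 * lam\<^sup>2 * (c\<^sup>2 / (16 * lam\<^sup>2))" by (intro mult_left_mono) (simp_all add: t_def)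
  also have "\<dots> = c\<^sup>2 / 4" using assms by simp
  finally have t3: "4 * lam\<^sup>2 * t \<le> c\<^sup>2 / 4" .
  obtain A where A: "Gfun lam A = 2 * lam * (c/2) * t" "(norm (A - mat lam))\<^sup>2 = (c/2)\<^sup>2 + 4 * lam\<^sup>2 * t"
    using Gfun_example[OF assms(1) half_gt_zero[OF assms(2)] less_imp_le[OF t(1)] t(2)] by blast
  have "(c/2)\<^sup>2 = c\<^sup>2 / 4" "0 < c\<^sup>2" using assms by (simp_all add: power_divide)
  then have "(norm (A - mat lam))\<^sup>2 < c\<^sup>2" using A(2) t3 by linarith
  then have "norm (A - mat lam) < c" by (rule power2_less_imp_less) (use assms in simp)
  moreover have "0 < (c/2)\<^sup>2 + 4 * lam\<^sup>2 * t" using t assms by (intro add_pos_pos) auto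
  then have "(norm (A - mat lam))\<^sup>2 > 0" unfolding A(2) .
  then have n: "norm (A - mat lam) > 0" by simp
  ultimately have "2 * lam * (c/2) * t \<le> M3 lam c * norm (A - mat lam) ^ 3" 
    using M3_bound[of lam c A] assms unfolding A(1) by simp
  moreover have "2 * lam * (c/2) * t > 0" using assms t by simp
  ultimately have "M3 lam c * norm (A - mat lam) ^ 3 > 0" by linarith
  then show ?thesis using n by (simp add: zero_less_mult_iff)
qed

lemma M2_antimono:
  assumes "lam > 0" "0 < c" "c \<le> c'" shows "M2 lam c' \<le> M2 lam c"
  unfolding M2_def
proof (rule cSup_subset_mono)
  obtain X :: mat3 where "norm X = c'" using vector_choose_size[of c'] assms by auto
  then have "X + mat lam \<in> {A. c' \<le> norm (A - mat lam)}" by simp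
  then show "(\<lambda>A. \<bar>Gfun lam A\<bar> / (norm (A - mat lam))\<^sup>2) ` {A. c' \<le> norm (A - mat lam)} \<noteq> {}" by blast
qed (use assms bdd_M2 in auto)

lemma M3_mono:
  assumes "lam > 0" "0 < c" "c \<le> c'" shows "M3 lam c \<le> M3 lam c'"
  unfolding M3_def
proof (rule cSup_subset_mono)
  obtain X :: mat3 where "norm X = c/2" using vector_choose_size[of "c/2"] assms by auto
  then have "X + mat lam \<in> {A. 0 < norm (A - mat lam) \<and> norm (A - mat lam) < c}" using assms \<open>norm X = c/2\<close> by auto
  then show "(\<lambda>A. \<bar>Gfun lam A\<bar> / norm (A - mat lam) ^ 3) ` {A. 0 < norm (A - mat lam) \<and> norm (A - mat lam) < c} \<noteq> {}" 
    by blast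
qed (use assms bdd_M3[of lam c'] in auto)

lemma shift_image:
  fixes p :: "'a :: real_normed_vector"
  shows "(\<lambda>A. f A (norm (A - p))) ` {A. P (norm (A - p))} = (\<lambda>X. f (X + p) (norm X)) ` {X. P (norm X)}"
proof -
  have "(\<lambda>X. X + p) ` {X. P (norm X)} = {A. P (norm (A - p))}"
    by (force intro: image_eqI[where x = "a - p" for a])
  then show ?thesis by (auto simp: image_image simp flip: \<open>_ = {A. P (norm (A - p))}\<close>)
qed

lemma continuous_on_M2: assumes "lam > 0" shows "continuous_on {0<..} (M2 lam)"
proof -
  have e: "M2 lam = (\<lambda>c. Sup ((\<lambda>X. \<bar>Gfun lam (X + mat lam)\<bar> / norm X ^ 2) ` {X. c \<le> norm X}))"
    using shift_image[of "\<lambda>A r. \<bar>Gfun lam A\<bar> / r ^ 2" "mat lam" "\<lambda>r. c \<le> r" for c]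
    by (auto simp: M2_def fun_eq_iff)
  show ?thesis unfolding e
  proof (rule continuous_on_Sup_outside)
    show "continuous_on (- {0}) (\<lambda>X. \<bar>Gfun lam (X + mat lam)\<bar> / norm X ^ 2)"
      by (intro continuous_intros continuous_on_compose2[OF continuous_on_Gfun[of UNIV]]) auto
    show "bdd_above ((\<lambda>X. \<bar>Gfun lam (X + mat lam)\<bar> / (norm X)\<^sup>2) ` {X. c \<le> norm X})" if "0 < c" for c
      using bdd_M2[OF assms that] shift_image[of "\<lambda>A r. \<bar>Gfun lam A\<bar> / r ^ 2" "mat lam" "\<lambda>r. c \<le> r"]
      by auto
  qed
qed

lemma continuous_on_M3: assumes "lam > 0" shows "continuous_on {0<..} (M3 lam)"
proof -
  have e: "M3 lam = (\<lambda>c. Sup ((\<lambda>X. \<bar>Gfun lam (X + mat lam)\<bar> / norm X ^ 3) ` {X. 0 < norm X \<and> norm X < c}))"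
    using shift_image[of "\<lambda>A r. \<bar>Gfun lam A\<bar> / r ^ 3" "mat lam" "\<lambda>r. 0 < r \<and> r < c" for c]
    by (simp add: M3_def fun_eq_iff)
  show ?thesis unfolding e
  proof (rule continuous_on_Sup_inside)
    show "continuous_on (- {0}) (\<lambda>X. \<bar>Gfun lam (X + mat lam)\<bar> / norm X ^ 3)"
      by (intro continuous_intros continuous_on_compose2[OF continuous_on_Gfun[of UNIV]]) auto
    show "bdd_above ((\<lambda>X. \<bar>Gfun lam (X + mat lam)\<bar> / norm X ^ 3) ` {X. 0 < norm X \<and> norm X < c})" if "0 < c" for c
      using bdd_M3[OF assms that] shift_image[of "\<lambda>A r. \<bar>Gfun lam A\<bar> / r ^ 3" "mat lam" "\<lambda>r. 0 < r \<and> r < c"]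
      by simp
  qed
qed

text \<open>The quotient is nonincreasing, so it has at most one fixed point, and that point must
  lie between 1 and its image \<open>k\<close>. Monotonicity gives \<open>g\<close> opposite weak
  signs at these two ends, and continuity gives the zero.\<close>

lemma cstar_fixed_point:
  assumes "lam > 0"
  shows "0 < cstar lam \<and> M2 lam (cstar lam) / M3 lam (cstar lam) = cstar lam"
  unfolding cstar_def
proof (rule theI')
  define g where "g = (\<lambda>c. M2 lam c - c * M3 lam c)"
  define k where "k = M2 lam 1 / M3 lam 1"
  have p: "M2 lam 1 > 0" "M3 lam 1 > 0" using M2_pos M3_pos assms by auto
  then have k: "k > 0" "M2 lam 1 = k * M3 lam 1" by (auto simp: k_def)
  have "0 \<le> g (min 1 k)"
  proof -
    have "min 1 k * M3 lam (min 1 k) \<le> k * M3 lam 1" 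
      using k p M3_mono[OF assms, of "min 1 k" 1] M3_pos[OF assms, of "min 1 k"] by (intro mult_mono) auto
    then show ?thesis using M2_antimono[OF assms, of "min 1 k" 1] k by (auto simp: g_def)
  qed
  moreover have "g (max 1 k) \<le> 0"
  proof -
    have "k * M3 lam 1 \<le> max 1 k * M3 lam (max 1 k)" 
      using k p M3_mono[OF assms, of 1 "max 1 k"] by (intro mult_mono) auto
    then show ?thesis using M2_antimono[OF assms, of 1 "max 1 k"] k by (auto simp: g_def)
  qed
  moreover have "continuous_on {min 1 k..max 1 k} g" unfolding g_def
    by (intro continuous_intros continuous_on_subset[OF continuous_on_M2[OF assms]]
        continuous_on_subset[OF continuous_on_M3[OF assms]]) (use k in auto)
  ultimately obtain c where c: "min 1 k \<le> c" "g c = 0"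
    using IVT2'[of g "max 1 k" 0 "min 1 k"] by (auto simp: min_le_iff_disj)
  then have c0: "c > 0" using k by (auto simp: min_le_iff_disj)
  then have fp: "M2 lam c / M3 lam c = c" using c M3_pos[OF assms c0] by (simp add: g_def)
  have uniq: "\<not> x < y" if "0 < x" "M2 lam x / M3 lam x = x" "0 < y" "M2 lam y / M3 lam y = y" for x y
  proof
    assume "x < y"
    have "M2 lam y / M3 lam y \<le> M2 lam x / M3 lam x"
      using M2_antimono[OF assms, of x y] M3_mono[OF assms, of x y] M3_pos[OF assms, of x] M2_pos[OF assms, of x]
        that \<open>x < y\<close> by (intro frac_le) auto
    then show False using that \<open>x < y\<close> by simp
  qed
  show "\<exists>!c. 0 < c \<and> M2 lam c / M3 lam c = c"
    using c0 fp uniq by (metis linorder_neqE_linordered_idom)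
qed

text \<open>Since \<open>M2 = c * M3\<close> at the fixed point, the constant is
  \<open>c powr (q - 3) / M3\<close>. Outside radius \<open>c\<close> the exponent
  \<open>q - 2 > 0\<close> raises a square to the power \<open>q\<close>; inside,
  \<open>q - 3 < 0\<close> does the same for a cube.\<close>

lemma Gfun_le_powr:
  assumes lam: "lam > 0" and q: "2 < q" "q < 3"
  shows "M2 lam (cstar lam) powr (q - 3) * M3 lam (cstar lam) powr (2 - q) * \<bar>Gfun lam A\<bar>
     \<le> norm (A - mat lam) powr q"
proof -
  define c where "c = cstar lam"
  define r where "r = norm (A - mat lam)"
  define m2 m3 where "m2 = M2 lam c" and "m3 = M3 lam c"
  have c: "c > 0" "m2 / m3 = c" using cstar_fixed_point[OF lam] by (auto simp: c_def m2_def m3_def)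
  have m: "m2 > 0" "m3 > 0" using M2_pos M3_pos lam c by (auto simp: m2_def m3_def)
  then have m2: "m2 = c * m3" using c by (auto simp: field_simps)
  have f: "m2 powr (q - 3) * m3 powr (2 - q) = c powr (q - 3) * m3 powr (-1)"
    using m c unfolding m2 by (simp add: powr_mult mult.assoc flip: powr_add)
  have "c powr (q - 3) * m3 powr (-1) * \<bar>Gfun lam A\<bar> \<le> r powr q"
  proof (cases "r = 0")
    \<comment> \<open>\<open>M3_bound\<close> excludes distance 0, where the cubic estimate near
      \<open>\<lambda>1\<close> gives \<open>G = 0\<close> directly.\<close>
    case True
    then have "Gfun lam A = 0" using Gfun_near[OF lam, of A] lam unfolding r_def[symmetric] by simp
    then show ?thesis by simp
  next
    case False
    then have r: "r > 0" by (simp add: r_def)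
    show ?thesis
    proof (cases "r \<ge> c")
      case True
      have "c powr (q - 3) * m3 powr (-1) * \<bar>Gfun lam A\<bar> \<le> c powr (q - 3) * m3 powr (-1) * (m2 * r^2)"
        using M2_bound[OF lam c(1), of A] True unfolding r_def m2_def by (intro mult_left_mono) auto
      also have "\<dots> = c powr (q - 3 + 1) * (m3 powr (-1) * m3) * r\<^sup>2"
        using c unfolding m2 powr_add by simp
      also have "\<dots> = c powr (q - 2) * r powr 2" using m r by (simp add: powr_minus)
      also have "\<dots> \<le> r powr (q - 2) * r powr 2" using True c q by (intro mult_right_mono powr_mono2) auto
      also have "\<dots> = r powr q" by (simp flip: powr_add)
      finally show ?thesis .
    next
      case False
      have "c powr (q - 3) * m3 powr (-1) * \<bar>Gfun lam A\<bar> \<le> c powr (q - 3) * m3 powr (-1) * (m3 * r^3)"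
        using M3_bound[OF lam c(1), of A] False r unfolding r_def m3_def by (intro mult_left_mono) auto
      also have "\<dots> = c powr (q - 3) * r powr 3" using m r by (simp add: powr_minus)
      also have "\<dots> \<le> r powr (q - 3) * r powr 3" using False r q by (intro mult_right_mono powr_mono2') auto
      also have "\<dots> = r powr q" by (simp flip: powr_add)
      finally show ?thesis .
    qed
  qed
  then show ?thesis unfolding c_def[symmetric] m2_def[symmetric] m3_def[symmetric] f r_def .
qed

section \<open>Pointwise inequalities\<close>

text \<open>For \<open>q > 2\<close> this is the minimum of
  \<open>(1 + y) powr (q / 2) / (y / 2)\<close> over \<open>y > 0\<close>, attained at
  \<open>y = 2 / (q - 2)\<close>.\<close>

definition Kq :: "real \<Rightarrow> real" where "Kq q = (q - 2) powr ((2 - q) / 2) * q powr (q / 2)"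

text \<open>Weighted AM-GM with weights \<open>1 - 2 / q\<close> and \<open>2 / q\<close>, raised to
  the power \<open>q / 2\<close>. The points \<open>a\<close> and \<open>b\<close> have weighted
  mean \<open>1 + y\<close> and coincide exactly at the optimal \<open>y\<close>.\<close>

lemma Kq_bernoulli:
  assumes q: "2 < q" and y: "y > 0" shows "Kq q * (y / 2) \<le> (1 + y) powr (q / 2)"
proof -
  define a where "a = q / (q - 2)"
  define b where "b = y * q / 2"
  define e where "e = q / 2 - 1"
  have ab: "a > 0" "b > 0" using q y by (simp_all add: a_def b_def)
  have w: "0 \<le> 1 - 2 / q" "0 \<le> 2 / q" "(1 - 2 / q) + 2 / q = 1" using q by simp_all
  have s: "(1 - 2 / q) * a + 2 / q * b = 1 + y"
  proof -
    have "1 - 2 / q = (q - 2) / q" using q by (simp add: diff_divide_distrib)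
    then show ?thesis using q by (simp add: a_def b_def)
  qed
  have e: "(1 - 2 / q) * (q / 2) = e" "2 / q * (q / 2) = 1" using q by (simp_all add: e_def left_diff_distrib)
  have "(a powr (1 - 2 / q) * b powr (2 / q)) powr (q / 2) \<le> ((1 - 2 / q) * a + 2 / q * b) powr (q / 2)"
    by (rule powr_mono2[OF _ _ Youngs_inequality_0[OF w ab]]) (use q in simp_all)
  also have "(a powr (1 - 2 / q) * b powr (2 / q)) powr (q / 2) = a powr e * b"
  proof -
    have "(a powr (1 - 2 / q) * b powr (2 / q)) powr (q / 2)
        = (a powr (1 - 2 / q)) powr (q / 2) * (b powr (2 / q)) powr (q / 2)"
      by (rule powr_mult)
    also have "\<dots> = a powr e * b powr 1" unfolding powr_powr e ..
    finally show ?thesis using ab by simp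
  qed
  also have "a powr e = q powr e / (q - 2) powr e" unfolding a_def by (rule powr_divide)
  also have "\<dots> = q powr e * (q - 2) powr (- e)" unfolding powr_minus by (rule divide_inverse)
  also have "- e = (2 - q) / 2" by (simp add: e_def diff_divide_distrib)
  also have "q powr e * (q - 2) powr ((2 - q) / 2) * b = (q - 2) powr ((2 - q) / 2) * (q powr e * q) * (y / 2)"
    by (simp add: b_def)
  also have "q powr e * q = q powr (e + 1)" unfolding powr_add using q by simp
  also have "e + 1 = q / 2" by (simp add: e_def)
  finally show ?thesis unfolding s Kq_def .
qed

lemma Kq_nonneg: "Kq q \<ge> 0" by (simp add: Kq_def)

text \<open>Dividing by \<open>t powr q\<close> reduces to \<open>y = p / t\<^sup>2\<close>, up to a
  factor \<open>t powr (q - 3)\<close>. Because \<open>q < 3\<close> this factor decreases in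
  \<open>t\<close>, so \<open>t \<le> lam\<close> permits replacing it by
  \<open>lam powr (q - 3)\<close>.\<close>

lemma product_bound_pos:
  assumes q: "2 < q" "q < 3" and t: "0 < t" "t \<le> lam" and p: "p > 0"
  shows "lam powr (q - 3) * Kq q * (t * (p / 2)) \<le> (t\<^sup>2 + p) powr (q / 2)"
proof -
  have t2: "t powr 2 = t\<^sup>2" using t by simp
  have "lam powr (q - 3) * Kq q * (t * (p / 2)) \<le> t powr (q - 3) * Kq q * (t * (p / 2))"
    using t p q Kq_nonneg by (intro mult_right_mono powr_mono2') auto
  also have "t powr (q - 3) * Kq q * (t * (p / 2)) = t powr q * (Kq q * (p / t\<^sup>2 / 2))"
  proof -
    have "t powr q = t powr (q - 3) * t powr 3" by (simp flip: powr_add)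
    also have "t powr 3 = t * t\<^sup>2" using t by (simp add: power2_eq_square power3_eq_cube)
    finally show ?thesis using t by simp
  qed
  also have "\<dots> \<le> t powr q * (1 + p / t\<^sup>2) powr (q / 2)"
    using Kq_bernoulli[OF q(1), of "p / t\<^sup>2"] t p by (intro mult_left_mono) auto
  also have "t powr q = (t\<^sup>2) powr (q / 2)" unfolding t2[symmetric] powr_powr by simp
  also have "(t\<^sup>2) powr (q / 2) * (1 + p / t\<^sup>2) powr (q / 2) = (t\<^sup>2 * (1 + p / t\<^sup>2)) powr (q / 2)"
    by (rule powr_mult[symmetric])
  also have "t\<^sup>2 * (1 + p / t\<^sup>2) = t\<^sup>2 + p" using t by (simp add: field_simps)
  finally show ?thesis .
qed

text \<open>Only a negative product matters. Then some factor is negative, with absolute value at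
  most \<open>lam\<close>, and the other two have a positive product, at most half the sum of their
  squares.\<close>

lemma product_bound:
  assumes q: "2 < q" "q < 3" and lam: "lam > 0" and a: "a \<ge> - lam" "b \<ge> - lam" "c \<ge> - lam"
  shows "lam powr (q - 3) * Kq q * (- (a * b * c)) \<le> (a\<^sup>2 + b\<^sup>2 + c\<^sup>2) powr (q / 2)"
proof (cases "a * b * c < 0")
  case False
  then have "lam powr (q - 3) * Kq q * (- (a * b * c)) \<le> 0"
    using Kq_nonneg[of q] by (intro mult_nonneg_nonpos) auto
  then show ?thesis by (rule order_trans) simp
next
  case True
  have main: "lam powr (q - 3) * Kq q * (- (x * y * z)) \<le> (x\<^sup>2 + y\<^sup>2 + z\<^sup>2) powr (q / 2)"
    if "x \<ge> - lam" "x < 0" "x * y * z < 0" for x y z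
  proof -
    have yz: "y * z > 0" using that by (simp add: mult.assoc mult_less_0_iff)
    have "2 * (y * z) \<le> y\<^sup>2 + z\<^sup>2" using sum_squares_bound[of y z] by simp
    then have "- (x * y * z) \<le> (- x) * ((y\<^sup>2 + z\<^sup>2) / 2)"
      using that mult_left_mono[of "y * z" "(y\<^sup>2 + z\<^sup>2) / 2" "- x"] by (simp add: mult.assoc)
    then have "lam powr (q - 3) * Kq q * (- (x * y * z)) \<le> lam powr (q - 3) * Kq q * ((- x) * ((y\<^sup>2 + z\<^sup>2) / 2))"
      using Kq_nonneg by (intro mult_left_mono) auto
    also have "\<dots> \<le> ((- x)\<^sup>2 + (y\<^sup>2 + z\<^sup>2)) powr (q / 2)"
    proof (rule product_bound_pos[OF q])
      show "0 < y\<^sup>2 + z\<^sup>2" using yz by (auto simp: sum_power2_gt_zero_iff)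
    qed (use that in auto)
    also have "(- x)\<^sup>2 + (y\<^sup>2 + z\<^sup>2) = x\<^sup>2 + y\<^sup>2 + z\<^sup>2" by simp
    finally show ?thesis .
  qed
  have "a < 0 \<or> b < 0 \<or> c < 0" using True 
    by (meson mult_nonneg_nonneg not_le)
  then show ?thesis
    using main[of a b c] main[of b a c] main[of c a b] True a by (auto simp: ac_simps)
qed

text \<open>The \<open>2 * k\<close> consists of one \<open>k\<close> for the triple product of the
  \<open>s$i - lam\<close> and one for \<open>lam\<close> times G, matching the two entries of the
  minimum in \<open>lam_bound\<close>.\<close>

lemma Gfun_pointwise:
  assumes lam: "lam > 0" and q: "2 < q" "q < 3" and k: "0 \<le> k" and A: "det A > 0"
    and d: "0 \<le> d" "lam powr (3 - q) * d \<le> k * Kq q"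
     "lam powr (3 - q) * d \<le> k * lam powr (2 - q) * M2 lam (cstar lam) powr (q - 3) * M3 lam (cstar lam) powr (2 - q)"
  shows "d * (det A - lam ^ 3) \<ge> d * lam * (trace (cof A) - lam * trace A) - 2 * k * norm (A - mat lam) powr q"
proof -
  obtain s U V where svd: "svd A s U V" using svd_exists by blast
  define Q where "Q = transpose V ** U"
  have s: "0 \<le> s$1" "0 \<le> s$2" "0 \<le> s$3" using svd by (auto simp: svd_def)
  have Q: "orthogonal_matrix Q" using svd_trace_cof(3)[OF svd] by (simp add: Q_def)
  have det: "det A = det Q * (s$1 * s$2 * s$3)" using svd_trace_cof(4)[OF svd] by (simp add: Q_def)
  \<comment> \<open>\<open>det A > 0\<close> excludes \<open>det Q = -1\<close>; otherwise the
    expansion of \<open>det A\<close> would have the wrong sign.\<close>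
  have "0 \<le> s$1 * s$2 * s$3" using s by simp
  then have dA: "det A = s$1 * s$2 * s$3" using det_orthogonal_matrix[OF Q] A det by auto
  define a where "a = (\<lambda>i. s$i - lam)"
  define X where "X = norm (A - mat lam)"
  have GN: "Gfun lam A + (trace (cof A) - lam * trace A) = s$1 * s$2 + s$1 * s$3 + s$2 * s$3 - lam * (s$1 + s$2 + s$3)"
    by (simp add: Gfun_def singvals_eqI[OF svd] Let_def)
  then have e: "det A - lam ^ 3 = a 1 * a 2 * a 3 + lam * (Gfun lam A + (trace (cof A) - lam * trace A))"
    unfolding GN by (simp add: dA a_def power3_eq_cube algebra_simps)
  have p: "lam powr (q - 3) * lam powr (3 - q) = 1" "lam * lam powr (2 - q) = lam powr (3 - q)"
    using lam by (simp_all flip: powr_add) (simp add: powr_mult_base)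
  have "(a 1)\<^sup>2 + (a 2)\<^sup>2 + (a 3)\<^sup>2 \<le> X\<^sup>2"
    using singval_shift_le[OF svd lam] by (simp add: a_def X_def)
  then have "((a 1)\<^sup>2 + (a 2)\<^sup>2 + (a 3)\<^sup>2) powr (q/2) \<le> (X\<^sup>2) powr (q/2)"
    using q by (intro powr_mono2) auto
  also have "(X\<^sup>2) powr (q/2) = X powr q"
  proof -
    have "X\<^sup>2 = X powr 2" by (simp add: X_def)
    then show ?thesis by (simp only: powr_powr) simp
  qed
  finally have X: "((a 1)\<^sup>2 + (a 2)\<^sup>2 + (a 3)\<^sup>2) powr (q/2) \<le> X powr q" .
  have 1: "d * (- (a 1 * a 2 * a 3)) \<le> k * X powr q"
  proof (cases "- (a 1 * a 2 * a 3) \<le> 0")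
    case True
    have "d * (- (a 1 * a 2 * a 3)) \<le> 0" using d(1) True by (rule mult_nonneg_nonpos)
    also have "0 \<le> k * X powr q" using k by simp
    finally show ?thesis .
  next
    case False
    have "d = lam powr (q - 3) * (lam powr (3 - q) * d)" using p by (simp add: mult.assoc[symmetric])
    also have "\<dots> \<le> lam powr (q - 3) * (k * Kq q)" using d by (intro mult_left_mono) auto
    finally have "d * (- (a 1 * a 2 * a 3)) \<le> lam powr (q - 3) * (k * Kq q) * (- (a 1 * a 2 * a 3))"
      using False by (intro mult_right_mono) auto
    also have "\<dots> = k * (lam powr (q - 3) * Kq q * (- (a 1 * a 2 * a 3)))" by simp
    also have "\<dots> \<le> k * X powr q"
      using product_bound[OF q lam, of "a 1" "a 2" "a 3"] X k s by (intro mult_left_mono) (auto simp: a_def)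
    finally show ?thesis .
  qed
  have 2: "d * lam * \<bar>Gfun lam A\<bar> \<le> k * X powr q"
  proof -
    define m where "m = M2 lam (cstar lam) powr (q - 3) * M3 lam (cstar lam) powr (2 - q)"
    have "d * lam = (lam powr (q - 3) * lam) * (lam powr (3 - q) * d)" using p by simp
    also have "\<dots> \<le> (lam powr (q - 3) * lam) * (k * lam powr (2 - q) * m)"
      using d(3) lam by (intro mult_left_mono) (auto simp: m_def mult.assoc)
    also have "\<dots> = k * m * (lam powr (q - 3) * (lam * lam powr (2 - q)))" by simp
    also have "\<dots> = k * m" unfolding p by simp
    finally have "d * lam * \<bar>Gfun lam A\<bar> \<le> k * m * \<bar>Gfun lam A\<bar>" by (intro mult_right_mono) auto
    also have "\<dots> = k * (m * \<bar>Gfun lam A\<bar>)" by simp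
    also have "\<dots> \<le> k * X powr q" using Gfun_le_powr[OF lam q, of A] k
      unfolding m_def X_def by (intro mult_left_mono) auto
    finally show ?thesis .
  qed
  have "- (d * lam * Gfun lam A) \<le> d * lam * \<bar>Gfun lam A\<bar>"
    using d(1) lam by (metis abs_ge_minus_self abs_mult abs_of_nonneg mult_nonneg_nonneg less_imp_le)
  then show ?thesis using 1 2 unfolding e X_def[symmetric] by (simp add: algebra_simps)
qed

text \<open>A hyperplane separates the graph point from the strict epigraph. It cannot be vertical,
  because \<open>Z\<close> is finite everywhere and the epigraph therefore has points over
  \<open>A - p\<close> too.\<close>

lemma convex_subgradient:
  fixes Z :: "'a :: euclidean_space \<Rightarrow> real"
  assumes "convex_on UNIV Z"
  shows "\<exists>S. \<forall>B. Z B \<ge> Z A + S \<bullet> (B - A)"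
proof -
  define E where "E = {p :: 'a \<times> real. Z (fst p) < snd p}"
  have "convex E" unfolding convex_alt
  proof (intro ballI allI impI)
    fix x y :: "'a \<times> real" and u :: real assume xy: "x \<in> E" "y \<in> E" and u: "0 \<le> u \<and> u \<le> 1"
    have "Z ((1 - u) *\<^sub>R fst x + u *\<^sub>R fst y) \<le> (1 - u) * Z (fst x) + u * Z (fst y)"
      using convex_onD[OF assms, of u "fst x" "fst y"] u by auto
    also have "\<dots> < (1 - u) * snd x + u * snd y"
    proof (cases "u = 0")
      case True then show ?thesis using xy by (simp add: E_def)
    next
      case False
      then show ?thesis using xy u by (intro add_le_less_mono mult_left_mono mult_strict_left_mono) (auto simp: E_def)
    qed
    finally show "(1 - u) *\<^sub>R x + u *\<^sub>R y \<in> E" by (simp add: E_def)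
  qed
  moreover have "(0, Z 0 + 1) \<in> E" by (simp add: E_def)
  then have "E \<noteq> {}" by blast
  moreover have "{(A, Z A)} \<inter> E = {}" by (auto simp: E_def)
  ultimately have "\<exists>a b. a \<noteq> 0 \<and> (\<forall>x\<in>{(A, Z A)}. a \<bullet> x \<le> b) \<and> (\<forall>x\<in>E. b \<le> a \<bullet> x)"
    by (intro separating_hyperplane_sets) simp_all
  then obtain a b where a: "a \<noteq> 0" "a \<bullet> (A, Z A) \<le> b" "\<And>p. p \<in> E \<Longrightarrow> b \<le> a \<bullet> p"
    by blast
  obtain p \<beta> where ap: "a = (p, \<beta>)" by (cases a)
  have le: "p \<bullet> A + \<beta> * Z A \<le> p \<bullet> x + \<beta> * y" if "Z x < y" for x y
    using a(2) a(3)[of "(x, y)"] that by (simp add: ap E_def)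
  have "\<beta> \<ge> 0" using le[of A "Z A + 1"] by (simp add: algebra_simps)
  moreover have "\<beta> \<noteq> 0"
  proof
    assume "\<beta> = 0"
    then have "p \<bullet> p \<le> 0" using le[of "A - p" "Z (A - p) + 1"] by (simp add: inner_diff_right)
    then have "p = 0" by (metis inner_gt_zero_iff not_le)
    then show False using a(1) ap \<open>\<beta> = 0\<close> by (simp add: zero_prod_def)
  qed
  ultimately have \<beta>: "\<beta> > 0" by simp
  have le2: "p \<bullet> A + \<beta> * Z A \<le> p \<bullet> x + \<beta> * Z x" for x
  proof (rule field_le_epsilon)
    fix e :: real assume "e > 0"
    then show "p \<bullet> A + \<beta> * Z A \<le> p \<bullet> x + \<beta> * Z x + e"
      using le[of x "Z x + e / \<beta>"] \<beta> by (simp add: algebra_simps)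
  qed
  show ?thesis
  proof (intro exI allI)
    fix B
    have "\<beta> * (Z A + (- (1/\<beta>) *\<^sub>R p) \<bullet> (B - A)) \<le> \<beta> * Z B"
      using le2[of B] \<beta> by (simp add: algebra_simps)
    then show "Z A + (- (1/\<beta>) *\<^sub>R p) \<bullet> (B - A) \<le> Z B" using \<beta> by simp
  qed
qed

section \<open>Continuously differentiable functions and integration by parts\<close>

definition C1 :: "(vec3 \<Rightarrow> real) \<Rightarrow> bool" where
  "C1 f \<longleftrightarrow> f differentiable_on UNIV \<and> (\<forall>j. continuous_on UNIV (pderiv3 f j))"

lemma pderiv3_eq: 
  assumes "(f has_derivative D) (at x)" shows "pderiv3 f j x = D (axis j 1)"
  unfolding pderiv3_def using frechet_derivative_at[OF assms] by simp

lemma C1_has_derivative: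
  assumes "C1 f" shows "(f has_derivative frechet_derivative f (at x)) (at x)"
  using assms unfolding C1_def differentiable_on_def by (simp add: frechet_derivative_works)

lemma C1_continuous: "C1 f \<Longrightarrow> continuous_on S f"
  unfolding C1_def by (meson continuous_on_subset differentiable_imp_continuous_on subset_UNIV)

lemma C1_continuous_pderiv: "C1 f \<Longrightarrow> continuous_on S (pderiv3 f j)"
  unfolding C1_def by (meson continuous_on_subset subset_UNIV)

lemma C1_I:
  assumes "\<And>x. (f has_derivative D x) (at x)" "\<And>j. continuous_on UNIV (\<lambda>x. D x (axis j 1))"
  shows "C1 f"
proof -
  have "pderiv3 f j = (\<lambda>x. D x (axis j 1))" for j using pderiv3_eq[OF assms(1)] by blast
  then show ?thesis using assms unfolding C1_def differentiable_on_def differentiable_def by auto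
qed

lemma C1_bounded_linear: "bounded_linear f \<Longrightarrow> C1 f"
  by (rule C1_I[where D = "\<lambda>_. f"]) (auto simp: bounded_linear_imp_has_derivative)

lemma C1_const: "C1 (\<lambda>_. c)"
  by (rule C1_I[where D = "\<lambda>_ _. 0"]) auto

lemma C1_component: "C1 (\<lambda>x. x $ i)"
  by (intro C1_bounded_linear bounded_linear_vec_nth)

lemma C1_add: 
  assumes "C1 f" "C1 g" shows "C1 (\<lambda>x. f x + g x)"
proof (rule C1_I)
  show "((\<lambda>x. f x + g x) has_derivative (\<lambda>v. frechet_derivative f (at x) v + frechet_derivative g (at x) v)) (at x)" for x
    using assms by (intro derivative_intros C1_has_derivative)
  show "continuous_on UNIV (\<lambda>x. frechet_derivative f (at x) (axis j 1) + frechet_derivative g (at x) (axis j 1))" for j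
    using assms C1_continuous_pderiv unfolding pderiv3_def[symmetric] by (intro continuous_intros) auto
qed

lemma pderiv3_mult:
  assumes "C1 f" "C1 g"
  shows "pderiv3 (\<lambda>x. f x * g x) j x = f x * pderiv3 g j x + pderiv3 f j x * g x"
  using pderiv3_eq[OF has_derivative_mult[OF assms[THEN C1_has_derivative]]] by (simp add: pderiv3_def)

lemma C1_mult: 
  assumes "C1 f" "C1 g" shows "C1 (\<lambda>x. f x * g x)"
proof (rule C1_I)
  show "((\<lambda>x. f x * g x) has_derivative (\<lambda>v. f x * frechet_derivative g (at x) v + frechet_derivative f (at x) v * g x)) (at x)" for x
    using assms by (intro has_derivative_mult C1_has_derivative)
  show "continuous_on UNIV (\<lambda>x. f x * frechet_derivative g (at x) (axis j 1) + frechet_derivative f (at x) (axis j 1) * g x)" for j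
    using assms C1_continuous_pderiv C1_continuous unfolding pderiv3_def[symmetric] by (intro continuous_intros) auto
qed

lemma C1_compose:
  assumes f: "C1 f" and F: "\<And>s. (F has_real_derivative F' s) (at s)" "continuous_on UNIV F'"
  shows "C1 (\<lambda>x. F (f x))"
proof (rule C1_I)
  show "((\<lambda>x. F (f x)) has_derivative (\<lambda>v. frechet_derivative f (at x) v * F' (f x))) (at x)" for x
    using has_derivative_compose[OF C1_has_derivative[OF f] F(1)[unfolded has_field_derivative_def]]
    by (simp add: mult.commute)
  show "continuous_on UNIV (\<lambda>x. frechet_derivative f (at x) (axis j 1) * F' (f x))" for j
    using C1_continuous_pderiv[OF f] continuous_on_compose2[OF F(2) C1_continuous[OF f]] 
    unfolding pderiv3_def[symmetric] by (intro continuous_intros) auto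
qed

lemma has_derivative_translate:
  assumes "C1 f" 
  shows "((\<lambda>x. f (x + t)) has_derivative frechet_derivative f (at (x + t))) (at x)"
proof -
  have "((\<lambda>x. x + t) has_derivative (\<lambda>v. v)) (at x)" by (auto intro!: derivative_eq_intros)
  from has_derivative_compose[OF this C1_has_derivative[OF assms]] show ?thesis .
qed

lemma pderiv3_translate: "C1 f \<Longrightarrow> pderiv3 (\<lambda>x. f (x + t)) j x = pderiv3 f j (x + t)"
  using pderiv3_eq[OF has_derivative_translate] by (simp add: pderiv3_def)

lemma C1_translate:
  assumes "C1 f" shows "C1 (\<lambda>x. f (x + t))"
proof (rule C1_I)
  show "((\<lambda>x. f (x + t)) has_derivative frechet_derivative f (at (x + t))) (at x)" for x
    using assms by (rule has_derivative_translate)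
  show "continuous_on UNIV (\<lambda>x. frechet_derivative f (at (x + t)) (axis j 1))" for j
    using C1_continuous_pderiv[OF assms, of UNIV j] unfolding pderiv3_def[symmetric]
    by (rule continuous_on_compose2) (auto intro!: continuous_intros)
qed

lemma test_fn_C1: "test_fn \<Omega> f \<longleftrightarrow> C1 f \<and> (\<exists>K. compact K \<and> K \<subseteq> \<Omega> \<and> (\<forall>x. x \<notin> K \<longrightarrow> f x = 0))"
  unfolding test_fn_def C1_def pderiv3_def by auto

lemma test_fn_mono: "test_fn \<Omega> f \<Longrightarrow> test_fn UNIV f"
  unfolding test_fn_C1 by blast

lemma test_fn_mult: "test_fn \<Omega> f \<Longrightarrow> C1 g \<Longrightarrow> test_fn \<Omega> (\<lambda>x. f x * g x)"
  unfolding test_fn_C1 by (auto intro!: C1_mult)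

lemma pderiv3_outside:
  assumes "compact K" "\<And>x. x \<notin> K \<Longrightarrow> f x = 0" "x \<notin> K"
  shows "pderiv3 f j x = 0"
proof -
  have "((\<lambda>_. 0 :: real) has_derivative (\<lambda>_. 0)) (at x)" by simp
  moreover have "open (- K)" using compact_imp_closed[OF assms(1)] by (rule open_Compl)
  ultimately have "(f has_derivative (\<lambda>_. 0)) (at x)"
    by (rule has_derivative_transform_within_open) (use assms in auto)
  then show ?thesis by (rule pderiv3_eq)
qed

lemma test_fn_translate:
  assumes "test_fn UNIV f" shows "test_fn UNIV (\<lambda>x. f (x + t))"
proof -
  obtain K where K: "compact K" "\<forall>x. x \<notin> K \<longrightarrow> f x = 0" using assms unfolding test_fn_C1 by auto
  have "compact ((+) (- t) ` K)" using K by (intro compact_translation)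
  moreover have "f (x + t) = 0" if "x \<notin> (+) (- t) ` K" for x
    using K(2) that by (metis add.commute image_eqI minus_add_cancel)
  ultimately show ?thesis using assms C1_translate unfolding test_fn_C1 by blast
qed

section \<open>Integration by parts against compactly supported functions\<close>

lemma integrable_compact_support:
  fixes f :: "vec3 \<Rightarrow> real"
  assumes "continuous_on UNIV f" "compact K" "\<And>x. x \<notin> K \<Longrightarrow> f x = 0"
  shows "integrable lborel f"
proof -
  have "integrable lborel (\<lambda>x. indicator K x *\<^sub>R f x)"
    using assms by (intro borel_integrable_compact) (auto intro: continuous_on_subset)
  moreover have "(\<lambda>x. indicator K x *\<^sub>R f x) = f"
    using assms(3) by (intro ext) (case_tac "x \<in> K", simp_all)
  ultimately show ?thesis by simp
qed

lemma test_fn_integrable: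
  assumes "test_fn UNIV f" "continuous_on UNIV g"
  shows "integrable lborel (\<lambda>x. g x * f x)" "integrable lborel (\<lambda>x. g x * pderiv3 f j x)"
proof -
  obtain K where K: "compact K" "\<And>x. x \<notin> K \<Longrightarrow> f x = 0" using assms unfolding test_fn_C1 by auto
  have c: "C1 f" using assms unfolding test_fn_C1 by auto
  show "integrable lborel (\<lambda>x. g x * f x)" using K assms(2) C1_continuous[OF c]
    by (intro integrable_compact_support[of _ K]) (auto intro!: continuous_intros)
  show "integrable lborel (\<lambda>x. g x * pderiv3 f j x)" using K assms(2) C1_continuous_pderiv[OF c]
    by (intro integrable_compact_support[of _ K]) (auto intro!: continuous_intros pderiv3_outside)
qed

lemma integral_translate:
  fixes g :: "vec3 \<Rightarrow> real"
  assumes "continuous_on UNIV g"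
  shows "(\<integral>x. g (x + t) \<partial>lborel) = (\<integral>x. g x \<partial>lborel)"
proof -
  have "g \<in> borel_measurable borel" using assms by (rule borel_measurable_continuous_onI)
  then have "(\<integral>x. g x \<partial>distr lborel borel ((+) t)) = (\<integral>x. g (t + x) \<partial>lborel)"
    by (intro integral_distr) auto
  then show ?thesis by (simp add: lborel_distr_plus add.commute)
qed

lemma line_derivative:
  assumes "C1 f" shows "((\<lambda>h. f (x + h *\<^sub>R axis j 1)) has_real_derivative pderiv3 f j (x + h *\<^sub>R axis j 1)) (at h)"
proof -
  have "((\<lambda>h. x + h *\<^sub>R axis j 1) has_derivative (\<lambda>k. k *\<^sub>R axis j 1)) (at h)"
    by (auto intro!: derivative_eq_intros)
  from has_derivative_compose[OF this C1_has_derivative[OF assms]]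
  have D: "((\<lambda>h. f (x + h *\<^sub>R axis j 1)) has_derivative 
      (\<lambda>k. frechet_derivative f (at (x + h *\<^sub>R axis j 1)) (k *\<^sub>R axis j 1))) (at h)" .
  have "linear (frechet_derivative f (at (x + h *\<^sub>R axis j 1)))"
    using C1_has_derivative[OF assms] has_derivative_linear by blast
  then have "(\<lambda>k. frechet_derivative f (at (x + h *\<^sub>R axis j 1)) (k *\<^sub>R axis j 1)) 
    = (*) (pderiv3 f j (x + h *\<^sub>R axis j 1))"
    by (auto simp: linear_scale pderiv3_def)
  with D show ?thesis by (simp add: has_field_derivative_def)
qed

lemma pderiv3_bounded:
  assumes "test_fn UNIV f" shows "\<exists>B. \<forall>x. \<bar>pderiv3 f j x\<bar> \<le> B"
proof -
  obtain K where K: "compact K" "\<And>x. x \<notin> K \<Longrightarrow> f x = 0" using assms unfolding test_fn_C1 by auto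
  have c: "C1 f" using assms unfolding test_fn_C1 by auto
  have "bounded (pderiv3 f j ` K)"
    using K C1_continuous_pderiv[OF c] by (intro compact_imp_bounded compact_continuous_image)
  then obtain B where B: "\<And>x. x \<in> K \<Longrightarrow> \<bar>pderiv3 f j x\<bar> \<le> B" by (auto simp: bounded_iff)
  have "\<bar>pderiv3 f j x\<bar> \<le> max B 0" for x
    using B[of x] pderiv3_outside[OF K] by (cases "x \<in> K") (auto simp: max_def intro: order_trans)
  then show ?thesis by blast
qed

lemma diffquot_bound:
  assumes "C1 f" "\<And>x. \<bar>pderiv3 f j x\<bar> \<le> B"
  shows "\<bar>f (x + h *\<^sub>R axis j 1) - f x\<bar> \<le> B * \<bar>h\<bar>"
  using field_differentiable_bound[of UNIV "\<lambda>h. f (x + h *\<^sub>R axis j 1)" 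
      "\<lambda>h. pderiv3 f j (x + h *\<^sub>R axis j 1)" B h 0] line_derivative[OF assms(1)] assms(2)
  by auto

text \<open>Dominated convergence: the quotients are bounded by the supremum of the derivative, and
  for steps at most 1 their supports stay in one ball.\<close>

lemma diffquot_limit:
  assumes f: "test_fn UNIV f" and g: "continuous_on UNIV g"
    and h: "h \<longlonglongrightarrow> 0" "\<And>n. h n \<noteq> 0" "\<And>n. \<bar>h n\<bar> \<le> 1"
  shows "(\<lambda>n. \<integral>x. g x * ((f (x + h n *\<^sub>R axis j 1) - f x) / h n) \<partial>lborel) 
    \<longlonglongrightarrow> (\<integral>x. g x * pderiv3 f j x \<partial>lborel)"
proof -
  obtain K where K: "compact K" "\<And>x. x \<notin> K \<Longrightarrow> f x = 0" using f unfolding test_fn_C1 by auto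
  have c: "C1 f" using f unfolding test_fn_C1 by auto
  obtain B where B: "\<And>x. \<bar>pderiv3 f j x\<bar> \<le> B" using pderiv3_bounded[OF f] by blast
  obtain R where R: "\<And>x. x \<in> K \<Longrightarrow> norm x \<le> R" using compact_imp_bounded[OF K(1)] unfolding bounded_iff by blast
  define w where "w = (\<lambda>x. indicator (cball 0 (R + 1)) x *\<^sub>R (\<bar>g x\<bar> * B))"
  show ?thesis
  proof (rule integral_dominated_convergence[where w = w])
    have [measurable]: "g \<in> borel_measurable borel" "f \<in> borel_measurable borel" "pderiv3 f j \<in> borel_measurable borel"
      using g C1_continuous[OF c] C1_continuous_pderiv[OF c] by (auto intro!: borel_measurable_continuous_onI)
    show "(\<lambda>x. g x * pderiv3 f j x) \<in> borel_measurable lborel" by measurable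
    show "(\<lambda>x. g x * ((f (x + h n *\<^sub>R axis j 1) - f x) / h n)) \<in> borel_measurable lborel" for n by measurable
    show "integrable lborel w" unfolding w_def using g
      by (intro borel_integrable_compact compact_cball continuous_on_mult continuous_on_rabs continuous_on_const
          continuous_on_subset[OF g]) auto
    show "AE x in lborel. (\<lambda>n. g x * ((f (x + h n *\<^sub>R axis j 1) - f x) / h n)) \<longlonglongrightarrow> g x * pderiv3 f j x"
    proof (intro always_eventually allI tendsto_mult tendsto_const)
      fix x
      have "(\<lambda>t. (f (x + (0 + t) *\<^sub>R axis j 1) - f (x + 0 *\<^sub>R axis j 1)) / t) \<midarrow>0\<rightarrow> pderiv3 f j (x + 0 *\<^sub>R axis j 1)"
        using line_derivative[OF c, of x j 0] unfolding DERIV_def .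
      then have "(\<lambda>t. (f (x + t *\<^sub>R axis j 1) - f x) / t) \<midarrow>0\<rightarrow> pderiv3 f j x" by simp
      moreover have "filterlim h (at 0) sequentially" using h by (auto simp: filterlim_at)
      ultimately show "(\<lambda>n. (f (x + h n *\<^sub>R axis j 1) - f x) / h n) \<longlonglongrightarrow> pderiv3 f j x"
        by (rule filterlim_compose)
    qed
    show "AE x in lborel. norm (g x * ((f (x + h n *\<^sub>R axis j 1) - f x) / h n)) \<le> w x" for n
    proof (intro always_eventually allI)
      fix x
      show "norm (g x * ((f (x + h n *\<^sub>R axis j 1) - f x) / h n)) \<le> w x"
      proof (cases "x \<in> cball 0 (R + 1)")
        case True
        have "\<bar>(f (x + h n *\<^sub>R axis j 1) - f x) / h n\<bar> \<le> B"
          using diffquot_bound[OF c B, of x "h n"] h(2)[of n] by (simp add: divide_le_eq)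
        then have "\<bar>g x\<bar> * \<bar>(f (x + h n *\<^sub>R axis j 1) - f x) / h n\<bar> \<le> \<bar>g x\<bar> * B" by (rule mult_left_mono) simp
        then show ?thesis using True by (simp add: w_def abs_mult)
      next
        case False
        then have n: "norm x > R + 1" by simp
        have "x \<notin> K" using R[of x] n by auto
        moreover have "norm x \<le> norm (x + h n *\<^sub>R axis j 1) + norm (h n *\<^sub>R axis j (1::real) :: vec3)"
          using norm_triangle_ineq4[of "x + h n *\<^sub>R axis j (1::real)" "h n *\<^sub>R axis j (1::real)"] by simp
        then have "norm (x + h n *\<^sub>R axis j 1) > R" using n h(3)[of n] by simp
        then have "x + h n *\<^sub>R axis j 1 \<notin> K" using R by force
        ultimately show ?thesis using K(2) False by (simp add: w_def)
      qed
    qed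
  qed
qed

text \<open>Translation invariance makes the integral of every difference quotient vanish, and the
  limit inherits this.\<close>

lemma integral_pderiv_zero:
  assumes f: "test_fn UNIV f" shows "(\<integral>x. pderiv3 f j x \<partial>lborel) = 0"
proof -
  define h where "h = (\<lambda>n::nat. inverse (real (Suc n)))"
  have h: "h \<longlonglongrightarrow> 0" "\<And>n. h n \<noteq> 0" "\<And>n. \<bar>h n\<bar> \<le> 1"
    unfolding h_def using LIMSEQ_inverse_real_of_nat by (auto simp: inverse_le_1_iff)
  have c: "C1 f" using f unfolding test_fn_C1 by auto
  have "(\<integral>x. 1 * ((f (x + h n *\<^sub>R axis j 1) - f x) / h n) \<partial>lborel) = 0" for n
  proof -
    have "integrable lborel (\<lambda>x. f (x + h n *\<^sub>R axis j 1))" "integrable lborel f"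
      using test_fn_integrable(1)[OF test_fn_translate[OF f], of "\<lambda>_. 1"] test_fn_integrable(1)[OF f, of "\<lambda>_. 1"] by auto
    then show ?thesis using integral_translate[OF C1_continuous[OF c]] by simp
  qed
  then have "(\<lambda>n. 0) \<longlonglongrightarrow> (\<integral>x. 1 * pderiv3 f j x \<partial>lborel)"
    using diffquot_limit[OF f continuous_on_const[of UNIV 1] h, of j] by presburger
  then show ?thesis by (simp add: LIMSEQ_const_iff)
qed

lemma integral_by_parts:
  assumes f: "test_fn UNIV f" and g: "C1 g"
  shows "(\<integral>x. f x * pderiv3 g j x \<partial>lborel) = - (\<integral>x. g x * pderiv3 f j x \<partial>lborel)"
proof -
  have c: "C1 f" using f unfolding test_fn_C1 by auto
  have "(\<integral>x. pderiv3 (\<lambda>x. f x * g x) j x \<partial>lborel) = 0"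
    by (rule integral_pderiv_zero[OF test_fn_mult[OF f g]])
  moreover have "pderiv3 (\<lambda>x. f x * g x) j x = pderiv3 g j x * f x + g x * pderiv3 f j x" for x
    using pderiv3_mult[OF c g] by (simp add: mult.commute)
  moreover have "integrable lborel (\<lambda>x. pderiv3 g j x * f x)" "integrable lborel (\<lambda>x. g x * pderiv3 f j x)"
    using test_fn_integrable[OF f] C1_continuous[OF g] C1_continuous_pderiv[OF g] by auto
  ultimately show ?thesis by (simp add: mult.commute)
qed

text \<open>Second derivatives need not exist, so one of the two derivatives is replaced by a difference
  quotient, which commutes with the integration by parts of the other.\<close>
lemma integral_pderiv_commute:
  assumes f: "test_fn UNIV f" and g: "test_fn UNIV g"
  shows "(\<integral>x. pderiv3 f i x * pderiv3 g j x \<partial>lborel) = (\<integral>x. pderiv3 f j x * pderiv3 g i x \<partial>lborel)"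
proof -
  define h where "h = (\<lambda>n::nat. inverse (real (Suc n)))"
  have h: "h \<longlonglongrightarrow> 0" "\<And>n. h n \<noteq> 0" "\<And>n. \<bar>h n\<bar> \<le> 1"
    unfolding h_def using LIMSEQ_inverse_real_of_nat by (auto simp: inverse_le_1_iff)
  have h': "(\<lambda>n. - h n) \<longlonglongrightarrow> 0" "\<And>n. - h n \<noteq> 0" "\<And>n. \<bar>- h n\<bar> \<le> 1"
    using h tendsto_minus[OF h(1)] by auto
  have cf: "C1 f" and cg: "C1 g" using f g unfolding test_fn_C1 by auto
  \<comment> \<open>Integration by parts in direction \<open>i\<close> exchanges the roles of
    \<open>f\<close> and \<open>g\<close>, and a change of variables turns the shift of
    \<open>g\<close> by \<open>t\<close> into a shift of \<open>f\<close> by \<open>-t\<close>;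
    hence the step \<open>- h n\<close> on the right.\<close>
  have eq: "(\<integral>x. pderiv3 f i x * ((g (x + h n *\<^sub>R axis j 1) - g x) / h n) \<partial>lborel)
    = (\<integral>x. pderiv3 g i x * ((f (x + (- h n) *\<^sub>R axis j 1) - f x) / (- h n)) \<partial>lborel)" for n
  proof -
    define t where "t = h n *\<^sub>R (axis j 1 :: vec3)"
    have I: "integrable lborel (\<lambda>x. pderiv3 f i x * g (x + t))" "integrable lborel (\<lambda>x. pderiv3 f i x * g x)"
      "integrable lborel (\<lambda>x. pderiv3 g i x * f (x - t))" "integrable lborel (\<lambda>x. pderiv3 g i x * f x)"
      using test_fn_integrable(1)[OF test_fn_translate[OF g] C1_continuous_pderiv[OF cf]]
        test_fn_integrable(1)[OF g C1_continuous_pderiv[OF cf]]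
        test_fn_integrable(1)[OF test_fn_translate[OF f, of "- t"] C1_continuous_pderiv[OF cg]]
        test_fn_integrable(1)[OF f C1_continuous_pderiv[OF cg]] by auto
    have 1: "(\<integral>x. pderiv3 f i x * g (x + t) \<partial>lborel) = - (\<integral>x. pderiv3 g i x * f (x - t) \<partial>lborel)"
    proof -
      have "(\<integral>x. pderiv3 f i x * g (x + t) \<partial>lborel) = - (\<integral>x. f x * pderiv3 g i (x + t) \<partial>lborel)"
        using integral_by_parts[OF f C1_translate[OF cg, of t], of i] pderiv3_translate[OF cg]
        by (simp add: mult.commute)
      also have "(\<integral>x. f x * pderiv3 g i (x + t) \<partial>lborel) = (\<integral>x. f ((x + t) - t) * pderiv3 g i (x + t) \<partial>lborel)"
        by simp
      also have "\<dots> = (\<integral>x. f (x - t) * pderiv3 g i x \<partial>lborel)"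
        using integral_translate[of "\<lambda>x. f (x - t) * pderiv3 g i x" t] C1_continuous[OF C1_translate[OF cf, of "- t"], of UNIV] 
          C1_continuous_pderiv[OF cg, of UNIV i] by (simp add: continuous_on_mult)
      finally show ?thesis by (simp add: mult.commute)
    qed
    have 2: "(\<integral>x. pderiv3 f i x * g x \<partial>lborel) = - (\<integral>x. pderiv3 g i x * f x \<partial>lborel)"
      using integral_by_parts[OF f cg, of i] by (simp add: mult.commute)
    have "(\<integral>x. pderiv3 f i x * ((g (x + t) - g x) / h n) \<partial>lborel)
        = ((\<integral>x. pderiv3 f i x * g (x + t) \<partial>lborel) - (\<integral>x. pderiv3 f i x * g x \<partial>lborel)) / h n"
      using I by (simp add: right_diff_distrib flip: Bochner_Integration.integral_diff)
    also have "\<dots> = ((\<integral>x. pderiv3 g i x * f (x - t) \<partial>lborel) - (\<integral>x. pderiv3 g i x * f x \<partial>lborel)) / (- h n)"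
      unfolding 1 2 using h(2)[of n] by (simp add: field_simps)
    also have "\<dots> = (\<integral>x. pderiv3 g i x * ((f (x - t) - f x) / (- h n)) \<partial>lborel)"
      using I by (simp add: right_diff_distrib flip: Bochner_Integration.integral_diff)
    finally show ?thesis by (simp add: t_def)
  qed
  have "(\<integral>x. pderiv3 f i x * pderiv3 g j x \<partial>lborel) = (\<integral>x. pderiv3 g i x * pderiv3 f j x \<partial>lborel)"
  proof (rule LIMSEQ_unique)
    show "(\<lambda>n. \<integral>x. pderiv3 f i x * ((g (x + h n *\<^sub>R axis j 1) - g x) / h n) \<partial>lborel)
      \<longlonglongrightarrow> (\<integral>x. pderiv3 f i x * pderiv3 g j x \<partial>lborel)"
      by (rule diffquot_limit[OF g C1_continuous_pderiv[OF cf] h])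
    show "(\<lambda>n. \<integral>x. pderiv3 f i x * ((g (x + h n *\<^sub>R axis j 1) - g x) / h n) \<partial>lborel)
      \<longlonglongrightarrow> (\<integral>x. pderiv3 g i x * pderiv3 f j x \<partial>lborel)"
      unfolding eq by (rule diffquot_limit[OF f C1_continuous_pderiv[OF cg] h'])
  qed
  then show ?thesis by (simp add: mult.commute)
qed

section \<open>The fundamental lemma of the calculus of variations\<close>

text \<open>The square makes the positive part continuously differentiable at 0, while its nonzero
  set stays exactly the positive half-line.\<close>

definition possq :: "real \<Rightarrow> real" where "possq s = (max 0 s)\<^sup>2"

lemma possq_derivative: "(possq has_real_derivative 2 * max 0 s) (at s)"
proof -
  consider "s < 0" | "s = 0" | "s > 0" by linarith
  then show ?thesis
  proof cases
    case 1
    have "((\<lambda>_. 0 :: real) has_real_derivative 2 * max 0 s) (at s)" using 1 by simp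
    then show ?thesis
      by (rule has_field_derivative_transform_within_open[where S = "{..<0}"]) (use 1 in \<open>auto simp: possq_def\<close>)
  next
    case 2
    have "((\<lambda>h. possq h / h) \<longlongrightarrow> 0) (at 0)"
    proof (rule Lim_null_comparison)
      show "\<forall>\<^sub>F h in at 0. norm (possq h / h) \<le> \<bar>h\<bar>"
        by (intro always_eventually) (auto simp: possq_def max_def power2_eq_square)
      show "((\<lambda>h. \<bar>h\<bar>) \<longlongrightarrow> (0::real)) (at 0)" by (intro tendsto_rabs_zero tendsto_ident_at)
    qed
    then show ?thesis using 2 by (simp add: DERIV_def possq_def)
  next
    case 3
    have "((\<lambda>s. s\<^sup>2) has_real_derivative 2 * max 0 s) (at s)" using 3 by (auto intro!: derivative_eq_intros)
    then show ?thesis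
      by (rule has_field_derivative_transform_within_open[where S = "{0<..}"]) (use 3 in \<open>auto simp: possq_def\<close>)
  qed
qed

lemma C1_possq: "C1 f \<Longrightarrow> C1 (\<lambda>x. possq (f x))"
  by (rule C1_compose[OF _ possq_derivative]) (auto intro!: continuous_intros)

lemma possq_pos_iff: "possq s \<noteq> 0 \<longleftrightarrow> s > 0" by (auto simp: possq_def max_def)

text \<open>\<open>possq\<close> of \<open>r\<^sup>2\<close> minus the squared distance to
  \<open>c\<close>, spelled with sums and products only so that the closure rules for
  \<open>C1\<close> apply.\<close>

definition bump :: "vec3 \<Rightarrow> real \<Rightarrow> vec3 \<Rightarrow> real" where
  "bump c r x = possq (r\<^sup>2 + (-1) * ((x$1 + - c$1) * (x$1 + - c$1) + (x$2 + - c$2) * (x$2 + - c$2) + (x$3 + - c$3) * (x$3 + - c$3)))"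

lemma bump_nonzero: assumes "r > 0" shows "bump c r x \<noteq> 0 \<longleftrightarrow> x \<in> ball c r"
proof -
  have "(x$1 + - c$1) * (x$1 + - c$1) + (x$2 + - c$2) * (x$2 + - c$2) + (x$3 + - c$3) * (x$3 + - c$3) = (norm (x - c))\<^sup>2"
    unfolding power2_norm_eq_inner by (simp add: inner_vec_def sum_3)
  then have "bump c r x \<noteq> 0 \<longleftrightarrow> (norm (x - c))\<^sup>2 < r\<^sup>2" unfolding bump_def possq_pos_iff by simp
  also have "\<dots> \<longleftrightarrow> norm (x - c) < r" using assms by (metis abs_le_square_iff abs_norm_cancel abs_of_pos not_le)
  finally show ?thesis by (simp add: dist_norm norm_minus_commute)
qed

lemma bump_test_fn: assumes "r > 0" "cball c r \<subseteq> \<Omega>" shows "test_fn \<Omega> (bump c r)"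
  unfolding test_fn_C1
proof
  show "C1 (bump c r)" unfolding bump_def[abs_def]
    by (intro C1_possq C1_add C1_mult C1_const C1_component)
  have "bump c r x = 0" if "x \<notin> cball c r" for x using bump_nonzero[OF assms(1), of c x] that by auto
  then show "\<exists>K. compact K \<and> K \<subseteq> \<Omega> \<and> (\<forall>x. x \<notin> K \<longrightarrow> bump c r x = 0)" 
    using assms by (intro exI[of _ "cball c r"]) auto
qed

definition boxbump :: "vec3 \<Rightarrow> vec3 \<Rightarrow> vec3 \<Rightarrow> real" where
  "boxbump a b x = possq (x$1 + - a$1) * possq (b$1 + (-1) * x$1) *
     (possq (x$2 + - a$2) * possq (b$2 + (-1) * x$2) * (possq (x$3 + - a$3) * possq (b$3 + (-1) * x$3)))"

lemma boxbump_nonzero: "boxbump a b x \<noteq> 0 \<longleftrightarrow> x \<in> box a b"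
  unfolding boxbump_def mult_eq_0_iff de_Morgan_disj possq_pos_iff mem_box_cart forall_3 by auto

lemma C1_boxbump: "C1 (boxbump a b)"
  unfolding boxbump_def[abs_def] by (intro C1_possq C1_add C1_mult C1_const C1_component)

text \<open>As \<open>n\<close> grows this tends to the indicator of \<open>s \<noteq> 0\<close>,
  with values bounded by 1; composed with \<open>boxbump\<close> it approximates indicators of boxes
  by \<open>C1\<close> functions.\<close>

definition cutoff :: "nat \<Rightarrow> real \<Rightarrow> real" where "cutoff n s = real n * s\<^sup>2 / (1 + real n * s\<^sup>2)"

lemma cutoff_pos: "0 < 1 + real n * s\<^sup>2"
  by (intro add_pos_nonneg) auto

lemma C1_cutoff: assumes "C1 f" shows "C1 (\<lambda>x. cutoff n (f x))"
proof (rule C1_compose[OF assms, of "cutoff n" "\<lambda>s. 2 * real n * s / (1 + real n * s\<^sup>2)\<^sup>2"])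
  have p: "1 + real n * s\<^sup>2 \<noteq> 0" for s using cutoff_pos[of n s] by simp
  show "(cutoff n has_real_derivative 2 * real n * s / (1 + real n * s\<^sup>2)\<^sup>2) (at s)" for s
  proof -
    have "((\<lambda>s. 1 - inverse (1 + real n * s\<^sup>2)) has_real_derivative 2 * real n * s / (1 + real n * s\<^sup>2)\<^sup>2) (at s)"
      by (rule derivative_eq_intros refl p)+ (simp add: power2_eq_square divide_inverse)
    moreover have "cutoff n = (\<lambda>s. 1 - inverse (1 + real n * s\<^sup>2))"
      using p by (auto simp: cutoff_def fun_eq_iff divide_simps)
    ultimately show ?thesis by simp
  qed
  show "continuous_on UNIV (\<lambda>s. 2 * real n * s / (1 + real n * s\<^sup>2)\<^sup>2)"
    using p by (intro continuous_intros) auto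
qed

lemma cutoff_le: "\<bar>cutoff n s\<bar> \<le> 1"
  unfolding cutoff_def abs_divide using cutoff_pos[of n s] by (simp add: divide_le_eq abs_mult)

lemma cutoff_limit: "(\<lambda>n. cutoff n s) \<longlonglongrightarrow> (if s = 0 then 0 else 1)"
proof (cases "s = 0")
  case True then show ?thesis by (simp add: cutoff_def)
next
  case False
  have "filterlim (\<lambda>n. 1 + real n * s\<^sup>2) at_top sequentially"
    using False by (intro filterlim_tendsto_add_at_top[OF tendsto_const]
        filterlim_at_top_mult_tendsto_pos[OF tendsto_const _ filterlim_real_sequentially]) auto
  then have "(\<lambda>n. 1 - inverse (1 + real n * s\<^sup>2)) \<longlonglongrightarrow> 1 - 0"
    by (intro tendsto_diff tendsto_const tendsto_inverse_0_at_top)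
  moreover have "cutoff n s = 1 - inverse (1 + real n * s\<^sup>2)" for n
    unfolding cutoff_def using cutoff_pos[of n s] by (simp add: field_simps)
  ultimately show ?thesis using False by simp
qed

text \<open>A Dynkin argument: boxes are stable under intersection and generate the Borel sets, and
  the vanishing total integral gives closure under complements. Then all set integrals vanish, so
  the density does.\<close>

lemma AE_zero_if_box_integrals_zero:
  fixes f :: "'a :: euclidean_space \<Rightarrow> real"
  assumes f: "integrable lborel f" and box: "\<And>a b. (\<integral>x\<in>box a b. f x \<partial>lborel) = 0"
    and total: "(\<integral>x. f x \<partial>lborel) = 0"
  shows "AE x in lborel. f x = 0"
proof (rule density_unique_real[OF f])
  let ?E = "range (\<lambda>(a, b). box a b :: 'a set)"
  have si: "set_integrable lborel A f" if "A \<in> sets borel" for A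
    using integrable_mult_indicator[of A lborel f] f that by (simp add: set_integrable_def)
  fix A :: "'a set" assume "A \<in> sets lborel"
  then have A: "A \<in> sigma_sets UNIV ?E" by (simp add: borel_eq_box)
  have "Int_stable ?E" "?E \<subseteq> Pow UNIV" by (auto simp: Int_stable_def box_Int_box)
  then have "(\<integral>x\<in>A. f x \<partial>lborel) = 0"
    using A
  proof (induction rule: sigma_sets_induct_disjoint)
    case (basic A) then show ?case using box by auto
  next
    case empty then show ?case by (simp add: set_lebesgue_integral_def)
  next
    case (compl A)
    then have A: "A \<in> sets borel" by (simp add: borel_eq_box)
    have "(\<integral>x\<in>A \<union> (UNIV - A). f x \<partial>lborel) = (\<integral>x\<in>A. f x \<partial>lborel) + (\<integral>x\<in>UNIV - A. f x \<partial>lborel)"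
      using A by (intro set_integral_Un si) auto
    then show ?case using compl total by (simp add: set_lebesgue_integral_def)
  next
    case (union A)
    then have A: "A i \<in> sets borel" for i by (auto simp: borel_eq_box)
    have "(\<integral>x\<in>(\<Union>i. A i). f x \<partial>lborel) = (\<Sum>i. (\<integral>x\<in>A i. f x \<partial>lborel))"
      using A union by (intro lebesgue_integral_countable_add si) (auto simp: disjoint_family_on_def)
    then show ?case using union by simp
  qed
  then show "(\<integral>x\<in>A. f x \<partial>lborel) = (\<integral>x\<in>A. 0 \<partial>lborel)" by simp
qed simp

lemma lebesgue_on_extend:
  fixes f :: "vec3 \<Rightarrow> real"
  assumes "open \<Omega>" "\<And>x. x \<notin> \<Omega> \<Longrightarrow> f x = 0"
  shows "integrable (lebesgue_on \<Omega>) f \<longleftrightarrow> integrable lebesgue f"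
    and "(\<integral>x. f x \<partial>lebesgue_on \<Omega>) = (\<integral>x. f x \<partial>lebesgue)"
proof -
  have s: "\<Omega> \<inter> space lebesgue \<in> sets lebesgue" using assms(1) by auto
  have e: "(\<lambda>x. indicator \<Omega> x *\<^sub>R f x) = f"
    using assms(2) by (intro ext) (case_tac "x \<in> \<Omega>", simp_all)
  show "integrable (lebesgue_on \<Omega>) f \<longleftrightarrow> integrable lebesgue f"
    "(\<integral>x. f x \<partial>lebesgue_on \<Omega>) = (\<integral>x. f x \<partial>lebesgue)"
    using integrable_restrict_space[OF s, of f] integral_restrict_space[OF s, of f] unfolding e by auto
qed

text \<open>Integrability is known only against test functions, hence the localisation:
  \<open>f\<close> times a bump is integrable and orthogonal to every \<open>C1\<close> function,
  since a bump times such a function is again a test function. So it vanishes a.e., and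
  \<open>f\<close> vanishes a.e. on each small ball; locally negligible sets are negligible.\<close>

lemma AE_zero_if_weakly_zero:
  fixes f :: "vec3 \<Rightarrow> real"
  assumes \<Omega>: "open \<Omega>"
    and f: "\<And>\<phi>. test_fn \<Omega> \<phi> \<Longrightarrow> integrable (lebesgue_on \<Omega>) (\<lambda>x. f x * \<phi> x)"
      "\<And>\<phi>. test_fn \<Omega> \<phi> \<Longrightarrow> (\<integral>x. f x * \<phi> x \<partial>lebesgue_on \<Omega>) = 0"
  shows "AE x in lebesgue_on \<Omega>. f x = 0"
proof -
  have out: "f x * \<phi> x = 0" if "test_fn \<Omega> \<phi>" "x \<notin> \<Omega>" for \<phi> x
    using that unfolding test_fn_C1 by auto
  have f': "integrable lebesgue (\<lambda>x. f x * \<phi> x)" "(\<integral>x. f x * \<phi> x \<partial>lebesgue) = 0" if "test_fn \<Omega> \<phi>" for \<phi>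
    using f[OF that] lebesgue_on_extend[OF \<Omega>, of "\<lambda>x. f x * \<phi> x"] out[OF that] by auto
  have ball: "AE x in lebesgue. x \<in> ball c r \<longrightarrow> f x = 0" if "r > 0" "cball c r \<subseteq> \<Omega>" for c r
  proof -
    define F where "F = (\<lambda>x. f x * bump c r x)"
    have t: "test_fn \<Omega> (bump c r)" using bump_test_fn that by blast
    have F: "integrable lebesgue F" "(\<integral>x. F x \<partial>lebesgue) = 0" using f'[OF t] by (auto simp: F_def)
    \<comment> \<open>A Borel representative moves the problem to \<open>lborel\<close>, where the
      boxes generate the measurable sets.\<close>
    obtain F' where F'[measurable]: "F' \<in> borel_measurable lborel" and ae: "AE x in lborel. F x = F' x"
      using completion_ex_borel_measurable_real[of F lborel] F(1) by auto
    have ae': "AE x in lebesgue. F x = F' x" using AE_completion[OF ae] .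
    have F'l: "F' \<in> borel_measurable lebesgue" using F' by (rule measurable_completion)
    have "integrable lebesgue F'" using integrable_cong_AE_imp[OF F(1) F'l ae'] .
    then have int: "integrable lborel F'" using integrable_completion[OF F'] by simp
    have zero: "(\<integral>x. F' x * \<eta> x \<partial>lborel) = 0" if "C1 \<eta>" for \<eta>
    proof -
      have [measurable]: "\<eta> \<in> borel_measurable borel" 
        using C1_continuous[OF that] by (rule borel_measurable_continuous_onI)
      have m: "(\<lambda>x. F' x * \<eta> x) \<in> borel_measurable lborel" by measurable
      have "test_fn \<Omega> (\<lambda>x. bump c r x * \<eta> x)" using t that by (rule test_fn_mult)
      from f'[OF this] have z: "integrable lebesgue (\<lambda>x. F x * \<eta> x)" "(\<integral>x. F x * \<eta> x \<partial>lebesgue) = 0"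
        by (auto simp: F_def mult.assoc)
      have "(\<integral>x. F' x * \<eta> x \<partial>lborel) = (\<integral>x. F' x * \<eta> x \<partial>lebesgue)"
        by (rule integral_completion[OF m, symmetric])
      also have "\<dots> = (\<integral>x. F x * \<eta> x \<partial>lebesgue)"
        using z(1) ae' measurable_completion[OF m] by (intro integral_cong_AE) auto
      finally show ?thesis using z(2) by simp
    qed
    have "AE x in lborel. F' x = 0"
    proof (rule AE_zero_if_box_integrals_zero[OF int])
      show "(\<integral>x. F' x \<partial>lborel) = 0" using zero[OF C1_const, of 1] by simp
      fix a b :: vec3
      have "(\<lambda>n. \<integral>x. F' x * cutoff n (boxbump a b x) \<partial>lborel) \<longlonglongrightarrow> (\<integral>x. F' x * indicator (box a b) x \<partial>lborel)"
      proof (rule integral_dominated_convergence[where w = "\<lambda>x. \<bar>F' x\<bar>"])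
        show "integrable lborel (\<lambda>x. \<bar>F' x\<bar>)" using int by simp
        show "(\<lambda>x. F' x * indicator (box a b) x) \<in> borel_measurable lborel" by measurable
        show "(\<lambda>x. F' x * cutoff n (boxbump a b x)) \<in> borel_measurable lborel" for n
        proof -
          have [measurable]: "(\<lambda>x. cutoff n (boxbump a b x)) \<in> borel_measurable borel"
            using C1_continuous[OF C1_cutoff[OF C1_boxbump]] by (rule borel_measurable_continuous_onI)
          show ?thesis by measurable
        qed
        show "AE x in lborel. (\<lambda>n. F' x * cutoff n (boxbump a b x)) \<longlonglongrightarrow> F' x * indicator (box a b) x"
        proof (intro always_eventually allI tendsto_mult tendsto_const)
          fix x
          have "(if boxbump a b x = 0 then 0 else 1) = (indicator (box a b) x :: real)"
            using boxbump_nonzero[of a b x] by (auto simp: indicator_def)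
          then show "(\<lambda>n. cutoff n (boxbump a b x)) \<longlonglongrightarrow> indicator (box a b) x"
            using cutoff_limit[of "boxbump a b x"] by simp
        qed
        show "AE x in lborel. norm (F' x * cutoff n (boxbump a b x)) \<le> \<bar>F' x\<bar>" for n
          using cutoff_le by (intro always_eventually) (auto simp: abs_mult intro: mult_left_le)
      qed
      then have "(\<integral>x. F' x * indicator (box a b) x \<partial>lborel) = 0"
        using zero[OF C1_cutoff[OF C1_boxbump]] by (simp add: LIMSEQ_const_iff)
      then show "(\<integral>x\<in>box a b. F' x \<partial>lborel) = 0" by (simp add: set_lebesgue_integral_def mult.commute)
    qed
    then have "AE x in lebesgue. F' x = 0" by (rule AE_completion)
    with ae' show ?thesis
      by eventually_elim (use bump_nonzero[OF that(1), of c] in \<open>auto simp: F_def\<close>)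
  qed
  define N where "N = {x \<in> \<Omega>. f x \<noteq> 0}"
  have "negligible N"
  proof (rule locally_negligible_alt[THEN iffD2], rule ballI)
    fix x assume "x \<in> N"
    then have "x \<in> \<Omega>" by (simp add: N_def)
    then obtain r where r: "r > 0" "cball x r \<subseteq> \<Omega>" using \<Omega> open_contains_cball by blast
    have "{y. \<not> (y \<in> ball x r \<longrightarrow> f y = 0)} \<in> null_sets lebesgue"
      using ball[OF r] by (simp add: completion.AE_iff_null_sets)
    then have "negligible (N \<inter> ball x r)" 
      unfolding negligible_iff_null_sets[symmetric] by (rule negligible_subset) (auto simp: N_def)
    moreover have "openin (top_of_set N) (N \<inter> ball x r)" by (simp add: openin_open_Int)
    ultimately show "\<exists>U. openin (top_of_set N) U \<and> x \<in> U \<and> negligible U"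
      using \<open>x \<in> N\<close> r by (intro exI[of _ "N \<inter> ball x r"]) auto
  qed
  then have "AE x in lebesgue. x \<notin> N" by (simp add: negligible_iff_null_sets AE_not_in)
  moreover have "\<Omega> \<inter> space lebesgue \<in> sets lebesgue" using \<Omega> by auto
  ultimately show ?thesis by (subst AE_restrict_space_iff) (auto simp: N_def)
qed

section \<open>Null Lagrangians\<close>

lemma lebesgue_on_continuous:
  fixes g :: "vec3 \<Rightarrow> real"
  assumes "open \<Omega>" "continuous_on UNIV g" "\<And>x. x \<notin> \<Omega> \<Longrightarrow> g x = 0" "integrable lborel g"
  shows "integrable (lebesgue_on \<Omega>) g" "(\<integral>x. g x \<partial>lebesgue_on \<Omega>) = (\<integral>x. g x \<partial>lborel)"
proof -
  have m: "g \<in> borel_measurable lborel" using assms(4) by (rule borel_measurable_integrable)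
  show "integrable (lebesgue_on \<Omega>) g" "(\<integral>x. g x \<partial>lebesgue_on \<Omega>) = (\<integral>x. g x \<partial>lborel)"
    using lebesgue_on_extend[OF assms(1,3)] integrable_completion[OF m] integral_completion[OF m] assms(4) by auto
qed

lemma test_fn_outside:
  assumes "test_fn \<Omega> f" "x \<notin> \<Omega>" shows "f x = 0" "pderiv3 f j x = 0"
proof -
  obtain K where K: "compact K" "K \<subseteq> \<Omega>" "\<And>x. x \<notin> K \<Longrightarrow> f x = 0" using assms unfolding test_fn_C1 by auto
  then have "x \<notin> K" using assms by auto
  then show "f x = 0" "pderiv3 f j x = 0" using K pderiv3_outside[OF K(1,3)] by auto
qed

lemma test_fn_lebesgue_on:
  assumes "open \<Omega>" "test_fn \<Omega> f" "continuous_on UNIV g"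
  shows "integrable (lebesgue_on \<Omega>) (\<lambda>x. g x * f x)" 
    "(\<integral>x. g x * f x \<partial>lebesgue_on \<Omega>) = (\<integral>x. g x * f x \<partial>lborel)"
    "integrable (lebesgue_on \<Omega>) (\<lambda>x. g x * pderiv3 f j x)" 
    "(\<integral>x. g x * pderiv3 f j x \<partial>lebesgue_on \<Omega>) = (\<integral>x. g x * pderiv3 f j x \<partial>lborel)"
proof -
  have c: "C1 f" and t: "test_fn UNIV f" using assms(2) test_fn_mono by (auto simp: test_fn_C1)
  have 1: "continuous_on UNIV (\<lambda>x. g x * f x)" "continuous_on UNIV (\<lambda>x. g x * pderiv3 f j x)"
    using assms(3) C1_continuous[OF c] C1_continuous_pderiv[OF c] by (auto intro: continuous_on_mult)
  show "integrable (lebesgue_on \<Omega>) (\<lambda>x. g x * f x)" 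
    "(\<integral>x. g x * f x \<partial>lebesgue_on \<Omega>) = (\<integral>x. g x * f x \<partial>lborel)"
    using lebesgue_on_continuous[OF assms(1) 1(1)] test_fn_integrable(1)[OF t assms(3)] test_fn_outside[OF assms(2)] by auto
  show "integrable (lebesgue_on \<Omega>) (\<lambda>x. g x * pderiv3 f j x)" 
    "(\<integral>x. g x * pderiv3 f j x \<partial>lebesgue_on \<Omega>) = (\<integral>x. g x * pderiv3 f j x \<partial>lborel)"
    using lebesgue_on_continuous[OF assms(1) 1(2)] test_fn_integrable(2)[OF t assms(3)] test_fn_outside[OF assms(2)] by auto
qed

text \<open>In \<^const>\<open>sobolev0\<close> the gradients of the approximating test functions are only required to be weak ones. That they
  agree almost everywhere with the classical ones also excludes the junk value 0 of non-integrable integrands there.\<close>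
lemma weak_grad_classical:
  assumes \<Omega>: "open \<Omega>" and \<phi>: "\<And>i. test_fn \<Omega> (\<lambda>x. \<phi> x $ i)" and w: "weak_grad \<Omega> \<phi> D"
  shows "AE x in lebesgue_on \<Omega>. D x = (\<chi> i j. pderiv3 (\<lambda>x. \<phi> x $ i) j x)"
proof -
  have "AE x in lebesgue_on \<Omega>. D x $ i $ j - pderiv3 (\<lambda>x. \<phi> x $ i) j x = 0" for i j
  proof (rule AE_zero_if_weakly_zero[OF \<Omega>])
    fix \<psi> assume t: "test_fn \<Omega> \<psi>"
    let ?d = "pderiv3 (\<lambda>x. \<phi> x $ i) j"
    have c: "C1 (\<lambda>x. \<phi> x $ i)" "C1 \<psi>" using \<phi> t by (auto simp: test_fn_C1)
    have D: "integrable (lebesgue_on \<Omega>) (\<lambda>x. D x $ i $ j * \<psi> x)"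
      "(\<integral>x. D x $ i $ j * \<psi> x \<partial>lebesgue_on \<Omega>) = - (\<integral>x. \<phi> x $ i * pderiv3 \<psi> j x \<partial>lebesgue_on \<Omega>)"
      using w t unfolding weak_grad_def by auto
    have d: "integrable (lebesgue_on \<Omega>) (\<lambda>x. ?d x * \<psi> x)"
      "(\<integral>x. ?d x * \<psi> x \<partial>lebesgue_on \<Omega>) = (\<integral>x. ?d x * \<psi> x \<partial>lborel)"
      using test_fn_lebesgue_on(1,2)[OF \<Omega> t C1_continuous_pderiv[OF c(1)]] by auto
    have "(\<integral>x. \<phi> x $ i * pderiv3 \<psi> j x \<partial>lebesgue_on \<Omega>) = (\<integral>x. \<phi> x $ i * pderiv3 \<psi> j x \<partial>lborel)"
      using test_fn_lebesgue_on(4)[OF \<Omega> t C1_continuous[OF c(1)]] .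
    also have "\<dots> = - (\<integral>x. ?d x * \<psi> x \<partial>lborel)"
      using integral_by_parts[OF test_fn_mono[OF \<phi>] c(2), of i j] by (simp add: mult.commute)
    finally have "(\<integral>x. D x $ i $ j * \<psi> x \<partial>lebesgue_on \<Omega>) = (\<integral>x. ?d x * \<psi> x \<partial>lebesgue_on \<Omega>)"
      using D d by simp
    with D d show "integrable (lebesgue_on \<Omega>) (\<lambda>x. (D x $ i $ j - ?d x) * \<psi> x)"
      "(\<integral>x. (D x $ i $ j - ?d x) * \<psi> x \<partial>lebesgue_on \<Omega>) = 0"
      by (simp_all add: left_diff_distrib)
  qed
  then have "AE x in lebesgue_on \<Omega>. \<forall>i j. D x $ i $ j - pderiv3 (\<lambda>x. \<phi> x $ i) j x = 0"
    by (simp add: AE_all_countable)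
  then show ?thesis by eventually_elim (simp add: vec_eq_iff)
qed

section \<open>Passing to the limit from test functions to Sobolev maps\<close>

lemma complete_lebesgue_on: 
  assumes "\<Omega> \<in> sets lebesgue" shows "complete_measure (lebesgue_on \<Omega>)"
proof
  fix A B assume "B \<subseteq> A" "A \<in> null_sets (lebesgue_on \<Omega>)"
  then have "B \<subseteq> \<Omega>" "B \<in> sets lebesgue"
    using assms completion.complete[of B A lborel] by (auto simp: null_sets_restrict_space)
  then show "B \<in> sets (lebesgue_on \<Omega>)" using assms by (simp add: sets_restrict_space_iff)
qed

text \<open>The approximating weak gradients in \<open>sobolev0\<close> carry no explicit
  measurability condition; completeness lets them inherit it from the classical gradients.\<close>

lemma (in complete_measure) measurable_AE_cong:
  assumes "g \<in> measurable M N" "AE x in M. f x = g x" "\<And>x. x \<in> space M \<Longrightarrow> f x \<in> space N"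
  shows "f \<in> measurable M N"
proof (rule measurableI)
  fix A assume "A \<in> sets N"
  then have 1: "g -` A \<inter> space M \<in> sets M" using assms(1) by (rule measurable_sets[rotated])
  have "AE x in M. x \<in> g -` A \<inter> space M \<longleftrightarrow> x \<in> f -` A \<inter> space M" using assms(2) by eventually_elim auto
  then show "f -` A \<inter> space M \<in> sets M" using 1 by (rule in_sets_AE) auto
qed (use assms(3) in simp)

text \<open>The error may contain a fixed integrable \<open>W\<close> with a small factor
  \<open>d\<close>, besides a vanishing part whose constant depends on \<open>d\<close>. First
  \<open>n\<close> tends to infinity, then \<open>d\<close> to 0.\<close>

lemma integral_zero_by_approximation:
  fixes f W :: "'a \<Rightarrow> real"
  assumes f: "integrable M f" and g: "\<And>n. integrable M (g n)" "\<And>n. (\<integral>x. g n x \<partial>M) = 0"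
    and W: "integrable M W" and E: "\<And>n. integrable M (E n)" "(\<lambda>n. \<integral>x. E n x \<partial>M) \<longlonglongrightarrow> 0"
    and le: "\<And>d. d > 0 \<Longrightarrow> \<exists>C. \<forall>n x. \<bar>f x - g n x\<bar> \<le> d * W x + C * E n x"
  shows "(\<integral>x. f x \<partial>M) = (0::real)"
proof -
  define w where "w = (\<integral>x. W x \<partial>M)"
  have *: "\<bar>\<integral>x. f x \<partial>M\<bar> \<le> d * w" if d: "d > 0" for d
  proof -
    obtain C where C: "\<And>n x. \<bar>f x - g n x\<bar> \<le> d * W x + C * E n x" using le[OF d] by blast
    have "\<bar>\<integral>x. f x \<partial>M\<bar> \<le> d * w + C * (\<integral>x. E n x \<partial>M)" for n
    proof -
      have "\<bar>\<integral>x. f x \<partial>M\<bar> = \<bar>\<integral>x. f x - g n x \<partial>M\<bar>" using f g by simp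
      also have "\<dots> \<le> (\<integral>x. \<bar>f x - g n x\<bar> \<partial>M)" by (rule integral_abs_bound)
      also have "\<dots> \<le> (\<integral>x. d * W x + C * E n x \<partial>M)"
        using f g W E C by (intro integral_mono) auto
      also have "\<dots> = d * w + C * (\<integral>x. E n x \<partial>M)" using W E by (simp add: w_def)
      finally show ?thesis .
    qed
    moreover have "(\<lambda>n. d * w + C * (\<integral>x. E n x \<partial>M)) \<longlonglongrightarrow> d * w + C * 0"
      by (intro tendsto_intros E)
    ultimately have "\<bar>\<integral>x. f x \<partial>M\<bar> \<le> d * w + C * 0" by (intro LIMSEQ_le_const) auto
    then show ?thesis by simp
  qed
  have "\<bar>\<integral>x. f x \<partial>M\<bar> \<le> 0"
  proof (rule field_le_epsilon)
    fix e :: real assume e: "e > 0"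
    have "\<bar>\<integral>x. f x \<partial>M\<bar> \<le> e / (\<bar>w\<bar> + 1) * w" using e by (intro *) (simp add: add_nonneg_pos)
    also have "\<dots> \<le> e / (\<bar>w\<bar> + 1) * (\<bar>w\<bar> + 1)" using e by (intro mult_left_mono) auto
    also have "\<dots> = 0 + e" by (simp add: add_nonneg_eq_0_iff)
    finally show "\<bar>\<integral>x. f x \<partial>M\<bar> \<le> 0 + e" .
  qed
  then show ?thesis by simp
qed

text \<open>Once \<open>t powr a\<close> exceeds \<open>d\<close>, its quotient by \<open>d\<close>
  is at least 1, and a suitable power of it lifts the exponent from \<open>a\<close> to
  \<open>p\<close>.\<close>

lemma powr_interpolate:
  fixes t d a p :: real
  assumes "0 \<le> t" "0 < d" "0 < a" "a \<le> p"
  shows "t powr a \<le> d + d powr ((a - p) / a) * t powr p"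
proof (cases "t powr a \<le> d")
  case True
  have "0 \<le> d powr ((a - p) / a) * t powr p" by simp
  with True show ?thesis by linarith
next
  case False
  then have t: "t > 0" using assms by (cases "t = 0") auto
  have "t powr a = (t powr a) powr ((a - p) / a) * t powr p" 
    using assms(3) by (simp add: powr_powr flip: powr_add)
  also have "\<dots> \<le> d powr ((a - p) / a) * t powr p"
    using False assms by (intro mult_right_mono powr_mono2') (auto simp: divide_nonpos_pos)
  finally show ?thesis using assms by linarith
qed

text \<open>Each product changes by at most \<open>2 * (E * X) + E\<^sup>2\<close>. The square of
  \<open>d * X - 2 * E\<close> splits the mixed terms, which is the origin of \<open>4 / d\<close>;
  the 2 counts the two products.\<close>

lemma minor_diff_bound:
  fixes x1 x2 x3 x4 g1 g2 g3 g4 X E d :: real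
  assumes x: "\<bar>x1\<bar> \<le> X" "\<bar>x2\<bar> \<le> X" "\<bar>x3\<bar> \<le> X" "\<bar>x4\<bar> \<le> X" and d: "d > 0"
    and e: "\<bar>g1 - x1\<bar> \<le> E" "\<bar>g2 - x2\<bar> \<le> E" "\<bar>g3 - x3\<bar> \<le> E" "\<bar>g4 - x4\<bar> \<le> E"
  shows "\<bar>(x1 * x2 - x3 * x4) - (g1 * g2 - g3 * g4)\<bar> \<le> d * X\<^sup>2 + (4 / d + 2) * E\<^sup>2"
proof -
  have *: "\<bar>a * b - g * h\<bar> \<le> 2 * (E * X) + E\<^sup>2"
    if "\<bar>a\<bar> \<le> X" "\<bar>b\<bar> \<le> X" "\<bar>g - a\<bar> \<le> E" "\<bar>h - b\<bar> \<le> E" for a b g h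
  proof -
    have "a * b - g * h = - ((g - a) * b) - a * (h - b) - (g - a) * (h - b)" by (simp add: algebra_simps)
    moreover have "\<bar>(g - a) * b\<bar> \<le> E * X" "\<bar>a * (h - b)\<bar> \<le> X * E" "\<bar>(g - a) * (h - b)\<bar> \<le> E * E"
      unfolding abs_mult using that by (auto intro!: mult_mono)
    ultimately show ?thesis by (simp add: power2_eq_square mult.commute abs_le_iff)
  qed
  have "0 \<le> (d * X - 2 * E)\<^sup>2 / d" using d by simp
  also have "\<dots> = d * X\<^sup>2 - 4 * (E * X) + 4 / d * E\<^sup>2" using d by (simp add: power2_eq_square field_simps)
  finally have "4 * (E * X) \<le> d * X\<^sup>2 + 4 / d * E\<^sup>2" by simp
  moreover have "\<bar>x1 * x2 - g1 * g2\<bar> \<le> 2 * (E * X) + E\<^sup>2" "\<bar>x3 * x4 - g3 * g4\<bar> \<le> 2 * (E * X) + E\<^sup>2"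
    using * x e by auto
  ultimately show ?thesis by (simp add: distrib_right)
qed

lemma abs_entry_le_norm: "\<bar>(A :: mat3) $ i $ j\<bar> \<le> norm A"
  using component_le_norm_cart[of "A$i" j] Finite_Cartesian_Product.norm_nth_le[of A i] by linarith

lemma norm_powr_add_le:
  fixes a b :: "'a :: real_normed_vector"
  assumes "0 \<le> p" "norm a \<le> B"
  shows "norm (a - b) powr p \<le> (2 * B) powr p + 2 powr p * norm b powr p"
proof -
  have B: "0 \<le> B" using norm_ge_zero[of a] assms(2) by linarith
  have "norm (a - b) \<le> norm a + norm b" by (rule norm_triangle_ineq4)
  then have "norm (a - b) \<le> 2 * B \<or> norm (a - b) \<le> 2 * norm b" using assms(2) by linarith
  then show ?thesis
  proof
    assume "norm (a - b) \<le> 2 * B"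
    then have "norm (a - b) powr p \<le> (2 * B) powr p" using assms(1) by (intro powr_mono2) auto
    moreover have "0 \<le> 2 powr p * norm b powr p" by simp
    ultimately show ?thesis by linarith
  next
    assume "norm (a - b) \<le> 2 * norm b"
    then have "norm (a - b) powr p \<le> (2 * norm b) powr p" using assms(1) by (intro powr_mono2) auto
    also have "\<dots> = 2 powr p * norm b powr p" by (rule powr_mult)
    finally show ?thesis by (simp add: add_increasing)
  qed
qed

lemma finite_measure_lebesgue_on:
  assumes "open \<Omega>" "bounded \<Omega>" shows "finite_measure (lebesgue_on (\<Omega> :: vec3 set))"
proof
  have "emeasure lborel \<Omega> < \<infinity>" by (rule emeasure_bounded_finite[OF assms(2)])
  then show "emeasure (lebesgue_on \<Omega>) (space (lebesgue_on \<Omega>)) \<noteq> \<infinity>"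
    using assms by (simp add: emeasure_restrict_space space_restrict_space)
qed

text \<open>For test functions the integrals vanish: one derivative integrates to zero, and in a 2x2
  minor the two derivatives may be interchanged. Both expressions are at most quadratic, hence pass
  to limits in \<open>L^p\<close> with \<open>p \<ge> 2\<close> on a bounded domain.\<close>

lemma null_lagrangian:
  fixes \<Omega> :: "vec3 set"
  assumes \<Omega>: "open \<Omega>" "bounded \<Omega>" and p: "2 \<le> p" and v: "sobolev0 p \<Omega> v X"
  shows "integrable (lebesgue_on \<Omega>) (\<lambda>x. X x $ i $ j)" "(\<integral>x. X x $ i $ j \<partial>lebesgue_on \<Omega>) = 0"
    and "integrable (lebesgue_on \<Omega>) (\<lambda>x. X x $ i $ a * X x $ j $ b - X x $ i $ b * X x $ j $ a)"
    and "(\<integral>x. X x $ i $ a * X x $ j $ b - X x $ i $ b * X x $ j $ a \<partial>lebesgue_on \<Omega>) = 0"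
proof -
  define M where "M = lebesgue_on \<Omega>"
  have \<Omega>s: "\<Omega> \<in> sets lebesgue" using \<Omega> by auto
  interpret finite_measure M unfolding M_def by (rule finite_measure_lebesgue_on[OF \<Omega>])
  interpret complete_measure M unfolding M_def by (rule complete_lebesgue_on[OF \<Omega>s])
  have cont: "g \<in> borel_measurable M" if "continuous_on UNIV g" for g :: "vec3 \<Rightarrow> real"
    unfolding M_def using measurable_completion[of g lborel borel] borel_measurable_continuous_onI[OF that]
    by (intro measurable_restrict_space1) auto
  have X[measurable]: "X \<in> borel_measurable M" and Xp: "integrable M (\<lambda>x. norm (X x) powr p)"
    using v unfolding sobolev0_def sobolev_def M_def by auto
  have "(\<lambda>A :: mat3. A $ i $ j) \<in> borel_measurable borel" for i j
    by (intro borel_measurable_continuous_onI continuous_intros)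
  from measurable_compose[OF X this] have Xij[measurable]: "(\<lambda>x. X x $ i $ j) \<in> borel_measurable M" for i j .
  obtain \<phi> D where \<phi>: "\<And>n i. test_fn \<Omega> (\<lambda>x. \<phi> n x $ i)" "\<And>n. weak_grad \<Omega> (\<phi> n) (D n)"
    and lim: "(\<lambda>n. \<integral>x. norm (D n x - X x) powr p \<partial>M) \<longlonglongrightarrow> 0"
    using v unfolding sobolev0_def M_def by blast
  define g where "g = (\<lambda>n x. \<chi> i j. pderiv3 (\<lambda>x. \<phi> n x $ i) j x)"
  have g_nth: "g n x $ i $ j = pderiv3 (\<lambda>x. \<phi> n x $ i) j x" for n x i j by (simp add: g_def)
  have D: "AE x in M. D n x = g n x" for n
    using weak_grad_classical[OF \<Omega>(1) \<phi>(1) \<phi>(2)] unfolding M_def g_def .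
  have t: "test_fn UNIV (\<lambda>x. \<phi> n x $ i)" for n i using \<phi>(1) test_fn_mono by blast
  have c: "C1 (\<lambda>x. \<phi> n x $ i)" for n i using \<phi>(1) by (simp add: test_fn_C1)
  have gcont: "continuous_on UNIV (\<lambda>x. g n x $ i $ j)" for n i j unfolding g_nth by (rule C1_continuous_pderiv[OF c])
  have "continuous_on UNIV (g n)" for n unfolding g_def by (intro continuous_on_vec_lambda C1_continuous_pderiv c)
  then have gm[measurable]: "g n \<in> borel_measurable M" for n
    unfolding M_def using measurable_completion[of "g n" lborel borel] borel_measurable_continuous_onI[of "g n"]
    by (intro measurable_restrict_space1) auto
  have Dm[measurable]: "D n \<in> borel_measurable M" for n by (rule measurable_AE_cong[OF gm D]) simp
  have "(\<integral>x. norm (D n x - X x) powr p \<partial>M) = (\<integral>x. norm (g n x - X x) powr p \<partial>M)" for n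
  proof (rule integral_cong_AE)
    show "AE x in M. norm (D n x - X x) powr p = norm (g n x - X x) powr p" using D[of n] by eventually_elim simp
  qed measurable
  then have lim': "(\<lambda>n. \<integral>x. norm (g n x - X x) powr p \<partial>M) \<longlonglongrightarrow> 0" using lim by simp
  have gb: "\<exists>B. \<forall>x. norm (g n x) \<le> B" for n
  proof -
    have "\<forall>i j. \<exists>B. \<forall>x. \<bar>g n x $ i $ j\<bar> \<le> B" unfolding g_nth using pderiv3_bounded[OF t] by blast
    then obtain B where B: "\<And>i j x. \<bar>g n x $ i $ j\<bar> \<le> B i j" by metis
    have "norm (g n x) \<le> (\<Sum>i\<in>UNIV. \<Sum>j\<in>UNIV. B i j)" for x
    proof -
      have "norm (g n x) \<le> (\<Sum>i\<in>UNIV. norm (g n x $ i))" unfolding norm_vec_def by (rule L2_set_le_sum) simp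
      also have "\<dots> \<le> (\<Sum>i\<in>UNIV. \<Sum>j\<in>UNIV. \<bar>g n x $ i $ j\<bar>)"
        by (intro sum_mono) (rule norm_le_l1_cart)
      also have "\<dots> \<le> (\<Sum>i\<in>UNIV. \<Sum>j\<in>UNIV. B i j)" by (intro sum_mono B)
      finally show ?thesis .
    qed
    then show ?thesis by blast
  qed
  have Ei: "integrable M (\<lambda>x. norm (g n x - X x) powr p)" for n
  proof -
    obtain B where B: "\<And>x. norm (g n x) \<le> B" using gb by blast
    have "integrable M (\<lambda>x. (2 * B) powr p + 2 powr p * norm (X x) powr p)" using Xp by simp
    then show ?thesis
      by (rule Bochner_Integration.integrable_bound) (use norm_powr_add_le[OF _ B] p in \<open>auto intro: order_trans\<close>)
  qed
  have X2: "integrable M (\<lambda>x. (norm (X x))\<^sup>2)"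
  proof (rule Bochner_Integration.integrable_bound)
    show "integrable M (\<lambda>x. 1 + norm (X x) powr p)" using Xp by simp
    show "AE x in M. norm ((norm (X x))\<^sup>2) \<le> norm (1 + norm (X x) powr p)"
    proof (intro always_eventually allI)
      fix x
      have "norm (X x) powr 2 \<le> 1 + 1 powr ((2 - p) / 2) * norm (X x) powr p"
        using p by (intro powr_interpolate) auto
      then show "norm ((norm (X x))\<^sup>2) \<le> norm (1 + norm (X x) powr p)" by simp
    qed
  qed measurable
  have gz: "integrable M (\<lambda>x. g n x $ i $ j)" "(\<integral>x. g n x $ i $ j \<partial>M) = 0" for n i j
    using test_fn_lebesgue_on(3,4)[OF \<Omega>(1) \<phi>(1), of "\<lambda>_. 1" n i j] integral_pderiv_zero[OF t, of n i j]
    by (simp_all add: g_nth M_def)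
  have gg: "integrable M (\<lambda>x. g n x $ i $ a * g n x $ j $ b)" 
    "(\<integral>x. g n x $ i $ a * g n x $ j $ b \<partial>M) = (\<integral>x. pderiv3 (\<lambda>x. \<phi> n x $ i) a x * pderiv3 (\<lambda>x. \<phi> n x $ j) b x \<partial>lborel)" for n i j a b
    using test_fn_lebesgue_on(3,4)[OF \<Omega>(1) \<phi>(1)[of n j] C1_continuous_pderiv[OF c[of n i], of UNIV a], of b]
    by (simp_all add: g_nth M_def)
  have gz2: "integrable M (\<lambda>x. g n x $ i $ a * g n x $ j $ b - g n x $ i $ b * g n x $ j $ a)" 
    "(\<integral>x. g n x $ i $ a * g n x $ j $ b - g n x $ i $ b * g n x $ j $ a \<partial>M) = 0" for n
    using gg integral_pderiv_commute[OF t[of n i] t[of n j], of a b] by simp_all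
  have X1: "integrable M (\<lambda>x. X x $ i $ j)" for i j
  proof (rule Bochner_Integration.integrable_bound)
    show "integrable M (\<lambda>x. 1 + (norm (X x))\<^sup>2)" using X2 by simp
    show "AE x in M. norm (X x $ i $ j) \<le> norm (1 + (norm (X x))\<^sup>2)"
    proof (intro always_eventually allI)
      fix x
      have "2 * norm (X x) \<le> 1 + (norm (X x))\<^sup>2" using sum_squares_bound[of 1 "norm (X x)"] by simp
      then show "norm (X x $ i $ j) \<le> norm (1 + (norm (X x))\<^sup>2)"
        using abs_entry_le_norm[of "X x" i j] norm_ge_zero[of "X x"] by simp
    qed
  qed measurable
  have XX: "integrable M (\<lambda>x. X x $ i $ a * X x $ j $ b)" for i j a b
  proof (rule Bochner_Integration.integrable_bound[OF X2])
    show "AE x in M. norm (X x $ i $ a * X x $ j $ b) \<le> norm ((norm (X x))\<^sup>2)"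
      by (intro always_eventually allI) (auto simp: abs_mult power2_eq_square intro!: mult_mono abs_entry_le_norm)
  qed measurable
  show "integrable (lebesgue_on \<Omega>) (\<lambda>x. X x $ i $ j)" using X1 unfolding M_def .
  show X2i: "integrable (lebesgue_on \<Omega>) (\<lambda>x. X x $ i $ a * X x $ j $ b - X x $ i $ b * X x $ j $ a)"
    using XX unfolding M_def by simp
  have e: "\<bar>g n x $ i $ j - X x $ i $ j\<bar> \<le> norm (g n x - X x)" for n x i j
    using abs_entry_le_norm[of "g n x - X x" i j] by simp
  have "(\<integral>x. X x $ i $ j \<partial>M) = 0"
  proof (rule integral_zero_by_approximation[OF X1 gz _ Ei lim'])
    show "integrable M (\<lambda>_. 1)" by simp
    fix d :: real assume d: "d > 0"
    have "\<bar>X x $ i $ j - g n x $ i $ j\<bar> \<le> d * 1 + d powr ((1 - p) / 1) * norm (g n x - X x) powr p" for n x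
      using powr_interpolate[of "norm (g n x - X x)" d 1 p] d p e[of n x i j] by (simp add: abs_minus_commute)
    then show "\<exists>C. \<forall>n x. \<bar>X x $ i $ j - g n x $ i $ j\<bar> \<le> d * 1 + C * norm (g n x - X x) powr p" by blast
  qed
  then show "(\<integral>x. X x $ i $ j \<partial>lebesgue_on \<Omega>) = 0" unfolding M_def .
  have "(\<integral>x. X x $ i $ a * X x $ j $ b - X x $ i $ b * X x $ j $ a \<partial>M) = 0"
  proof (rule integral_zero_by_approximation[OF X2i[folded M_def] gz2 _ Ei lim'])
    show "integrable M (\<lambda>x. (norm (X x))\<^sup>2 + 1)" using X2 by simp
    fix d :: real assume d: "d > 0"
    \<comment> \<open>\<open>k\<close> is the coefficient of the squared error in
      \<open>minor_diff_bound\<close>. Interpolating with \<open>d / k\<close> makes its constant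
      part equal to \<open>d\<close>, which the summand 1 in the majorant absorbs.\<close>
    define k where "k = 4 / d + 2"
    have k: "k > 0" using d by (simp add: k_def add_pos_pos)
    define C where "C = (d / k) powr ((2 - p) / 2)"
    have "\<bar>(X x $ i $ a * X x $ j $ b - X x $ i $ b * X x $ j $ a) - (g n x $ i $ a * g n x $ j $ b - g n x $ i $ b * g n x $ j $ a)\<bar>
      \<le> d * ((norm (X x))\<^sup>2 + 1) + (k * C) * norm (g n x - X x) powr p" for n x
    proof -
      have "(norm (g n x - X x))\<^sup>2 \<le> d / k + C * norm (g n x - X x) powr p"
        using powr_interpolate[of "norm (g n x - X x)" "d / k" 2 p] d k p by (simp add: C_def)
      then have "k * (norm (g n x - X x))\<^sup>2 \<le> k * (d / k + C * norm (g n x - X x) powr p)"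
        using k by (intro mult_left_mono) auto
      also have "\<dots> = d + k * C * norm (g n x - X x) powr p" using k by (simp add: distrib_left)
      finally show ?thesis
        using minor_diff_bound[OF abs_entry_le_norm[of "X x" i a] abs_entry_le_norm[of "X x" j b]
            abs_entry_le_norm[of "X x" i b] abs_entry_le_norm[of "X x" j a] d
            e[of n x i a] e[of n x j b] e[of n x i b] e[of n x j a]]
        unfolding k_def[symmetric] by (simp add: distrib_left)
    qed
    then show "\<exists>C. \<forall>n x. \<bar>(X x $ i $ a * X x $ j $ b - X x $ i $ b * X x $ j $ a) 
      - (g n x $ i $ a * g n x $ j $ b - g n x $ i $ b * g n x $ j $ a)\<bar>
      \<le> d * ((norm (X x))\<^sup>2 + 1) + C * norm (g n x - X x) powr p" by blast
  qed
  then show "(\<integral>x. X x $ i $ a * X x $ j $ b - X x $ i $ b * X x $ j $ a \<partial>lebesgue_on \<Omega>) = 0" unfolding M_def .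
qed

section \<open>Energy estimates\<close>

lemma cof_minor: "\<exists>k l a b. \<forall>X. cof X $ i $ j = X $ k $ a * X $ l $ b - X $ k $ b * X $ l $ a"
  using exhaust_3[of i] exhaust_3[of j] by (auto simp: cof_entries) blast+

text \<open>Cofactors are quadratic, so the shift contributes only terms linear in \<open>X\<close>.
  Thus the increment of the cofactor of \<open>Du\<close> consists of minors and entries of
  \<open>X = Du - mat lam\<close>, all null Lagrangians with zero boundary values.\<close>

lemma cof_shift: 
  "cof (X + mat l) $ i $ j - cof (mat l) $ i $ j = cof X $ i $ j + l * (if i = j then trace X else 0) - l * X $ j $ i"
  using exhaust_3[of i] exhaust_3[of j] 
  by (auto simp: cof_entries mat_def trace_def sum_3 algebra_simps)

lemma mat_scaleR: "mat c = c *\<^sub>R (mat 1 :: mat3)"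
  by (simp add: mat_def vec_eq_iff)

text \<open>Every term is homogeneous of degree \<open>q\<close> when \<open>A\<close> and the base
  point are scaled together.\<close>

lemma kappa_scale:
  assumes "lam > 0" "\<mu> > 0" and
    k: "\<And>A :: mat3. norm A powr q \<ge> norm (mat lam :: mat3) powr q
        + q * norm (mat lam :: mat3) powr (q - 2) * (mat lam \<bullet> (A - mat lam)) + \<kappa> * norm (A - mat lam) powr q"
  shows "norm (A :: mat3) powr q \<ge> norm (mat \<mu> :: mat3) powr q
        + q * norm (mat \<mu> :: mat3) powr (q - 2) * (mat \<mu> \<bullet> (A - mat \<mu>)) + \<kappa> * norm (A - mat \<mu>) powr q"
proof -
  define c where "c = lam / \<mu>"
  have c: "c > 0" using assms by (simp add: c_def)
  have m: "mat lam = c *\<^sub>R (mat \<mu> :: mat3)" using assms by (simp add: mat_scaleR[of lam] mat_scaleR[of \<mu>] c_def)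
  have n: "norm (c *\<^sub>R B) powr r = c powr r * norm B powr r" for B :: mat3 and r
    using c by (simp add: powr_mult)
  have c2: "c powr (q - 2) * (c * c) = c powr q"
  proof -
    have "c * c = c powr 2" using c by (simp add: power2_eq_square)
    then show ?thesis by (simp flip: powr_add)
  qed
  have "c powr q * (norm (mat \<mu> :: mat3) powr q) + q * (c powr (q - 2) * (c * c)) * norm (mat \<mu> :: mat3) powr (q - 2)
      * (mat \<mu> \<bullet> (A - mat \<mu>)) + c powr q * (\<kappa> * norm (A - mat \<mu>) powr q) \<le> c powr q * norm A powr q"
    using k[of "c *\<^sub>R A"] unfolding m n scaleR_diff_right[symmetric] by (simp add: mult.assoc mult.left_commute)
  then have "c powr q * (norm (mat \<mu> :: mat3) powr q + q * norm (mat \<mu> :: mat3) powr (q - 2)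
      * (mat \<mu> \<bullet> (A - mat \<mu>)) + \<kappa> * norm (A - mat \<mu>) powr q) \<le> c powr q * norm A powr q"
    unfolding c2 by (simp add: algebra_simps)
  then show ?thesis using c by simp
qed

text \<open>The integrand may change sign, and \<open>ennreal\<close> truncates its negative values
  to 0; hence only an inequality.\<close>

lemma ennreal_integral_le_nn_integral:
  assumes "integrable M f" shows "ennreal (\<integral>x. f x \<partial>M) \<le> (\<integral>\<^sup>+x. ennreal (f x) \<partial>M)"
proof -
  have i: "integrable M (\<lambda>x. max 0 (f x))" using assms by simp
  have "ennreal (\<integral>x. f x \<partial>M) \<le> ennreal (\<integral>x. max 0 (f x) \<partial>M)"
    using assms i by (intro ennreal_leI integral_mono) auto
  also have "\<dots> = (\<integral>\<^sup>+x. ennreal (max 0 (f x)) \<partial>M)" using i by (intro nn_integral_eq_integral[symmetric]) auto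
  also have "\<dots> = (\<integral>\<^sup>+x. ennreal (f x) \<partial>M)" by (intro nn_integral_cong) (auto simp: max_def ennreal_neg)
  finally show ?thesis .
qed

lemma det_mat3: "det (mat lam :: mat3) = lam ^ 3"
  by (simp add: det_3 mat_def power3_eq_cube)

lemma null_affine:
  assumes \<Omega>: "open \<Omega>" "bounded \<Omega>" and p: "2 \<le> p" and u: "admissible p \<Omega> lam u Du"
  shows "integrable (lebesgue_on \<Omega>) (\<lambda>x. a * trace (Du x - mat lam) + S \<bullet> (cof (Du x) - cof (mat lam)))"
    "(\<integral>x. a * trace (Du x - mat lam) + S \<bullet> (cof (Du x) - cof (mat lam)) \<partial>lebesgue_on \<Omega>) = 0"
proof -
  define X where "X = (\<lambda>x. Du x - mat lam)"
  have tX: "Du x - mat lam = X x" for x by (simp add: X_def)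
  have v: "sobolev0 p \<Omega> (\<lambda>x. u x - lam *\<^sub>R x) X" using u by (simp add: admissible_def X_def)
  note N = null_lagrangian[OF \<Omega> p v]
  have C: "integrable (lebesgue_on \<Omega>) (\<lambda>x. cof (X x) $ i $ j)" "(\<integral>x. cof (X x) $ i $ j \<partial>lebesgue_on \<Omega>) = 0" for i j
  proof -
    obtain k l c b where "\<And>X. cof X $ i $ j = X $ k $ c * X $ l $ b - X $ k $ b * X $ l $ c" using cof_minor by metis
    then show "integrable (lebesgue_on \<Omega>) (\<lambda>x. cof (X x) $ i $ j)" "(\<integral>x. cof (X x) $ i $ j \<partial>lebesgue_on \<Omega>) = 0"
      using N(3,4) by simp_all
  qed
  have T: "integrable (lebesgue_on \<Omega>) (\<lambda>x. trace (X x))" "(\<integral>x. trace (X x) \<partial>lebesgue_on \<Omega>) = 0"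
    unfolding trace_def using N(1,2) by simp_all
  have "cof (Du x) - cof (mat lam) = (\<chi> i j. cof (X x) $ i $ j + lam * (if i = j then trace (X x) else 0) - lam * X x $ j $ i)" for x
    using cof_shift[of "X x" lam] by (simp add: vec_eq_iff X_def)
  moreover define F where "F = (\<lambda>i j x. S$i$j * (cof (X x) $ i $ j + lam * (if i = j then trace (X x) else 0) - lam * X x $ j $ i))"
  ultimately have e: "S \<bullet> (cof (Du x) - cof (mat lam)) = (\<Sum>i\<in>UNIV. \<Sum>j\<in>UNIV. F i j x)" for x
    by (simp add: inner_vec_def)
  have F: "integrable (lebesgue_on \<Omega>) (F i j)" "(\<integral>x. F i j x \<partial>lebesgue_on \<Omega>) = 0" for i j
    unfolding F_def using C[of i j] T N(1,2)[of j i] by (cases "i = j"; simp)+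
  show "integrable (lebesgue_on \<Omega>) (\<lambda>x. a * trace (Du x - mat lam) + S \<bullet> (cof (Du x) - cof (mat lam)))"
    "(\<integral>x. a * trace (Du x - mat lam) + S \<bullet> (cof (Du x) - cof (mat lam)) \<partial>lebesgue_on \<Omega>) = 0"
    unfolding e tX using T F by simp_all
qed

lemma energy_lower_bound:
  assumes \<Omega>: "open \<Omega>" "bounded \<Omega>" and p: "2 \<le> p" and u: "admissible p \<Omega> lam u Du" and lam: "lam > 0"
    and Z: "\<And>A. Z A \<ge> 0"
    and h_neg: "\<And>t. t \<le> 0 \<Longrightarrow> h t = \<infinity>" and h_fin: "\<And>t. t > 0 \<Longrightarrow> h t < \<infinity>"
    and \<rho>: "integrable (lebesgue_on \<Omega>) (\<lambda>x. \<rho> (Du x))" "\<And>A. \<rho> A \<ge> 0"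
    and le: "\<And>A. det A > 0 \<Longrightarrow> norm (mat lam :: mat3) powr q + Z (cof (mat lam)) + enn2real (h (lam ^ 3))
       + (a * trace (A - mat lam) + S \<bullet> (cof A - cof (mat lam))) + \<rho> A
       \<le> norm A powr q + Z (cof A) + enn2real (h (det A))"
  shows "energy \<Omega> q Z h (\<lambda>_. mat lam) + ennreal (\<integral>x. \<rho> (Du x) \<partial>lebesgue_on \<Omega>) \<le> energy \<Omega> q Z h Du"
proof -
  interpret finite_measure "lebesgue_on \<Omega>" by (rule finite_measure_lebesgue_on[OF \<Omega>])
  define W0 where "W0 = norm (mat lam :: mat3) powr q + Z (cof (mat lam)) + enn2real (h (lam ^ 3))"
  define L where "L = (\<lambda>A. a * trace (A - mat lam) + S \<bullet> (cof A - cof (mat lam)))"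
  have W: "Wen q Z h A = ennreal (norm A powr q + Z (cof A) + enn2real (h (det A)))" if "det A > 0" for A
  proof -
    have "h (det A) = ennreal (enn2real (h (det A)))" using h_fin[OF that] by (simp add: less_top)
    then show ?thesis unfolding Wen_def using Z[of "cof A"] by (metis add_nonneg_nonneg enn2real_nonneg ennreal_plus powr_ge_zero)
  qed
  have W0: "W0 \<ge> 0" using Z by (simp add: W0_def)
  have "Wen q Z h (mat lam) = ennreal W0" using W[of "mat lam"] lam by (simp add: det_mat3 W0_def)
  then have "energy \<Omega> q Z h (\<lambda>_. mat lam) = (\<integral>\<^sup>+x. ennreal W0 \<partial>lebesgue_on \<Omega>)" by (simp add: energy_def)
  also have "\<dots> = ennreal (\<integral>x. W0 \<partial>lebesgue_on \<Omega>)" using W0 by (intro nn_integral_eq_integral) auto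
  finally have E0: "energy \<Omega> q Z h (\<lambda>_. mat lam) = ennreal (\<integral>x. W0 \<partial>lebesgue_on \<Omega>)" .
  have L: "integrable (lebesgue_on \<Omega>) (\<lambda>x. L (Du x))" "(\<integral>x. L (Du x) \<partial>lebesgue_on \<Omega>) = 0"
    unfolding L_def using null_affine[OF \<Omega> p u] by auto
  have "energy \<Omega> q Z h (\<lambda>_. mat lam) + ennreal (\<integral>x. \<rho> (Du x) \<partial>lebesgue_on \<Omega>)
     = ennreal ((\<integral>x. W0 \<partial>lebesgue_on \<Omega>) + (\<integral>x. \<rho> (Du x) \<partial>lebesgue_on \<Omega>))"
    unfolding E0 using W0 \<rho>(2) by (intro ennreal_plus[symmetric] integral_nonneg_AE) auto
  also have "\<dots> = ennreal (\<integral>x. W0 + L (Du x) + \<rho> (Du x) \<partial>lebesgue_on \<Omega>)" using L \<rho>(1) by simp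
  also have "\<dots> \<le> (\<integral>\<^sup>+x. ennreal (W0 + L (Du x) + \<rho> (Du x)) \<partial>lebesgue_on \<Omega>)"
    using L \<rho>(1) by (intro ennreal_integral_le_nn_integral) auto
  also have "\<dots> \<le> (\<integral>\<^sup>+x. Wen q Z h (Du x) \<partial>lebesgue_on \<Omega>)"
  proof (intro nn_integral_mono)
    fix x
    show "ennreal (W0 + L (Du x) + \<rho> (Du x)) \<le> Wen q Z h (Du x)"
    proof (cases "det (Du x) > 0")
      case True
      then show ?thesis unfolding W[OF True] using le[OF True] by (intro ennreal_leI) (simp add: W0_def L_def)
    next
      case False
      then show ?thesis using h_neg[of "det (Du x)"] by (simp add: Wen_def)
    qed
  qed
  finally show ?thesis by (simp add: energy_def)
qed

text \<open>Here \<open>e\<close> is the fraction of the \<open>\<kappa>\<close> term kept in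
  reserve: 0 for minimality, positive for the energy gap.\<close>

lemma energy_density_lower_bound:
  fixes h :: "real \<Rightarrow> ennreal" and Z :: "mat3 \<Rightarrow> real"
  assumes q: "2 < q" "q < 3" and lam: "lam > 0" and \<kappa>: "\<kappa> \<ge> 0"
    and kappa: "\<And>A :: mat3. norm A powr q \<ge> norm (mat lam :: mat3) powr q
        + q * norm (mat lam :: mat3) powr (q - 2) * (mat lam \<bullet> (A - mat lam)) + \<kappa> * norm (A - mat lam) powr q"
    and Z: "convex_on UNIV Z"
    and h_convex: "convex_on {0<..} (\<lambda>t. enn2real (h t))"
    and h_deriv: "((\<lambda>t. enn2real (h t)) has_real_derivative d) (at (lam ^ 3))"
    and e: "0 \<le> e" "e \<le> 1" and d: "0 \<le> lam_quant h q lam" "lam_quant h q lam \<le> (1 - e) * lam_bound q \<kappa> lam"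
  shows "\<exists>a S. \<forall>A. det A > 0 \<longrightarrow> norm (mat lam :: mat3) powr q + Z (cof (mat lam)) + enn2real (h (lam ^ 3))
       + (a * trace (A - mat lam) + S \<bullet> (cof A - cof (mat lam))) + e * \<kappa> * norm (A - mat lam) powr q
       \<le> norm A powr q + Z (cof A) + enn2real (h (det A))"
proof -
  obtain S where S: "\<And>B. Z B \<ge> Z (cof (mat lam)) + S \<bullet> (B - cof (mat lam))"
    using convex_subgradient[OF Z] by blast
  have dq: "lam_quant h q lam = lam powr (3 - q) * d" by (simp add: lam_quant_def DERIV_imp_deriv[OF h_deriv])
  have "0 \<le> d" using d(1) lam unfolding dq by (simp add: zero_le_mult_iff)
  define k where "k = (1 - e) * (\<kappa> / 2)"
  have k: "0 \<le> k" using e \<kappa> by (simp add: k_def)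
  have "(1 - e) * lam_bound q \<kappa> lam \<le> (1 - e) * (\<kappa> / 2 * (q - 2) powr ((2 - q) / 2) * q powr (q / 2))"
    "(1 - e) * lam_bound q \<kappa> lam \<le> (1 - e) * (\<kappa> / 2 * lam powr (2 - q) * M2 lam (cstar lam) powr (q - 3) * M3 lam (cstar lam) powr (2 - q))"
    unfolding lam_bound_def by (rule mult_left_mono[OF min.cobounded1] mult_left_mono[OF min.cobounded2], use e in simp)+
  then have b: "lam powr (3 - q) * d \<le> k * Kq q"
     "lam powr (3 - q) * d \<le> k * lam powr (2 - q) * M2 lam (cstar lam) powr (q - 3) * M3 lam (cstar lam) powr (2 - q)"
    using d(2) unfolding dq k_def Kq_def by (simp_all add: mult.assoc)
  \<comment> \<open>The first part comes from the derivative of the \<open>q\<close>-th power of the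
    norm, the second from \<open>- lam * trace A\<close> inside N, multiplied by
    \<open>d * lam\<close>.\<close>
  define a where "a = q * norm (mat lam :: mat3) powr (q - 2) * lam - d * lam * lam"
  have i1: "mat c \<bullet> B = c * trace B" for c and B :: mat3
    by (simp add: inner_vec_def mat_def trace_def sum_3 forall_3 distrib_left)
  \<comment> \<open>N vanishes at \<open>\<lambda>1\<close>, as
    \<open>3 * lam\<^sup>2 - lam * (3 * lam) = 0\<close>, so it can be rewritten through increments
    of the cofactor and of the matrix.\<close>
  have tc: "trace (cof (mat lam)) - lam * trace (mat lam :: mat3) = 0"
    by (simp add: trace_def sum_3 cof_entries mat_def)
  show ?thesis
  proof (intro exI allI impI)
    fix A :: mat3 assume A: "det A > 0"
    have h1: "enn2real (h (det A)) \<ge> enn2real (h (lam ^ 3)) + d * (det A - lam ^ 3)"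
      using convex_on_imp_above_tangent[OF h_convex, of "lam ^ 3" "det A" d] h_deriv A lam
      by (simp add: interior_open has_field_derivative_at_within)
    have G: "d * (det A - lam ^ 3) \<ge> d * lam * (trace (cof A) - lam * trace A) - 2 * k * norm (A - mat lam) powr q"
      by (rule Gfun_pointwise[OF lam q k A \<open>0 \<le> d\<close> b])
    have TE: "trace (cof A) - lam * trace A = trace (cof A - cof (mat lam)) - lam * trace (A - mat lam)"
      using tc by (simp add: trace_sub algebra_simps)
    have "d * lam * (trace (cof A) - lam * trace A) = mat (d * lam) \<bullet> (cof A - cof (mat lam)) - d * lam * lam * trace (A - mat lam)"
      unfolding i1 TE by (simp add: algebra_simps)
    moreover have "2 * k * norm (A - mat lam) powr q = \<kappa> * norm (A - mat lam) powr q - e * \<kappa> * norm (A - mat lam) powr q"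
      by (simp add: k_def field_simps)
    moreover have "a * trace (A - mat lam) = q * norm (mat lam :: mat3) powr (q - 2) * (mat lam \<bullet> (A - mat lam))
        - d * lam * lam * trace (A - mat lam)"
      unfolding i1 by (simp add: a_def algebra_simps)
    ultimately show "norm (mat lam :: mat3) powr q + Z (cof (mat lam)) + enn2real (h (lam ^ 3))
       + (a * trace (A - mat lam) + (S + mat (d * lam)) \<bullet> (cof A - cof (mat lam))) + e * \<kappa> * norm (A - mat lam) powr q
       \<le> norm A powr q + Z (cof A) + enn2real (h (det A))"
      using h1 G S[of "cof A"] kappa[of A] unfolding inner_add_left by linarith
  qed
qed

lemma minimizer_if_lam_cond:
  fixes \<Omega> :: "vec3 set" and h :: "real \<Rightarrow> ennreal" and Z :: "mat3 \<Rightarrow> real"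
  assumes \<Omega>: "open \<Omega>" "bounded \<Omega>" and q: "2 < q" "q < 3" and lam: "lam > 0" and \<kappa>: "\<kappa> \<ge> 0"
    and kappa: "\<And>A :: mat3. norm A powr q \<ge> norm (mat lam :: mat3) powr q
        + q * norm (mat lam :: mat3) powr (q - 2) * (mat lam \<bullet> (A - mat lam)) + \<kappa> * norm (A - mat lam) powr q"
    and Z: "convex_on UNIV Z" "\<And>A. Z A \<ge> 0"
    and h_neg: "\<And>t. t \<le> 0 \<Longrightarrow> h t = \<infinity>" and h_fin: "\<And>t. t > 0 \<Longrightarrow> h t < \<infinity>"
    and h_convex: "convex_on {0<..} (\<lambda>t. enn2real (h t))"
    and h_deriv: "((\<lambda>t. enn2real (h t)) has_real_derivative d) (at (lam ^ 3))"
    and cond: "lam_cond h q \<kappa> lam"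
  shows "minimizer \<Omega> q Z h lam"
  unfolding minimizer_def
proof (intro allI impI)
  fix u Du assume u: "admissible 2 \<Omega> lam u Du"
  have "0 \<le> lam_quant h q lam" "lam_quant h q lam \<le> (1 - 0) * lam_bound q \<kappa> lam"
    using cond by (auto simp: lam_cond_def)
  from energy_density_lower_bound[OF q lam \<kappa> kappa Z(1) h_convex h_deriv _ _ this]
  obtain a S where le: "\<And>A. det A > 0 \<Longrightarrow> norm (mat lam :: mat3) powr q + Z (cof (mat lam)) + enn2real (h (lam ^ 3))
       + (a * trace (A - mat lam) + S \<bullet> (cof A - cof (mat lam))) + 0 
       \<le> norm A powr q + Z (cof A) + enn2real (h (det A))"
    by auto
  have "energy \<Omega> q Z h (\<lambda>_. mat lam) + ennreal (\<integral>x. 0 \<partial>lebesgue_on \<Omega>) \<le> energy \<Omega> q Z h Du"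
    by (rule energy_lower_bound[OF \<Omega> order_refl u lam Z(2) h_neg h_fin _ _ le]) auto
  then show "energy \<Omega> q Z h (\<lambda>_. mat lam) \<le> energy \<Omega> q Z h Du" by simp
qed

lemma uniform_energy_gap:
  fixes \<Omega> :: "vec3 set" and h :: "real \<Rightarrow> ennreal" and Z :: "mat3 \<Rightarrow> real"
  assumes \<Omega>: "open \<Omega>" "bounded \<Omega>" and q: "2 < q" "q < 3" and lam: "lam > 0" and \<kappa>: "\<kappa> > 0"
    and kappa: "\<And>A :: mat3. norm A powr q \<ge> norm (mat lam :: mat3) powr q
        + q * norm (mat lam :: mat3) powr (q - 2) * (mat lam \<bullet> (A - mat lam)) + \<kappa> * norm (A - mat lam) powr q"
    and Z: "convex_on UNIV Z" "\<And>A. Z A \<ge> 0"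
    and h_neg: "\<And>t. t \<le> 0 \<Longrightarrow> h t = \<infinity>" and h_fin: "\<And>t. t > 0 \<Longrightarrow> h t < \<infinity>"
    and h_convex: "convex_on {0<..} (\<lambda>t. enn2real (h t))"
    and h_deriv: "((\<lambda>t. enn2real (h t)) has_real_derivative d) (at (lam ^ 3))"
    and cond: "lam_cond_strict h q \<kappa> lam"
  shows "\<exists>C>0. \<forall>u Du. admissible q \<Omega> lam u Du \<longrightarrow>
     energy \<Omega> q Z h (\<lambda>_. mat lam)
       + ennreal C * (\<integral>\<^sup>+ x. ennreal (norm (Du x - mat lam) powr q + \<bar>Gfun lam (Du x)\<bar>) \<partial>lebesgue_on \<Omega>)
       \<le> energy \<Omega> q Z h Du"
proof -
  define m where "m = M2 lam (cstar lam) powr (q - 3) * M3 lam (cstar lam) powr (2 - q)"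
  have cs: "cstar lam > 0" using cstar_fixed_point[OF lam] by simp
  have m: "m > 0" using M2_pos[OF lam cs] M3_pos[OF lam cs] by (simp add: m_def)
  have G: "\<bar>Gfun lam A\<bar> \<le> norm (A - mat lam) powr q / m" for A
    using Gfun_le_powr[OF lam q, of A] m unfolding m_def[symmetric] by (simp add: pos_le_divide_eq mult.commute)
  \<comment> \<open>This makes \<open>(1 - e) * lam_bound q \<kappa> lam\<close> equal to
    \<open>lam_quant h q lam\<close>; the bound is positive because it strictly exceeds a
    nonnegative number.\<close>
  define e where "e = 1 - lam_quant h q lam / lam_bound q \<kappa> lam"
  have b: "0 \<le> lam_quant h q lam" "lam_quant h q lam < lam_bound q \<kappa> lam"
    using cond by (auto simp: lam_cond_strict_def)
  then have e: "0 < e" "e \<le> 1" "lam_quant h q lam \<le> (1 - e) * lam_bound q \<kappa> lam"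
    by (auto simp: e_def)
  from energy_density_lower_bound[OF q lam less_imp_le[OF \<kappa>] kappa Z(1) h_convex h_deriv less_imp_le[OF e(1)] e(2) b(1) e(3)]
  obtain a S where le: "\<And>A. det A > 0 \<Longrightarrow> norm (mat lam :: mat3) powr q + Z (cof (mat lam)) + enn2real (h (lam ^ 3))
       + (a * trace (A - mat lam) + S \<bullet> (cof A - cof (mat lam))) + e * \<kappa> * norm (A - mat lam) powr q
       \<le> norm A powr q + Z (cof A) + enn2real (h (det A))"
    by blast
  \<comment> \<open>Since G is at most \<open>1 / m\<close> times the power of the distance, the
    reserve pays for both integrands with this factor, which does not depend on
    \<open>u\<close>.\<close>
  define C where "C = e * \<kappa> / (1 + 1 / m)"
  have C: "C > 0" using e \<kappa> m by (simp add: C_def add_pos_pos)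
  define \<rho> where "\<rho> = (\<lambda>A. C * (norm (A - mat lam) powr q + \<bar>Gfun lam A\<bar>))"
  have \<rho>0: "\<rho> A \<ge> 0" for A using C by (simp add: \<rho>_def)
  have \<rho>: "\<rho> A \<le> e * \<kappa> * norm (A - mat lam) powr q" for A
  proof -
    have "\<rho> A \<le> C * ((1 + 1 / m) * norm (A - mat lam) powr q)"
      unfolding \<rho>_def using G[of A] C by (intro mult_left_mono) (auto simp: distrib_right)
    also have "\<dots> = e * \<kappa> * norm (A - mat lam) powr q"
      using m by (simp add: C_def add_pos_pos less_imp_neq[symmetric])
    finally show ?thesis .
  qed
  show ?thesis
  proof (intro exI[of _ C] conjI allI impI C)
    fix u Du assume u: "admissible q \<Omega> lam u Du"
    define f where "f = (\<lambda>x. norm (Du x - mat lam) powr q + \<bar>Gfun lam (Du x)\<bar>)"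
    have Du: "Du \<in> borel_measurable (lebesgue_on \<Omega>)" 
      and i: "integrable (lebesgue_on \<Omega>) (\<lambda>x. norm (Du x - mat lam) powr q)"
      using u unfolding admissible_def sobolev0_def sobolev_def by auto
    have "(\<lambda>x. Gfun lam (Du x)) \<in> borel_measurable (lebesgue_on \<Omega>)"
      using measurable_compose[OF Du borel_measurable_continuous_onI[OF continuous_on_Gfun]] .
    then have "integrable (lebesgue_on \<Omega>) (\<lambda>x. Gfun lam (Du x))"
      using G by (intro Bochner_Integration.integrable_bound[OF integrable_divide[OF i, of m]]) (auto simp: m less_imp_le)
    then have fi: "integrable (lebesgue_on \<Omega>) f" unfolding f_def using i by simp
    have f0: "f x \<ge> 0" for x by (simp add: f_def)
    have R: "\<rho> (Du x) = C * f x" for x by (simp add: \<rho>_def f_def)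
    have "energy \<Omega> q Z h (\<lambda>_. mat lam) + ennreal (\<integral>x. \<rho> (Du x) \<partial>lebesgue_on \<Omega>) \<le> energy \<Omega> q Z h Du"
    proof (rule energy_lower_bound[OF \<Omega> less_imp_le[OF q(1)] u lam Z(2) h_neg h_fin])
      show "integrable (lebesgue_on \<Omega>) (\<lambda>x. \<rho> (Du x))" unfolding R using fi by simp
      show "norm (mat lam :: mat3) powr q + Z (cof (mat lam)) + enn2real (h (lam ^ 3))
         + (a * trace (A - mat lam) + S \<bullet> (cof A - cof (mat lam))) + \<rho> A
         \<le> norm A powr q + Z (cof A) + enn2real (h (det A))" if "det A > 0" for A
        using le[OF that] \<rho>[of A] by linarith
    qed (use \<rho>0 in auto)
    moreover have "ennreal (\<integral>x. \<rho> (Du x) \<partial>lebesgue_on \<Omega>) = ennreal C * (\<integral>\<^sup>+x. ennreal (f x) \<partial>lebesgue_on \<Omega>)"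
      unfolding R using C f0 fi by (simp add: nn_integral_eq_integral ennreal_mult')
    ultimately show "energy \<Omega> q Z h (\<lambda>_. mat lam)
       + ennreal C * (\<integral>\<^sup>+ x. ennreal (norm (Du x - mat lam) powr q + \<bar>Gfun lam (Du x)\<bar>) \<partial>lebesgue_on \<Omega>)
       \<le> energy \<Omega> q Z h Du" by (simp add: f_def)
  qed
qed

theorem theorem3p4:
  fixes \<Omega> :: "(real^3) set" and q \<kappa> lam :: real
    and Z :: "real^3^3 \<Rightarrow> real" and h :: "real \<Rightarrow> ennreal"
  assumes dom: "open \<Omega>" "bounded \<Omega>" "\<Omega> \<noteq> {}"
    and q: "2 < q" "q < 3"
    and Z: "convex_on UNIV Z" "\<And>A. Z A \<ge> 0"
    and h_neg: "\<And>t. t \<le> 0 \<Longrightarrow> h t = \<infinity>"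
    and h_fin: "\<And>t. t > 0 \<Longrightarrow> h t < \<infinity>"
    and h_convex: "convex_on {0<..} (\<lambda>t. enn2real (h t))"
    and h_C1: "\<exists>h'. continuous_on {0<..} h' \<and>
                 (\<forall>t>0. ((\<lambda>t. enn2real (h t)) has_real_derivative h' t) (at t))"
    and h_zero: "filterlim (\<lambda>t. enn2real (h t)) at_top (at_right 0)"
    and h_inf: "Liminf at_top (\<lambda>t. ereal (enn2real (h t) / t)) > 0"
    and lam: "lam > 0"
    and kappa: "2 powr (2 - q) \<le> \<kappa>" "\<kappa> \<le> q * 2 powr (1 - q)"
    and kappa_ineq: "\<And>A :: real^3^3. norm A powr q \<ge> norm (mat lam :: real^3^3) powr q
        + q * norm (mat lam :: real^3^3) powr (q - 2) * (mat lam \<bullet> (A - mat lam))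
        + \<kappa> * norm (A - mat lam) powr q"
    and cond: "lam_cond h q \<kappa> lam"
  shows "minimizer \<Omega> q Z h lam
    \<and> Sup (ereal ` {\<mu>. \<mu> > 0 \<and> lam_cond h q \<kappa> \<mu>}) \<le> Sup (ereal ` {\<mu>. \<mu> > 0 \<and> minimizer \<Omega> q Z h \<mu>})
    \<and> (lam_cond_strict h q \<kappa> lam \<longrightarrow>
        (\<exists>C>0. \<forall>u Du. admissible q \<Omega> lam u Du \<and> energy \<Omega> q Z h Du < \<infinity> \<longrightarrow>
           energy \<Omega> q Z h Du \<ge> energy \<Omega> q Z h (\<lambda>_. mat lam)
             + ennreal C * (\<integral>\<^sup>+ x. ennreal (norm (Du x - mat lam) powr q + \<bar>Gfun lam (Du x)\<bar>) \<partial>lebesgue_on \<Omega>)))"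
proof -
  obtain h' where h': "\<And>t. t > 0 \<Longrightarrow> ((\<lambda>t. enn2real (h t)) has_real_derivative h' t) (at t)"
    using h_C1 by blast
  have \<kappa>0: "\<kappa> > 0" using kappa(1) by (rule less_le_trans[rotated]) simp
  \<comment> \<open>The statement is needed at every \<open>\<mu>\<close> for the comparison of
    suprema, so the hypothesis on \<open>\<kappa>\<close> is transported by
    \<open>kappa_scale\<close>.\<close>
  have min: "minimizer \<Omega> q Z h \<mu>" if "\<mu> > 0" "lam_cond h q \<kappa> \<mu>" for \<mu>
    using that h'[of "\<mu> ^ 3"]
    by (intro minimizer_if_lam_cond[OF dom(1,2) q that(1) less_imp_le[OF \<kappa>0] kappa_scale[OF lam that(1) kappa_ineq]
        Z h_neg h_fin h_convex _ that(2)]) auto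
  then have "ereal ` {\<mu>. \<mu> > 0 \<and> lam_cond h q \<kappa> \<mu>} \<subseteq> ereal ` {\<mu>. \<mu> > 0 \<and> minimizer \<Omega> q Z h \<mu>}" by auto
  then have "Sup (ereal ` {\<mu>. \<mu> > 0 \<and> lam_cond h q \<kappa> \<mu>}) \<le> Sup (ereal ` {\<mu>. \<mu> > 0 \<and> minimizer \<Omega> q Z h \<mu>})"
    by (rule Sup_subset_mono)
  moreover have "\<exists>C>0. \<forall>u Du. admissible q \<Omega> lam u Du \<and> energy \<Omega> q Z h Du < \<infinity> \<longrightarrow>
           energy \<Omega> q Z h Du \<ge> energy \<Omega> q Z h (\<lambda>_. mat lam)
             + ennreal C * (\<integral>\<^sup>+ x. ennreal (norm (Du x - mat lam) powr q + \<bar>Gfun lam (Du x)\<bar>) \<partial>lebesgue_on \<Omega>)"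
    if "lam_cond_strict h q \<kappa> lam"
    using uniform_energy_gap[OF dom(1,2) q lam \<kappa>0 kappa_ineq Z h_neg h_fin h_convex h'[of "lam ^ 3"] that] lam
    by auto
  ultimately show ?thesis using min[OF lam cond] by blast
qed

end
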